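(* Let $p,q,l_1,l_2$ be positive integers with $p<q$, and put $$\alpha=\left(\frac{p}{q}\right)^{\frac{l_2}{l_1}},\qquad l=\left(\frac{p}{q}\right)^{\frac{l_2}{l_1}-1},$$ so that $0<\alpha<1$ and $\alpha=\frac{p}{q}\,l$. Let $f_{(\alpha,l)}(x)$, $x>0$, denote the one-sided L\'evy stable density of index $\alpha$ (described in the context). Then: (i) If $l$ is not a positive integer and $l_1\neq l_2$, then $$f_{(\alpha,l)}(x)=\frac{l\sqrt{pq}}{x(2\pi)^{\frac{q-p}{2}}}\,H^{q,0}_{p,q}\left[\frac{p^{pl}}{x^{pl}q^{q}}\,\Big|\,{}^{(1,l),\left(\frac{1}{p},l\right),\dots,\left(\frac{p-1}{p},l\right)}_{(1,1),\left(\frac{1}{q},1\right),\dots,\left(\frac{q-1}{q},1\right)}\right]$$ $$=\frac{l\sqrt{pq}}{x(2\pi)^{\frac{q-p}{2}}}\left(\frac{p^{lp}}{x^{lp}q^{q}}\right){}_{q-1}\Psi_{p}\left[-\frac{p^{pl}}{x^{pl}q^{q}}\,\Big|\,{}^{\left(-\frac{q-1}{q},-1\right),\dots,\left(-\frac{2}{q},-1\right),\left(-\frac{1}{q},-1\right)}_{(1-l,-l),\left(\frac{q-plq}{pq},-l\right),\dots,\left(\frac{(p-1)q-plq}{pq},-l\right)}\right]$$ $$+\frac{l\sqrt{pq}}{x(2\pi)^{\frac{q-p}{2}}}\sum_{j=1}^{q-1}\left(\frac{p^{jl\frac{p}{q}}}{x^{jl\frac{p}{q}}q^{j}}\right){}_{q-1}\Psi_{p}\left[-\frac{p^{pl}}{x^{pl}q^{q}}\,\Big|\,{}^{\left(1-\left[\frac{j}{q}\right]_{q},-1\right),\left(\frac{2}{q}-\left[\frac{j}{q}\right]_{2},-1\right),\left(\frac{3}{q}-\left[\frac{j}{q}\right]_{3},-1\right),\dots,\left(\frac{q-1}{q}-\left[\frac{j}{q}\right]_{q-1},-1\right)}_{\left(\frac{pq-jpl}{pq},-l\right),\left(\frac{q-jpl}{pq},-l\right),\dots,\left(\frac{(p-1)q-jpl}{pq},-l\right)}\right].$$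 (ii) If $l=1$ and $l_1=l_2$ (so $\alpha=p/q$), then $$f_{(\alpha,1)}(x)=\frac{\sqrt{pq}}{x(2\pi)^{\frac{q-p}{2}}}\,H^{q-1,0}_{p-1,q-1}\left[\frac{p^{p}}{x^{p}q^{q}}\,\Big|\,{}^{\left(\frac{1}{p},1\right),\dots,\left(\frac{p-1}{p},1\right)}_{\left(\frac{1}{q},1\right),\dots,\left(\frac{q-1}{q},1\right)}\right]$$ $$=\frac{\sqrt{pq}}{x(2\pi)^{\frac{q-p}{2}}}\sum_{j=1}^{q-1}\left(\frac{p^{j\frac{p}{q}}}{x^{j\frac{p}{q}}q^{j}}\right)\frac{\prod_{i_1=2}^{q-1}\Gamma\!\left(\frac{i_1}{q}-\left[\frac{j}{q}\right]_{i_1}\right)}{\prod_{i_2=1}^{p-1}\Gamma\!\left(\frac{i_2q-jp}{pq}\right)}\;{}_{p-1}F_{q-2}\!\left(1-\tfrac{q-jp}{pq},\dots,1-\tfrac{(p-1)q-jp}{pq};\;1-\tfrac{2}{q}+\left[\tfrac{j}{q}\right]_{2},\dots,1-\tfrac{q-1}{q}+\left[\tfrac{j}{q}\right]_{q-1};\;(-1)^{q-p}\frac{p^{p}}{x^{p}q^{q}}\right),$$ where empty products equal $1$. (iii) If $l\in\{2,3,4,\dots\}$ and $l_1\neq l_2$, then $$f_{(\alpha,l)}(x)=\frac{\sqrt{pql}}{x(2\pi)^{\frac{q+1-p-l}{2}}}\,H^{q-1,0}_{p+l-2,q-1}\left[\frac{p^{pl}l^{l}}{x^{pl}q^{q}}\,\Big|\,{}^{\left(\frac{1}{l},1\right),\dots,\left(\frac{l-1}{l},1\right),\left(\frac{1}{p},l\right),\dots,\left(\frac{p-1}{p},l\right)}_{\left(\frac{1}{q},1\right),\dots,\left(\frac{q-1}{q},1\right)}\right]$$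 $$=\frac{\sqrt{pql}}{x(2\pi)^{\frac{q+1-l-p}{2}}}\sum_{j=1}^{q-1}\left(\frac{p^{jl\frac{p}{q}}\,l^{j\frac{l}{q}}}{x^{jl\frac{p}{q}}q^{j}}\right){}_{q-2}\Psi_{p-1+l-1}\left[-\frac{p^{pl}l^{l}}{x^{pl}q^{q}}\,\Big|\,{}^{\left(\frac{2}{q}-\left[\frac{j}{q}\right]_{2},-1\right),\left(\frac{3}{q}-\left[\frac{j}{q}\right]_{3},-1\right),\dots,\left(\frac{q-1}{q}-\left[\frac{j}{q}\right]_{q-1},-1\right)}_{\left(\frac{q-jl}{lq},-1\right),\dots,\left(\frac{(l-1)q-jl}{lq},-1\right),\left(\frac{q-jpl}{pq},-l\right),\dots,\left(\frac{(p-1)q-jpl}{pq},-l\right)}\right].$$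
   Context: One-sided L\'evy stable density: for $0<\alpha<1$ and $x>0$, $f_\alpha(x)=\frac{1}{2\pi i}\int_L \frac{\Gamma\left(\frac{1}{\alpha}-\frac{s}{\alpha}\right)}{\alpha\,\Gamma(1-s)}x^{-s}\,ds$ (with $L$ a vertical line $0<\mathrm{Re}(s)<\alpha$); this is the probability density on $(0,\infty)$ whose Laplace transform is $e^{-t^{\alpha}}$. When $\alpha=(p/q)^{l_2/l_1}$ and $l=(p/q)^{l_2/l_1-1}$, this density is written $f_{(\alpha,l)}$. Fox $H$-function: for $z>0$, $H^{m,n}_{P,Q}\left[z\,\big|\,{}^{(a_1,A_1),\dots,(a_P,A_P)}_{(b_1,B_1),\dots,(b_Q,B_Q)}\right]=\frac{1}{2\pi i}\int_L\frac{\prod_{j=1}^{m}\Gamma(b_j+B_js)\prod_{j=1}^{n}\Gamma(1-a_j-A_js)}{\prod_{j=m+1}^{Q}\Gamma(1-b_j-B_js)\prod_{j=n+1}^{P}\Gamma(a_j+A_js)}z^{-s}\,ds$, with $L$ the standard Mellin–Barnes contour separating the poles of the $\Gamma(b_j+B_js)$ from those of the $\Gamma(1-a_j-A_js)$. Generalized Wright function: ${}_P\Psi_Q\left[z\,\big|\,{}^{(a_1,A_1),\dots,(a_P,A_P)}_{(b_1,B_1),\dots,(b_Q,B_Q)}\right]=\sum_{n=0}^{\infty}\frac{\prod_{i=1}^{P}\Gamma(a_i+A_in)}{\prod_{j=1}^{Q}\Gamma(b_j+B_jn)\,n!}z^{n}$, with $A_i,B_j$ nonzero reals. Generalized hypergeometric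 series: ${}_PF_Q(a_1,\dots,a_P;b_1,\dots,b_Q;z)=\sum_{n=0}^{\infty}\frac{\prod_{i=1}^{P}(a_i)_n}{\prod_{j=1}^{Q}(b_j)_n\,n!}z^{n}$, where $(b)_n=b(b+1)\cdots(b+n-1)$, $(b)_0=1$. L\'evy jump function: for positive integers $j,n$ and the fixed $q$, $\left[\frac{j}{q}\right]_n=\frac{j}{q}$ if $j<n$, and $\left[\frac{j}{q}\right]_n=\frac{j+1}{q}$ if $j\ge n$. *)

theory Defs
  imports "HOL-Analysis.Analysis"
begin

text \<open>Integral (1/(2 pi i)) of g along the upward vertical line Re s = c.
  With s = c + i t one has ds = i dt, so this is (1/(2 pi)) times the integral over t.\<close>
definition vline_integral :: "(complex \<Rightarrow> complex) \<Rightarrow> real \<Rightarrow> complex" where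
  "vline_integral g c = complex_of_real (1 / (2 * pi)) * integral\<^sup>L lborel (\<lambda>t. g (Complex c t))"

text \<open>One-sided Levy stable density, Mellin--Barnes integral along the line Re s = c,
  where 0 < c < alpha.\<close>
definition levy_density :: "real \<Rightarrow> real \<Rightarrow> real \<Rightarrow> complex" where
  "levy_density \<alpha> c x = vline_integral
     (\<lambda>s. Gamma ((1 - s) / of_real \<alpha>) * rGamma (1 - s) / of_real \<alpha> * of_real x powr (- s)) c"

definition fox_kernel :: "nat \<Rightarrow> nat \<Rightarrow> (real \<times> real) list \<Rightarrow> (real \<times> real) list \<Rightarrow> complex \<Rightarrow> complex" where
  "fox_kernel m n as bs s =
     prod_list (map (\<lambda>(b,B). Gamma (of_real b + of_real B * s)) (take m bs)) *
     prod_list (map (\<lambda>(a,A). Gamma (1 - of_real a - of_real A * s)) (take n as)) *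
     prod_list (map (\<lambda>(b,B). rGamma (1 - of_real b - of_real B * s)) (drop m bs)) *
     prod_list (map (\<lambda>(a,A). rGamma (of_real a + of_real A * s)) (drop n as))"

text \<open>The vertical line Re s = c separates the poles of Gamma(b_j + B_j s), j \<le> m
  (which lie at Re s \<le> -b_j/B_j) from those of Gamma(1 - a_j - A_j s), j \<le> n
  (which lie at Re s \<ge> (1-a_j)/A_j).\<close>
definition fox_separating :: "nat \<Rightarrow> nat \<Rightarrow> (real \<times> real) list \<Rightarrow> (real \<times> real) list \<Rightarrow> real \<Rightarrow> bool" where
  "fox_separating m n as bs c \<longleftrightarrow>
     (\<forall>(b,B) \<in> set (take m bs). 0 < B \<and> - b / B < c) \<and>
     (\<forall>(a,A) \<in> set (take n as). 0 < A \<and> c < (1 - a) / A)"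

definition fox_H :: "nat \<Rightarrow> nat \<Rightarrow> (real \<times> real) list \<Rightarrow> (real \<times> real) list \<Rightarrow> real \<Rightarrow> real \<Rightarrow> complex" where
  "fox_H m n as bs c z = vline_integral (\<lambda>s. fox_kernel m n as bs s * of_real z powr (- s)) c"

definition wright_psi :: "(real \<times> real) list \<Rightarrow> (real \<times> real) list \<Rightarrow> real \<Rightarrow> real" where
  "wright_psi as bs z = (\<Sum>n. prod_list (map (\<lambda>(a,A). Gamma (a + A * real n)) as) *
       prod_list (map (\<lambda>(b,B). rGamma (b + B * real n)) bs) / fact n * z ^ n)"

definition hyperF :: "real list \<Rightarrow> real list \<Rightarrow> real \<Rightarrow> real" where
  "hyperF as bs z = (\<Sum>n. prod_list (map (\<lambda>a. pochhammer a n) as) /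
       prod_list (map (\<lambda>b. pochhammer b n) bs) / fact n * z ^ n)"

definition levy_jump :: "nat \<Rightarrow> nat \<Rightarrow> nat \<Rightarrow> real" where
  "levy_jump q j n = (if j < n then real j / real q else (real j + 1) / real q)"

end

theory Submission
  imports Defs "HOL-Complex_Analysis.Complex_Analysis"
begin

text \<open>
  With \<open>u = (1 - s) / \<alpha>\<close> the density becomes \<open>\<alpha> / x\<close> times the integral of
  \<open>\<Gamma>(1 + u) x\<^sup>\<alpha>\<^sup>u / \<Gamma>(1 + \<alpha>u)\<close> along any line \<open>Re u > -1\<close>. Gauss' multiplication formula turns
  \<open>\<Gamma>(1 + q s)\<close> and \<open>\<Gamma>(1 + p l s)\<close> into the Gamma products of the Fox kernels, so each H-function is the
  same integral in the variable \<open>u = q s\<close>. Moving the line to \<open>-\<infinity>\<close> past the poles \<open>u = -m\<close> gives a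
  series over \<open>m \<ge> 1\<close>; splitting it by the residue class of \<open>m\<close> modulo \<open>q\<close> and applying the residue form
  of Gauss' formula yields the Wright functions. For integral \<open>l\<close> the class \<open>m \<equiv> 0\<close> vanishes because
  \<open>1 - \<alpha> m\<close> is then a pole of \<open>\<Gamma>\<close>.
\<close>

subsection \<open>Gauss' multiplication formula\<close>

text \<open>Two growth facts carry the contour argument. On a vertical line |Gamma u| decays like
  exp (- pi |t| / 2) and 1 / |Gamma (1 + \<alpha> u)| grows like exp (pi \<alpha> |t| / 2), up to
  powers of |t|; so \<alpha> < 1 makes the line integrals converge. When the line has passed N
  poles, Gamma u has shrunk roughly like 1 / N! and the reciprocal factor has grown only like
  (\<alpha> N)!, up to geometric factors; so the remainder vanishes for every x > 0. No Stirling
  formula is used: on Re u = 1/2 the reflection formula gives exact moduli, and monotonicity and the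
  recurrence carry them to other lines. Reciprocals are written with the entire function
  \<open>rGamma\<close>, and \<open>Gamma\<close>, its inverse, is 0 at its poles. Products of Gamma
  values can therefore be inverted without exceptions; only where a factor
  \<open>Gamma (1 + s)\<close> is cancelled against \<open>rGamma (1 + s)\<close> must poles be
  excluded. All powers of 2 pi in the theorem come from the constant of Gauss' formula.\<close>

text \<open>Finite form of Gauss' formula: the n m consecutive factors are regrouped by the residue
  of their index modulo n. Each induction step adds one block of n factors, one for every
  class.\<close>

lemma pochhammer_multiplication:
  fixes z :: "'a :: field_char_0"
  assumes "n > 0"
  shows "pochhammer (of_nat n * z) (n * m) =
           of_nat n ^ (n * m) * (\<Prod>k<n. pochhammer (z + of_nat k / of_nat n) m)"
proof (induction m)
  case (Suc m)
  have "pochhammer (of_nat n * z + of_nat (n * m)) n =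
          (\<Prod>k<n. of_nat n * (z + of_nat k / of_nat n + of_nat m))"
    unfolding pochhammer_prod atLeast0LessThan using assms
    by (intro prod.cong) (auto simp: field_simps)
  also have "\<dots> = of_nat n ^ n * (\<Prod>k<n. z + of_nat k / of_nat n + of_nat m)"
    by (simp add: prod.distrib)
  finally have "pochhammer (of_nat n * z) (n * m + n) =
      of_nat n ^ (n * m) * (\<Prod>k<n. pochhammer (z + of_nat k / of_nat n) m) *
      (of_nat n ^ n * (\<Prod>k<n. z + of_nat k / of_nat n + of_nat m))"
    by (simp only: pochhammer_product' Suc.IH)
  thus ?case by (simp add: pochhammer_rec' prod.distrib power_add mult_ac add_ac)
qed simp

text \<open>Euler's limit with one factor fewer than in \<open>rGamma_series\<close>; the dropped
  factor (z + m) / m tends to 1. With exactly m factors each, n Pochhammer symbols combine to one of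
  length n m.\<close>

lemma rGamma_LIMSEQ':
  fixes z :: "'a :: Gamma"
  shows "(\<lambda>m. pochhammer z m / (fact (m - 1) * exp (z * of_real (ln (real m))))) \<longlonglongrightarrow> rGamma z"
proof -
  have inv: "(\<lambda>m. inverse (of_nat m :: 'a)) \<longlonglongrightarrow> 0" by (rule lim_inverse_n)
  have "(\<lambda>m. rGamma_series z m * inverse (z * inverse (of_nat m) + 1)) \<longlonglongrightarrow> rGamma z * inverse (z * 0 + 1)"
    by (intro tendsto_intros inv) auto
  moreover have "eventually (\<lambda>m. rGamma_series z m * inverse (z * inverse (of_nat m) + 1) =
      pochhammer z m / (fact (m - 1) * exp (z * of_real (ln (real m))))) sequentially"
  proof -
    have "(\<lambda>m. z * inverse (of_nat m) + 1) \<longlonglongrightarrow> z * 0 + 1" by (intro tendsto_intros inv)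
    hence "eventually (\<lambda>m. z * inverse (of_nat m) + 1 \<noteq> 0) sequentially"
      by (rule tendsto_imp_eventually_ne) auto
    thus ?thesis using eventually_gt_at_top[of 0]
    proof eventually_elim
      case (elim m)
      have nz: "z + of_nat m \<noteq> 0" 
      proof
        assume "z + of_nat m = 0"
        hence "z = - of_nat m" by (simp add: eq_neg_iff_add_eq_0)
        with elim show False by simp
      qed
      have inv: "inverse (z * inverse (of_nat m) + 1) = of_nat m / (z + of_nat m)"
        using elim(2) by (simp add: field_simps)
      have fact: "fact m = of_nat m * (fact (m - 1) :: 'a)"
        using elim(2) by (simp add: fact_reduce)
      have "(b * P) / ((a * F) * E) * (a / b) = P / (F * E)" if "b \<noteq> 0" "a \<noteq> 0"
        for a b P F E :: 'a using that by simp
      from this[OF nz, of "of_nat m" "pochhammer z m" "fact (m - 1)"] show ?case using elim(2)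
        unfolding rGamma_series_def inv fact Suc_eq_plus1[symmetric] pochhammer_rec' by simp
    qed
  qed
  ultimately show ?thesis by (simp add: tendsto_cong)
qed

text \<open>Gauss' formula for the m-th approximants. The last factor is free of \<open>z\<close>,
  so its limit can be found at a single convenient point.\<close>

lemma rGamma_multiplication_aux:
  fixes z :: "'a :: Gamma"
  assumes n: "n > 0" and m: "m > 0"
  shows "(\<Prod>k<n. pochhammer (z + of_nat k / of_nat n) m /
              (fact (m - 1) * exp ((z + of_nat k / of_nat n) * of_real (ln (real m))))) =
         pochhammer (of_nat n * z) (n * m) /
           (fact (n * m - 1) * exp (of_nat n * z * of_real (ln (real (n * m))))) *
         exp (of_nat n * z * of_real (ln (real n))) *
         of_real (fact (n * m - 1) / (real n ^ (n * m) * fact (m - 1) ^ n *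
           exp ((real n - 1) / 2 * ln (real m))))"
proof -
  \<comment> \<open>The offsets k / n add up to (n - 1) / 2, which is the source of the power m^((n
    - 1) / 2) in the last factor.\<close>
  have sum: "(\<Sum>k<n. of_nat k / of_nat n) = (of_real ((real n - 1) / 2) :: 'a)"
  proof -
    have "(\<Sum>k<n. real k / real n) = (real n - 1) / 2"
      using n by (induction n rule: nat_induct_non_zero)
        (auto simp: sum_divide_distrib[symmetric] field_simps)
    hence "of_real (\<Sum>k<n. real k / real n) = (of_real ((real n - 1) / 2) :: 'a)" by (rule arg_cong)
    thus ?thesis by (simp only: of_real_sum of_real_divide of_real_of_nat_eq)
  qed
  have "(\<Prod>k<n. exp ((z + of_nat k / of_nat n) * of_real (ln (real m)))) =
        exp ((\<Sum>k<n. (z + of_nat k / of_nat n)) * of_real (ln (real m)))"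
    by (simp add: exp_sum sum_distrib_right)
  also have "(\<Sum>k<n. (z + of_nat k / of_nat n)) = of_nat n * z + of_real ((real n - 1) / 2)"
    by (simp only: sum.distrib sum) simp
  also have "exp ((of_nat n * z + of_real ((real n - 1) / 2)) * of_real (ln (real m))) =
      exp (of_nat n * z * of_real (ln (real m))) * of_real (exp ((real n - 1) / 2 * ln (real m)))"
    by (simp add: ring_distribs exp_add exp_of_real[symmetric])
  finally have E: "(\<Prod>k<n. exp ((z + of_nat k / of_nat n) * of_real (ln (real m)))) = \<dots>" .
  have E2: "exp (of_nat n * z * of_real (ln (real (n * m)))) =
      exp (of_nat n * z * of_real (ln (real n))) * exp (of_nat n * z * of_real (ln (real m)))"
    using n m by (simp add: ln_mult ring_distribs exp_add)
  show ?thesis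
    unfolding prod_dividef prod.distrib E E2 pochhammer_multiplication[OF n]
    using n m by (simp add: field_simps)
qed

text \<open>X^n - 1 is the product of the X - \<open>w k\<close> over the n-th roots of unity.
  Removing X - 1 and evaluating at 1 gives n for the product of the remaining 1 -
  \<open>w k\<close>, and |1 - \<open>w k\<close>| = 2 sin (pi k / n).\<close>

lemma prod_sin_pi_div:
  assumes "n > 0"
  shows "(\<Prod>k=1..<n. sin (pi * real k / real n)) = real n / 2 ^ (n - 1)"
proof -
  define w where "w = (\<lambda>k. cis (2 * pi * real k / real n))"
  have bij: "bij_betw w {..<n} {z. z ^ n = 1}"
    unfolding w_def by (rule Complex.bij_betw_roots_unity[OF assms])
  define P where "P = (\<Prod>k<n. [:- w k, 1:])"
  have inj: "inj_on w {..<n}" using bij by (rule bij_betw_imp_inj_on)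
  have "P = monom 1 n - 1"
  proof (rule ccontr)
    assume neq: "P \<noteq> monom 1 n - 1"
    \<comment> \<open>Both polynomials are monic of degree n, so \<open>Q\<close> has degree below
      n; yet it vanishes at n distinct roots of unity.\<close>
    define Q where "Q = P - (monom 1 n - 1)"
    have "Q \<noteq> 0" using neq by (simp add: Q_def)
    have degP: "degree P = n" unfolding P_def by (subst degree_prod_eq_sum_degree) auto
    have lead: "coeff P n = 1" using lead_coeff_prod[of "\<lambda>k. [:- w k, 1:]" "{..<n}"] degP
      by (simp add: P_def)
    have "degree Q < n"
    proof -
      have "degree Q \<le> n" unfolding Q_def
        by (intro degree_diff_le) (auto simp: degP degree_monom_le)
      moreover have "coeff Q n = 0" using assms lead by (simp add: Q_def)
      ultimately show ?thesis using \<open>Q \<noteq> 0\<close>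
        by (metis leading_coeff_0_iff order_le_imp_less_or_eq)
    qed
    moreover have "w ` {..<n} \<subseteq> {x. poly Q x = 0}"
    proof safe
      fix k assume k: "k < n"
      have "w k ^ n = 1" using bij k by (auto simp: bij_betw_def)
      moreover have "poly P (w k) = 0" using k by (auto simp: P_def poly_prod)
      ultimately show "poly Q (w k) = 0" by (simp add: Q_def poly_monom)
    qed
    hence "card (w ` {..<n}) \<le> card {x. poly Q x = 0}"
      by (intro card_mono poly_roots_finite \<open>Q \<noteq> 0\<close>)
    hence "n \<le> degree Q" using card_poly_roots_bound[OF \<open>Q \<noteq> 0\<close>] inj by (simp add: card_image)
    ultimately show False by simp
  qed
  moreover have "P = [:- 1, 1:] * (\<Prod>k=1..<n. [:- w k, 1:])"
    using assms unfolding P_def lessThan_atLeast0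
    by (subst prod.atLeast_Suc_lessThan) (auto simp: w_def)
  ultimately have eq: "[:- 1, 1:] * (\<Prod>k=1..<n. [:- w k, 1:]) = monom 1 n - 1" by simp
  \<comment> \<open>At 1 the factor X - 1 vanishes, so the derivative of the product there is the
    value of the cofactor.\<close>
  have "poly (pderiv ([:- 1, 1:] * (\<Prod>k=1..<n. [:- w k, 1:]))) 1 = poly (pderiv (monom 1 n - 1)) 1"
    by (simp only: eq)
  hence "(\<Prod>k=1..<n. 1 - w k) = of_nat n"
    by (simp add: pderiv_mult pderiv_pCons poly_prod pderiv_monom poly_monom pderiv_diff)
  hence "(\<Prod>k=1..<n. norm (1 - w k)) = real n"
    by (metis norm_of_nat prod_norm)
  moreover have "norm (1 - w k) = 2 * sin (pi * real k / real n)" if "k \<in> {1..<n}" for k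
  proof -
    define t where "t = pi * real k / real n"
    have "0 \<le> t" "t \<le> pi" using that by (auto simp: t_def field_simps)
    hence s: "sin t \<ge> 0" by (intro sin_ge_zero)
    have "w k = cis (2 * t)" by (simp add: w_def t_def mult.assoc)
    hence "(norm (1 - w k))\<^sup>2 = (1 - cos (2 * t))\<^sup>2 + (sin (2 * t))\<^sup>2"
      by (simp add: cmod_power2)
    also have "\<dots> = 2 - 2 * cos (2 * t)"
      using sin_cos_squared_add[of "2 * t"] by (simp add: power2_eq_square algebra_simps)
    also have "\<dots> = (2 * sin t)\<^sup>2"
      by (simp add: cos_double_sin power2_eq_square)
    finally have "norm (1 - w k) = 2 * sin t" using s by (subst (asm) power2_eq_iff_nonneg) auto
    thus ?thesis by (simp add: t_def)
  qed
  ultimately have "(\<Prod>k=1..<n. 2 * sin (pi * real k / real n)) = real n" by simp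
  thus ?thesis by (simp add: prod.distrib field_simps)
qed

text \<open>Pairing k with n - k, the reflection formula turns the square of the product into the
  product of sin (pi k / n) / pi; nonnegativity selects the root. This fixes the constant in Gauss'
  formula.\<close>

lemma prod_rGamma_fraction:
  assumes "n > 0"
  shows "(\<Prod>k=1..<n. rGamma (real k / real n)) = sqrt (real n) / (2 * pi) powr ((real n - 1) / 2)"
proof -
  define A where "A = (\<Prod>k=1..<n. rGamma (real k / real n))"
  have refl: "rGamma (real k / real n) * rGamma (real (n - k) / real n) = sin (pi * real k / real n) / pi"
    if "k \<in> {1..<n}" for k
  proof -
    have "complex_of_real (rGamma (real k / real n) * rGamma (1 - real k / real n)) =
          complex_of_real (sin (pi * (real k / real n)) / pi)"
      using rGamma_reflection_complex[of "complex_of_real (real k / real n)"]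
      by (simp only: of_real_mult of_real_divide of_real_1 of_real_diff rGamma_complex_of_real[symmetric]
            sin_of_real[symmetric])
    hence "rGamma (real k / real n) * rGamma (1 - real k / real n) = sin (pi * (real k / real n)) / pi"
      by (simp only: of_real_eq_iff)
    moreover have "1 - real k / real n = real (n - k) / real n"
      using that by (simp add: of_nat_diff field_simps)
    ultimately show ?thesis by simp
  qed
  have "A = (\<Prod>k=1..<n. rGamma (real (n - k) / real n))"
    unfolding A_def by (rule prod.reindex_bij_witness[of _ "\<lambda>k. n - k" "\<lambda>k. n - k"]) auto
  hence "A\<^sup>2 = (\<Prod>k=1..<n. rGamma (real k / real n) * rGamma (real (n - k) / real n))"
    by (simp add: power2_eq_square prod.distrib A_def)
  also have "\<dots> = (\<Prod>k=1..<n. sin (pi * real k / real n) / pi)"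
    by (intro prod.cong refl) auto
  also have "\<dots> = (real n / 2 ^ (n - 1)) / pi ^ (n - 1)"
    unfolding prod_dividef prod_sin_pi_div[OF assms] by simp
  also have "\<dots> = real n / (2 * pi) ^ (n - 1)"
    by (simp add: power_mult_distrib)
  also have "(2 * pi) ^ (n - 1) = (2 * pi) powr (real n - 1)"
    using assms powr_realpow[of "2 * pi" "n - 1"] by (simp add: of_nat_diff)
  also have "\<dots> = ((2 * pi) powr ((real n - 1) / 2))\<^sup>2"
    by (simp add: power2_eq_square powr_add[symmetric])
  also have "real n / \<dots> = (sqrt (real n) / (2 * pi) powr ((real n - 1) / 2))\<^sup>2"
    by (simp add: power_divide)
  finally have "A\<^sup>2 = (sqrt (real n) / (2 * pi) powr ((real n - 1) / 2))\<^sup>2" .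
  moreover have "A \<ge> 0" unfolding A_def
    by (intro prod_nonneg) (auto simp: rGamma_inverse_Gamma intro!: Gamma_real_nonneg)
  ultimately show ?thesis
    unfolding A_def by (subst (asm) power2_eq_iff_nonneg) auto
qed

text \<open>Limit of the identity for the approximants. The form with 1 + n z is the one that
  matches the parameters (1, B), (1/n, B), ..., ((n - 1)/n, B) of the Fox kernels.\<close>

theorem rGamma_multiplication:
  fixes z :: "'a :: Gamma"
  assumes n: "n > 0"
  shows "rGamma (1 + of_nat n * z) =
           of_real ((2 * pi) powr ((real n - 1) / 2) / sqrt (real n)) *
           exp (- of_nat n * z * of_real (ln (real n))) *
           (rGamma (1 + z) * (\<Prod>k=1..<n. rGamma (z + of_nat k / of_nat n)))"
proof -
  define h where "h = (\<lambda>m. fact (n * m - 1) / (real n ^ (n * m) * fact (m - 1) ^ n *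
           exp ((real n - 1) / 2 * ln (real m))))"
  have sub: "(\<lambda>m. pochhammer w (n * m) / (fact (n * m - 1) * exp (w * of_real (ln (real (n * m))))))
                \<longlonglongrightarrow> rGamma w" for w :: "'b :: Gamma"
    using LIMSEQ_subseq_LIMSEQ[OF rGamma_LIMSEQ'[of w], of "(*) n"] n
    by (simp add: o_def strict_mono_def)
  have lhs: "(\<lambda>m. (\<Prod>k<n. pochhammer (w + of_nat k / of_nat n) m /
              (fact (m - 1) * exp ((w + of_nat k / of_nat n) * of_real (ln (real m))))))
          \<longlonglongrightarrow> (\<Prod>k<n. rGamma (w + of_nat k / of_nat n))" for w :: "'b :: Gamma"
    by (intro tendsto_prod rGamma_LIMSEQ')
  have ev: "eventually (\<lambda>m. (\<Prod>k<n. pochhammer (w + of_nat k / of_nat n) m /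
              (fact (m - 1) * exp ((w + of_nat k / of_nat n) * of_real (ln (real m))))) =
           pochhammer (of_nat n * w) (n * m) /
           (fact (n * m - 1) * exp (of_nat n * w * of_real (ln (real (n * m))))) *
         exp (of_nat n * w * of_real (ln (real n))) * of_real (h m)) sequentially" for w :: "'b :: Gamma"
    using eventually_gt_at_top[of 0]
  proof eventually_elim
    case (elim m)
    show ?case unfolding h_def by (rule rGamma_multiplication_aux[OF n elim])
  qed
  define D where "D = (\<Prod>k=1..<n. rGamma (real k / real n)) / real n"
  have shift: "(\<Prod>k<n. rGamma (w + 1 / of_nat n + of_nat k / of_nat n)) =
      rGamma (1 + w) * (\<Prod>k=1..<n. rGamma (w + of_nat k / of_nat n))" for w :: "'b :: Gamma"
  proof -
    have "(\<Prod>k<n. rGamma (w + 1 / of_nat n + of_nat k / of_nat n)) =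
          (\<Prod>k=1..<Suc n. rGamma (w + of_nat k / of_nat n))"
      by (rule prod.reindex_bij_witness[of _ "\<lambda>k. k - 1" Suc])
         (auto simp: add_divide_distrib add_ac)
    also have "\<dots> = rGamma (1 + w) * (\<Prod>k=1..<n. rGamma (w + of_nat k / of_nat n))"
      using n by (subst prod.atLeastLessThan_Suc) (auto simp: add_ac mult_ac)
    finally show ?thesis .
  qed
  \<comment> \<open>The limit of the z-free factor is read off at the point 1 / n: there n w = 1,
    the right-hand approximant tends to \<open>rGamma 1\<close> = 1, and exp (n w ln n) = n accounts
    for the division by n.\<close>
  have hlim: "h \<longlonglongrightarrow> D"
  proof -
    let ?R = "\<lambda>m. pochhammer (1::real) (n * m) / (fact (n * m - 1) * exp (1 * of_real (ln (real (n * m)))))"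
    let ?L = "\<lambda>m. (\<Prod>k<n. pochhammer (1 / real n + of_nat k / of_nat n) m /
              (fact (m - 1) * exp ((1 / real n + of_nat k / of_nat n) * of_real (ln (real m)))))"
    have R: "?R \<longlonglongrightarrow> 1" using sub[of "1::real"] by simp
    have L: "?L \<longlonglongrightarrow> (\<Prod>k=1..<n. rGamma (real k / real n))"
      using lhs[of "1 / real n"] shift[of "0::real"] by simp
    have "eventually (\<lambda>m. ?L m / ?R m / real n = h m) sequentially"
      using ev[of "1 / real n"] tendsto_imp_eventually_ne[OF R zero_neq_one[symmetric]]
    proof eventually_elim
      case (elim m)
      show ?case using elim(2) n unfolding elim(1) by (simp add: exp_of_real)
    qed
    moreover have "(\<lambda>m. ?L m / ?R m / real n) \<longlonglongrightarrow> (\<Prod>k=1..<n. rGamma (real k / real n)) / 1 / real n"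
      using n by (intro tendsto_intros L R) auto
    ultimately show ?thesis by (simp add: D_def tendsto_cong)
  qed
  \<comment> \<open>The shift by 1 / n replaces the offsets 0, ..., n - 1 by 1, ..., n. The last one
    yields \<open>rGamma (1 + z)\<close>.\<close>
  define w where "w = z + 1 / of_nat n"
  have "(\<Prod>k<n. rGamma (w + of_nat k / of_nat n)) =
        rGamma (of_nat n * w) * exp (of_nat n * w * of_real (ln (real n))) * of_real D"
  proof (rule LIMSEQ_unique)
    show "(\<lambda>m. pochhammer (of_nat n * w) (n * m) /
           (fact (n * m - 1) * exp (of_nat n * w * of_real (ln (real (n * m))))) *
         exp (of_nat n * w * of_real (ln (real n))) * of_real (h m)) \<longlonglongrightarrow>
        rGamma (of_nat n * w) * exp (of_nat n * w * of_real (ln (real n))) * of_real D"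
      by (intro tendsto_intros sub hlim)
    show "(\<lambda>m. pochhammer (of_nat n * w) (n * m) /
           (fact (n * m - 1) * exp (of_nat n * w * of_real (ln (real (n * m))))) *
         exp (of_nat n * w * of_real (ln (real n))) * of_real (h m)) \<longlonglongrightarrow>
        (\<Prod>k<n. rGamma (w + of_nat k / of_nat n))"
      using lhs[of w] by (subst (asm) tendsto_cong[OF ev[of w]])
  qed
  also have "of_nat n * w = 1 + of_nat n * z" using n by (simp add: w_def algebra_simps)
  also have "(\<Prod>k<n. rGamma (w + of_nat k / of_nat n)) =
      rGamma (1 + z) * (\<Prod>k=1..<n. rGamma (z + of_nat k / of_nat n))"
    unfolding w_def by (rule shift)
  also have "exp ((1 + of_nat n * z) * of_real (ln (real n))) =
      exp (of_nat n * z * of_real (ln (real n))) * of_nat n"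
    using n by (simp add: ring_distribs exp_add exp_of_real)
  finally have "rGamma (1 + z) * (\<Prod>k=1..<n. rGamma (z + of_nat k / of_nat n)) =
      rGamma (1 + of_nat n * z) * exp (of_nat n * z * of_real (ln (real n))) * of_real (real n * D)"
    by (simp add: mult_ac)
  moreover have "real n * D = sqrt (real n) / (2 * pi) powr ((real n - 1) / 2)"
    unfolding D_def prod_rGamma_fraction[OF n] using n by simp
  moreover have "of_real (a / b) * exp (- e) * (r * exp e * of_real (b / a)) = r"
    if "a \<noteq> 0" "b \<noteq> 0" for a b :: real and e r :: 'a
    using that by (simp add: exp_minus[of e])
  ultimately show ?thesis using n by (simp only:) (simp add: exp_minus)
qed

subsection \<open>Growth of Gamma on vertical strips\<close>

lemma
  fixes z :: complex
  shows norm_sin_le_exp: "norm (sin z) \<le> exp \<bar>Im z\<bar>"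
    and norm_sin_ge_exp: "(exp \<bar>Im z\<bar> - exp (- \<bar>Im z\<bar>)) / 2 \<le> norm (sin z)"
proof -
  have eq: "norm (sin z) = norm (exp (\<i> * z) - exp (- (\<i> * z))) / 2"
    by (simp add: sin_exp_eq norm_divide norm_mult)
  have n: "norm (exp (\<i> * z)) = exp (- Im z)" "norm (exp (- (\<i> * z))) = exp (Im z)"
    by simp_all
  have "norm (sin z) \<le> (exp (- Im z) + exp (Im z)) / 2"
    using norm_triangle_ineq4[of "exp (\<i> * z)" "exp (- (\<i> * z))"] unfolding eq n by simp
  also have "\<dots> \<le> (exp \<bar>Im z\<bar> + exp \<bar>Im z\<bar>) / 2"
    by (intro divide_right_mono add_mono) auto
  finally show "norm (sin z) \<le> exp \<bar>Im z\<bar>" by simp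
  have "\<bar>exp (- Im z) - exp (Im z)\<bar> / 2 \<le> norm (sin z)"
    using norm_triangle_ineq3[of "exp (\<i> * z)" "exp (- (\<i> * z))"] unfolding eq n by simp
  moreover have "exp \<bar>Im z\<bar> - exp (- \<bar>Im z\<bar>) \<le> \<bar>exp (- Im z) - exp (Im z)\<bar>"
    by (cases "Im z \<ge> 0") auto
  ultimately show "(exp \<bar>Im z\<bar> - exp (- \<bar>Im z\<bar>)) / 2 \<le> norm (sin z)"
    by (meson divide_right_mono order_trans zero_le_numeral)
qed

text \<open>Because \<open>|\<Gamma>(x)/\<Gamma>(x + it)|\<^sup>2\<close> is the product of the factors \<open>1 + t\<^sup>2/(x + n)\<^sup>2\<close>, it decreases in \<open>x\<close>.\<close>
lemma norm_rGamma_ratio_antimono: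
  assumes "0 < x" "x \<le> y"
  shows "norm (rGamma (Complex y t)) * rGamma x \<le> norm (rGamma (Complex x t)) * rGamma y"
proof (rule LIMSEQ_le)
  show "(\<lambda>n. norm (rGamma_series (Complex y t) n) * rGamma_series x n) \<longlonglongrightarrow>
          norm (rGamma (Complex y t)) * rGamma x"
    and "(\<lambda>n. norm (rGamma_series (Complex x t) n) * rGamma_series y n) \<longlonglongrightarrow>
          norm (rGamma (Complex x t)) * rGamma y"
    by (intro tendsto_intros)+
  have "norm (rGamma_series (Complex y t) n) * rGamma_series x n \<le>
        norm (rGamma_series (Complex x t) n) * rGamma_series y n" for n
  proof -
    have fac: "norm (Complex y t + of_nat k) * (x + real k) \<le> norm (Complex x t + of_nat k) * (y + real k)" for k
    proof (rule power2_le_imp_le)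
      have "(x + real k)\<^sup>2 \<le> (y + real k)\<^sup>2" using assms by (intro power_mono) auto
      hence "t\<^sup>2 * (x + real k)\<^sup>2 \<le> t\<^sup>2 * (y + real k)\<^sup>2" by (intro mult_left_mono) auto
      thus "(norm (Complex y t + of_nat k) * (x + real k))\<^sup>2 \<le> (norm (Complex x t + of_nat k) * (y + real k))\<^sup>2"
        unfolding power_mult_distrib cmod_power2 by (simp add: algebra_simps)
    qed (use assms in auto)
    have "norm (pochhammer (Complex y t) (n+1)) * pochhammer x (n+1) \<le>
          norm (pochhammer (Complex x t) (n+1)) * pochhammer y (n+1)"
      unfolding pochhammer_prod prod_norm[symmetric] prod.distrib[symmetric]
      using assms fac by (intro prod_mono) auto
    hence "norm (pochhammer (Complex y t) (n+1)) * pochhammer x (n+1) /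
             (fact n * fact n * exp ((x + y) * ln (real n))) \<le>
          norm (pochhammer (Complex x t) (n+1)) * pochhammer y (n+1) /
             (fact n * fact n * exp ((x + y) * ln (real n)))"
      by (intro divide_right_mono) auto
    thus ?thesis
      by (simp add: rGamma_series_def norm_divide norm_mult ring_distribs exp_add mult_ac)
  qed
  thus "\<exists>N. \<forall>n\<ge>N. norm (rGamma_series (Complex y t) n) * rGamma_series x n \<le>
        norm (rGamma_series (Complex x t) n) * rGamma_series y n" by blast
qed

lemma norm_rGamma_half_le: "norm (rGamma (Complex (1/2) t)) \<le> exp (pi / 2 * \<bar>t\<bar>) / sqrt pi"
proof (rule power2_le_imp_le)
  let ?z = "Complex (1/2) t"
  have cnj: "1 - ?z = cnj ?z" by (simp add: complex_eq_iff)
  have "(norm (rGamma ?z))\<^sup>2 = norm (rGamma ?z * cnj (rGamma ?z))"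
    by (simp add: norm_mult power2_eq_square)
  also have "\<dots> = norm (sin (of_real pi * ?z) / of_real pi)"
    using rGamma_reflection_complex[of ?z] unfolding cnj by (simp add: cnj_rGamma)
  also have "\<dots> \<le> exp (pi * \<bar>t\<bar>) / pi"
    using norm_sin_le_exp[of "of_real pi * ?z"] by (simp add: norm_divide abs_mult divide_right_mono)
  also have "exp (pi * \<bar>t\<bar>) = (exp (pi / 2 * \<bar>t\<bar>))\<^sup>2"
    by (simp add: power2_eq_square exp_add[symmetric])
  finally show "(norm (rGamma ?z))\<^sup>2 \<le> (exp (pi / 2 * \<bar>t\<bar>) / sqrt pi)\<^sup>2"
    by (simp add: power_divide)
qed auto

lemma rGamma_real_nonneg: "x \<ge> 0 \<Longrightarrow> rGamma x \<ge> (0 :: real)"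
  by (cases "x = 0") (auto simp: rGamma_inverse_Gamma Gamma_real_nonneg)

text \<open>Monotonicity of the ratio carries the bound from Re = 1/2 to the right; the constants
  cancel because \<open>rGamma (1/2)\<close> = 1 / sqrt pi.\<close>

lemma norm_rGamma_le:
  assumes "x \<ge> 1/2"
  shows "norm (rGamma (Complex x t)) \<le> rGamma x * exp (pi / 2 * \<bar>t\<bar>)"
proof -
  have "norm (rGamma (Complex x t)) * rGamma (1/2) \<le> norm (rGamma (Complex (1/2) t)) * rGamma x"
    using assms by (intro norm_rGamma_ratio_antimono) auto
  also have "\<dots> \<le> exp (pi / 2 * \<bar>t\<bar>) / sqrt pi * rGamma x"
    using assms by (intro mult_right_mono norm_rGamma_half_le rGamma_real_nonneg) auto
  finally show ?thesis
    by (simp add: rGamma_inverse_Gamma[of "1/2"] Gamma_one_half_real field_simps)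
qed

lemma norm_Complex_le: "norm (Complex a b) \<le> \<bar>a\<bar> + \<bar>b\<bar>"
  using cmod_le[of "Complex a b"] by simp

text \<open>Strips reaching left of 1/2 are brought to the right by m uses of 1/Gamma(z) = z /
  Gamma(z + 1). Each use costs a factor |z|, absorbed by half of the available
  \<open>\<epsilon>\<close>; hence the induction must vary \<open>\<epsilon>\<close> together with
  the strip.\<close>

lemma rGamma_strip_bound:
  assumes "\<epsilon> > 0"
  shows "\<exists>C\<ge>0. \<forall>\<sigma>\<in>{a..b}. \<forall>t. norm (rGamma (Complex \<sigma> t)) \<le> C * exp ((pi / 2 + \<epsilon>) * \<bar>t\<bar>)"
proof -
  have main: "\<exists>C\<ge>0. \<forall>\<sigma>\<in>{a..b}. \<forall>t. norm (rGamma (Complex \<sigma> t)) \<le> C * exp ((pi / 2 + \<epsilon>) * \<bar>t\<bar>)"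
    if "\<epsilon> > 0" "a + real m \<ge> 1/2" for m a b \<epsilon>
    using that
  proof (induction m arbitrary: a b \<epsilon>)
    case 0
    have "compact ((\<lambda>\<sigma>. rGamma \<sigma> :: real) ` {a..b})"
      by (intro compact_continuous_image continuous_intros) auto
    then obtain C where C: "\<And>\<sigma>. \<sigma> \<in> {a..b} \<Longrightarrow> norm (rGamma \<sigma> :: real) \<le> C"
      by (metis bounded_iff compact_imp_bounded image_eqI)
    show ?case
    proof (intro exI[of _ "\<bar>C\<bar>"] conjI ballI allI)
      fix \<sigma> t assume s: "\<sigma> \<in> {a..b}"
      have "norm (rGamma (Complex \<sigma> t)) \<le> rGamma \<sigma> * exp (pi / 2 * \<bar>t\<bar>)"
        using s 0 by (intro norm_rGamma_le) auto
      also have "\<dots> \<le> \<bar>C\<bar> * exp ((pi / 2 + \<epsilon>) * \<bar>t\<bar>)"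
        using C[OF s] 0 by (intro mult_mono) (auto simp: ring_distribs)
      finally show "norm (rGamma (Complex \<sigma> t)) \<le> \<bar>C\<bar> * exp ((pi / 2 + \<epsilon>) * \<bar>t\<bar>)" .
    qed auto
  next
    case (Suc m)
    obtain C where C: "C \<ge> 0" "\<And>\<sigma> t. \<sigma> \<in> {a+1..b+1} \<Longrightarrow>
        norm (rGamma (Complex \<sigma> t)) \<le> C * exp ((pi / 2 + \<epsilon> / 2) * \<bar>t\<bar>)"
      using Suc.IH[of "\<epsilon> / 2" "a + 1" "b + 1"] Suc.prems by auto
    show ?case
    \<comment> \<open>The new constant bounds |z| <= |a| + |b| + |t| by a multiple of exp
      (\<epsilon> |t| / 2), using |t| <= (2 / \<epsilon>) exp (\<epsilon> |t| / 2).\<close>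
    proof (intro exI[of _ "(\<bar>a\<bar> + \<bar>b\<bar> + 2 / \<epsilon>) * C"] conjI ballI allI)
      fix \<sigma> t assume s: "\<sigma> \<in> {a..b}"
      have "rGamma (Complex \<sigma> t) = Complex \<sigma> t * rGamma (Complex (\<sigma> + 1) t)"
        using rGamma_plus1[of "Complex \<sigma> t"] by (simp add: Complex_eq algebra_simps)
      hence "norm (rGamma (Complex \<sigma> t)) = norm (Complex \<sigma> t) * norm (rGamma (Complex (\<sigma> + 1) t))"
        by (simp add: norm_mult)
      also have "\<dots> \<le> ((\<bar>a\<bar> + \<bar>b\<bar> + 2 / \<epsilon>) * exp (\<epsilon> / 2 * \<bar>t\<bar>)) * (C * exp ((pi / 2 + \<epsilon> / 2) * \<bar>t\<bar>))"
      proof (intro mult_mono)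
        have "norm (Complex \<sigma> t) \<le> (\<bar>a\<bar> + \<bar>b\<bar>) * 1 + \<bar>t\<bar>"
          using norm_Complex_le[of \<sigma> t] s by auto
        also have "\<dots> \<le> (\<bar>a\<bar> + \<bar>b\<bar>) * exp (\<epsilon> / 2 * \<bar>t\<bar>) + 2 / \<epsilon> * exp (\<epsilon> / 2 * \<bar>t\<bar>)"
        proof (intro add_mono mult_left_mono)
          have "\<epsilon> / 2 * \<bar>t\<bar> \<le> exp (\<epsilon> / 2 * \<bar>t\<bar>)"
            using exp_ge_add_one_self[of "\<epsilon> / 2 * \<bar>t\<bar>"] by linarith
          thus "\<bar>t\<bar> \<le> 2 / \<epsilon> * exp (\<epsilon> / 2 * \<bar>t\<bar>)" using \<open>\<epsilon> > 0\<close> by (simp add: field_simps)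
        qed (use \<open>\<epsilon> > 0\<close> in auto)
        finally show "norm (Complex \<sigma> t) \<le> (\<bar>a\<bar> + \<bar>b\<bar> + 2 / \<epsilon>) * exp (\<epsilon> / 2 * \<bar>t\<bar>)"
          by (simp add: algebra_simps)
      qed (use C s \<open>\<epsilon> > 0\<close> in auto)
      also have "\<dots> = (\<bar>a\<bar> + \<bar>b\<bar> + 2 / \<epsilon>) * C * exp ((pi / 2 + \<epsilon>) * \<bar>t\<bar>)"
      proof -
        have "exp (\<epsilon> / 2 * \<bar>t\<bar>) * exp ((pi / 2 + \<epsilon> / 2) * \<bar>t\<bar>) = exp ((pi / 2 + \<epsilon>) * \<bar>t\<bar>)"
          unfolding exp_add[symmetric] by (simp add: ring_distribs)
        thus ?thesis by (simp add: mult_ac)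
      qed
      finally show "norm (rGamma (Complex \<sigma> t)) \<le> (\<bar>a\<bar> + \<bar>b\<bar> + 2 / \<epsilon>) * C * exp ((pi / 2 + \<epsilon>) * \<bar>t\<bar>)" .
    qed (use C \<open>\<epsilon> > 0\<close> in auto)
  qed
  obtain m where "1/2 - a \<le> real m" using real_arch_simple by blast
  thus ?thesis using main[of \<epsilon> a m b] assms by auto
qed

text \<open>By reflection Gamma z = pi / (Gamma (1 - z) sin (pi z)): the sine contributes decay of
  rate pi against growth of rate pi / 2 + \<epsilon>. The restriction |t| >= 1 avoids the poles and
  makes the sine at least exp (pi |t|) / 4.\<close>

lemma Gamma_strip_bound:
  assumes "\<epsilon> > 0"
  shows "\<exists>C\<ge>0. \<forall>\<sigma>\<in>{a..b}. \<forall>t. \<bar>t\<bar> \<ge> 1 \<longrightarrow> norm (Gamma (Complex \<sigma> t)) \<le> C * exp (- (pi / 2 - \<epsilon>) * \<bar>t\<bar>)"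
proof -
  obtain C where C: "C \<ge> 0" "\<And>\<sigma> t. \<sigma> \<in> {1-b..1-a} \<Longrightarrow>
      norm (rGamma (Complex \<sigma> t)) \<le> C * exp ((pi / 2 + \<epsilon>) * \<bar>t\<bar>)"
    using rGamma_strip_bound[OF assms, of "1-b" "1-a"] by auto
  show ?thesis
  proof (intro exI[of _ "4 * pi * C"] conjI ballI allI impI)
    fix \<sigma> t :: real assume s: "\<sigma> \<in> {a..b}" and t: "\<bar>t\<bar> \<ge> 1"
    let ?z = "Complex \<sigma> t"
    have pt: "pi * \<bar>t\<bar> \<ge> 1" using t pi_ge_two mult_mono[of 1 pi 1 "\<bar>t\<bar>"] by auto
    have "exp (- (pi * \<bar>t\<bar>)) * 2 \<le> exp (pi * \<bar>t\<bar>)"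
    proof -
      have "2 \<le> exp (1::real)" using exp_ge_add_one_self[of "1::real"] by simp
      also have "\<dots> \<le> exp (pi * \<bar>t\<bar>)" using pt by simp
      finally have "exp (- (pi * \<bar>t\<bar>)) * 2 \<le> 1 * exp (pi * \<bar>t\<bar>)"
        using pt by (intro mult_mono) auto
      thus ?thesis by simp
    qed
    hence "exp (pi * \<bar>t\<bar>) / 4 \<le> (exp (pi * \<bar>t\<bar>) - exp (- (pi * \<bar>t\<bar>))) / 2" by simp
    also have "\<dots> \<le> norm (sin (of_real pi * ?z))"
      using norm_sin_ge_exp[of "of_real pi * ?z"] by (simp add: abs_mult)
    finally have sin: "exp (pi * \<bar>t\<bar>) / 4 \<le> norm (sin (of_real pi * ?z))" .
    have "rGamma ?z * rGamma (1 - ?z) = sin (of_real pi * ?z) / of_real pi"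
      by (rule rGamma_reflection_complex)
    moreover have nz: "sin (of_real pi * ?z) \<noteq> 0"
      using sin exp_gt_zero[of "pi * \<bar>t\<bar>"] by (metis divide_pos_pos norm_zero not_le zero_less_numeral)
    ultimately have "rGamma ?z \<noteq> 0" by auto
    hence "Gamma ?z = of_real pi * rGamma (1 - ?z) / sin (of_real pi * ?z)"
      using \<open>rGamma ?z * rGamma (1 - ?z) = _\<close> nz unfolding Gamma_def by (simp add: field_simps)
    moreover have "1 - ?z = Complex (1 - \<sigma>) (- t)" by (simp add: complex_eq_iff)
    ultimately have "norm (Gamma ?z) = pi * norm (rGamma (Complex (1 - \<sigma>) (- t))) / norm (sin (of_real pi * ?z))"
      by (simp add: norm_mult norm_divide)
    also have "\<dots> \<le> pi * (C * exp ((pi / 2 + \<epsilon>) * \<bar>t\<bar>)) / (exp (pi * \<bar>t\<bar>) / 4)"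
      using C(2)[of "1 - \<sigma>" "- t"] s sin C(1) by (intro frac_le mult_left_mono) auto
    also have "\<dots> = 4 * pi * C * (exp ((pi / 2 + \<epsilon>) * \<bar>t\<bar>) / exp (pi * \<bar>t\<bar>))" by simp
    also have "exp ((pi / 2 + \<epsilon>) * \<bar>t\<bar>) / exp (pi * \<bar>t\<bar>) = exp (- (pi / 2 - \<epsilon>) * \<bar>t\<bar>)"
      by (simp add: exp_diff[symmetric] algebra_simps)
    finally show "norm (Gamma ?z) \<le> 4 * pi * C * exp (- (pi / 2 - \<epsilon>) * \<bar>t\<bar>)" .
  qed (use C in auto)
qed

section \<open>Integrals along vertical lines and shifting them across a simple pole\<close>

lemma integrable_exp_minus_abs:
  assumes "\<delta> > 0"
  shows "integrable lborel (\<lambda>t::real. exp (- \<delta> * \<bar>t\<bar>))"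
proof -
  have 1: "set_integrable lborel {0..} (\<lambda>t. exp (- \<delta> * t))"
  proof -
    have "set_integrable lebesgue {0..} (\<lambda>t. exp (- \<delta> * t))"
      by (intro nonnegative_absolutely_integrable_1 integrable_on_exp_minus_to_infinity assms) auto
    thus ?thesis unfolding set_integrable_def
      by (subst (asm) integrable_completion) auto
  qed
  hence 2: "integrable lborel (\<lambda>t. indicator {0..} t * exp (- \<delta> * t))"
    by (simp add: set_integrable_def)
  hence "integrable lborel (\<lambda>t. indicator {0..} (0 + (- 1) * t) * exp (- \<delta> * (0 + (- 1) * t)))"
    by (subst lborel_integrable_real_affine_iff) auto
  hence "integrable lborel (\<lambda>t. indicator {0..} t * exp (- \<delta> * t) +
            indicator {0..} (0 + (- 1) * t) * exp (- \<delta> * (0 + (- 1) * t)))"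
    using 2 by (rule Bochner_Integration.integrable_add[rotated])
  thus ?thesis
  \<comment> \<open>Domination rather than equality, since the two half-lines both count the point
    0.\<close>
  proof (rule Bochner_Integration.integrable_bound)
    show "AE x in lborel. norm (exp (- \<delta> * \<bar>x\<bar>))
         \<le> norm (indicat_real {0..} x * exp (- \<delta> * x) +
                  indicat_real {0..} (0 + - 1 * x) * exp (- \<delta> * (0 + - 1 * x)))"
    proof (rule AE_I2)
      fix x :: real
      show "norm (exp (- \<delta> * \<bar>x\<bar>))
         \<le> norm (indicat_real {0..} x * exp (- \<delta> * x) +
                  indicat_real {0..} (0 + - 1 * x) * exp (- \<delta> * (0 + - 1 * x)))"
        by (cases "x > 0"; cases "x < 0") (auto simp: indicator_def)
    qed
  qed measurable
qed

text \<open>Connects the Lebesgue integral in \<open>vline_integral\<close> with the gauge integrals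
  over [-n, n] that contour integrals along vertical segments produce.\<close>

lemma truncated_integral_tendsto:
  fixes f :: "real \<Rightarrow> complex"
  assumes "integrable lborel f"
  shows "(\<lambda>n. integral {- real n..real n} f) \<longlonglongrightarrow> integral\<^sup>L lborel f"
proof -
  have [measurable]: "f \<in> borel_measurable borel"
    using borel_measurable_integrable[OF assms] by simp
  have "(\<lambda>n. integral\<^sup>L lborel (\<lambda>t. indicator {- real n..real n} t *\<^sub>R f t)) \<longlonglongrightarrow> integral\<^sup>L lborel f"
  proof (rule integral_dominated_convergence[where w = "\<lambda>t. norm (f t)"])
    show "AE x in lborel. (\<lambda>n. indicat_real {- real n..real n} x *\<^sub>R f x) \<longlonglongrightarrow> f x"
    proof (rule AE_I2)
      fix x :: real
      obtain N where N: "\<bar>x\<bar> \<le> real N" using real_arch_simple by blast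
      have "eventually (\<lambda>n. f x = indicat_real {- real n..real n} x *\<^sub>R f x) sequentially"
        using eventually_ge_at_top[of N] by eventually_elim (use N in \<open>auto simp: indicator_def\<close>)
      thus "(\<lambda>n. indicat_real {- real n..real n} x *\<^sub>R f x) \<longlonglongrightarrow> f x"
        by (rule Lim_transform_eventually[OF tendsto_const])
    qed
  qed (use assms in \<open>auto simp: indicator_def\<close>)
  moreover have "integral\<^sup>L lborel (\<lambda>t. indicator {- real n..real n} t *\<^sub>R f t) = integral {- real n..real n} f" for n
  proof -
    have "set_integrable lborel {- real n..real n} f"
      using assms unfolding set_integrable_def by (intro integrable_mult_indicator) auto
    from set_borel_integral_eq_integral(2)[OF this] show ?thesis
      by (simp add: set_lebesgue_integral_def)
  qed
  ultimately show ?thesis by simp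
qed

text \<open>Cauchy's integral formula for \<open>h\<close> on rectangles of half-height T. As T
  grows, \<open>B\<close> makes the horizontal sides vanish and the vertical sides become the two
  line integrals. The factor 2 pi of the formula is absorbed by the normalisation of
  \<open>vline_integral\<close>.\<close>

lemma vline_integral_shift_simple_pole:
  fixes h :: "complex \<Rightarrow> complex" and a b r :: real
  assumes S: "open S" "convex S" "{z. a \<le> Re z \<and> Re z \<le> b} \<subseteq> S"
    and h: "h holomorphic_on S" and r: "a < r" "r < b"
    and f: "f = (\<lambda>z. h z / (z - of_real r))"
    and int: "integrable lborel (\<lambda>t. f (Complex a t))" "integrable lborel (\<lambda>t. f (Complex b t))"
    and B: "\<And>\<sigma> t. a \<le> \<sigma> \<Longrightarrow> \<sigma> \<le> b \<Longrightarrow> \<bar>t\<bar> \<ge> 1 \<Longrightarrow> norm (f (Complex \<sigma> t)) \<le> B \<bar>t\<bar>"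
    and B_lim: "(B \<longlongrightarrow> 0) at_top"
  shows "vline_integral f b - vline_integral f a = h (of_real r)"
proof -
  let ?I = "\<lambda>c n. integral {- real n..real n} (\<lambda>t. f (Complex c t))"
  have bound: "norm (?I b n - ?I a n - 2 * pi * h (of_real r)) \<le> 2 * (b - a) * B (real n)" if n: "n > 0" for n
  proof -
    define T where "T = real n"
    have T: "T \<ge> 1" using n by (simp add: T_def)
    let ?p = "Complex a (-T)" and ?q = "Complex b (-T)" and ?r = "Complex b T" and ?s = "Complex a T"
    let ?g = "rectpath ?p ?r"
    have box: "of_real r \<in> box ?p ?r" using r T by (simp add: in_box_complex_iff)
    have cboxS: "cbox ?p ?r \<subseteq> S" using S(3) by (auto simp: in_cbox_complex_iff)
    have img: "path_image ?g \<subseteq> S - {of_real r}"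
      using box cboxS r T by (auto simp: path_image_rectpath_cbox_minus_box)
    have "(f has_contour_integral (2 * pi * \<i> * winding_number ?g (of_real r) * h (of_real r))) ?g"
      unfolding f using S h img cboxS box box_subset_cbox[of ?p ?r] interior_open[OF S(1)]
      by (intro Cauchy_integral_formula_convex_simple) auto
    hence has: "(f has_contour_integral (2 * pi * \<i> * h (of_real r))) ?g"
      using winding_number_rectpath[OF box] by simp
    have segs: "closed_segment ?p ?q \<subseteq> S - {of_real r}" "closed_segment ?q ?r \<subseteq> S - {of_real r}"
               "closed_segment ?r ?s \<subseteq> S - {of_real r}" "closed_segment ?s ?p \<subseteq> S - {of_real r}"
      using img by (auto simp: rectpath_def Let_def path_image_join)
    have cont: "continuous_on (S - {of_real r}) f"
      unfolding f by (intro continuous_intros continuous_on_subset[OF holomorphic_on_imp_continuous_on[OF h]]) auto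
    have ci: "f contour_integrable_on linepath u v" if "closed_segment u v \<subseteq> S - {of_real r}" for u v
      by (intro contour_integrable_continuous_linepath continuous_on_subset[OF cont that])
    note ci' = segs[THEN ci]
    have "2 * pi * \<i> * h (of_real r) = contour_integral ?g f"
      using has by (simp add: contour_integral_unique)
    also have "\<dots> = contour_integral (linepath ?p ?q) f + (contour_integral (linepath ?q ?r) f +
        (contour_integral (linepath ?r ?s) f + contour_integral (linepath ?s ?p) f))"
      using ci' by (simp add: rectpath_def Let_def)
    also have "contour_integral (linepath ?s ?p) f = - contour_integral (linepath ?p ?s) f"
      using ci'(4) by (subst contour_integral_reversepath[symmetric]) auto
    also have "contour_integral (linepath ?p ?s) f = \<i> * ?I a n"
      using T by (subst contour_integral_linepath_same_Re) (auto simp: T_def)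
    also have "contour_integral (linepath ?q ?r) f = \<i> * ?I b n"
      using T by (subst contour_integral_linepath_same_Re) (auto simp: T_def)
    \<comment> \<open>Along the vertical sides dz = i dt, and the left side is traversed downwards;
      the error consists of the two horizontal sides.\<close>
    finally have eq: "\<i> * (?I b n - ?I a n - 2 * pi * h (of_real r)) =
        - contour_integral (linepath ?p ?q) f - contour_integral (linepath ?r ?s) f"
      by (simp add: algebra_simps)
    have B0: "B T \<ge> 0" using order_trans[OF norm_ge_zero B[of a T]] r T by simp
    have norms: "norm (?q - ?p) = b - a" "norm (?s - ?r) = b - a"
      using r by (simp_all add: cmod_def)
    have "norm (contour_integral (linepath ?p ?q) f) \<le> B T * norm (?q - ?p)"
    proof (rule contour_integral_bound_linepath[OF ci'(1) B0])
      fix x assume x: "x \<in> closed_segment ?p ?q"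
      hence "x = Complex (Re x) (-T)" "a \<le> Re x" "Re x \<le> b"
        using r by (auto simp: closed_segment_same_Im closed_segment_eq_real_ivl complex_eq_iff)
      thus "norm (f x) \<le> B T" using B[of "Re x" "-T"] T by simp
    qed
    moreover have "norm (contour_integral (linepath ?r ?s) f) \<le> B T * norm (?s - ?r)"
    proof (rule contour_integral_bound_linepath[OF ci'(3) B0])
      fix x assume x: "x \<in> closed_segment ?r ?s"
      hence "x = Complex (Re x) T" "a \<le> Re x" "Re x \<le> b"
        using r by (auto simp: closed_segment_same_Im closed_segment_eq_real_ivl complex_eq_iff)
      thus "norm (f x) \<le> B T" using B[of "Re x" "T"] T by simp
    qed
    moreover have "norm (?I b n - ?I a n - 2 * pi * h (of_real r)) =
        norm (- contour_integral (linepath ?p ?q) f - contour_integral (linepath ?r ?s) f)"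
      unfolding eq[symmetric] by (simp add: norm_mult)
    moreover have "norm (- contour_integral (linepath ?p ?q) f - contour_integral (linepath ?r ?s) f) \<le>
        norm (contour_integral (linepath ?p ?q) f) + norm (contour_integral (linepath ?r ?s) f)"
      by (metis norm_minus_cancel norm_triangle_ineq4)
    ultimately have "norm (?I b n - ?I a n - 2 * pi * h (of_real r)) \<le> B T * (b - a) + B T * (b - a)"
      unfolding norms by linarith
    thus ?thesis by (simp add: T_def mult_ac)
  qed
  have "(\<lambda>n. ?I b n - ?I a n - 2 * pi * h (of_real r)) \<longlonglongrightarrow> 0"
  proof (rule Lim_null_comparison)
    show "eventually (\<lambda>n. norm (?I b n - ?I a n - 2 * pi * h (of_real r)) \<le> 2 * (b - a) * B (real n)) sequentially"
      using eventually_gt_at_top[of 0] by eventually_elim (rule bound)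
    have "(\<lambda>n. 2 * (b - a) * B (real n)) \<longlonglongrightarrow> 2 * (b - a) * 0"
      by (intro tendsto_intros filterlim_compose[OF B_lim filterlim_real_sequentially])
    thus "(\<lambda>n. 2 * (b - a) * B (real n)) \<longlonglongrightarrow> 0" by simp
  qed
  moreover have "(\<lambda>n. ?I b n - ?I a n - 2 * pi * h (of_real r)) \<longlonglongrightarrow>
     integral\<^sup>L lborel (\<lambda>t. f (Complex b t)) - integral\<^sup>L lborel (\<lambda>t. f (Complex a t)) - 2 * pi * h (of_real r)"
    by (intro tendsto_intros truncated_integral_tendsto int)
  ultimately have "integral\<^sup>L lborel (\<lambda>t. f (Complex b t)) - integral\<^sup>L lborel (\<lambda>t. f (Complex a t)) -
      2 * pi * h (of_real r) = 0"
    by (rule LIMSEQ_unique[symmetric])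
  thus ?thesis by (simp add: vline_integral_def field_simps)
qed

subsection \<open>The Mellin--Barnes integral as a sum of residues\<close>

text \<open>For y = \<open>x powr - \<alpha>\<close> this is \<open>levy_kernel\<close> with the
  variable moved by 1 and a factor y removed, so that the poles sit at 0, -1, -2, ...\<close>

definition mb_kernel :: "real \<Rightarrow> real \<Rightarrow> complex \<Rightarrow> complex" where
  "mb_kernel \<alpha> y u =
     Gamma u * rGamma (1 - of_real \<alpha> + of_real \<alpha> * u) * exp (- (u * of_real (ln y)))"

lemma Complex_affine: "1 - of_real \<alpha> + of_real \<alpha> * Complex \<sigma> t = Complex (1 - \<alpha> + \<alpha> * \<sigma>) (\<alpha> * t)"
  by (simp add: complex_eq_iff)

text \<open>The decay rate pi / 2 of Gamma beats the growth rate \<alpha> pi / 2 of the reciprocal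
  factor, which is where \<open>\<alpha> < 1\<close> enters.\<close>

lemma mb_kernel_strip_bound:
  assumes "0 < \<alpha>" "\<alpha> < 1"
  shows "\<exists>C\<ge>0. \<exists>\<delta>>0. \<forall>\<sigma>\<in>{a..b}. \<forall>t. \<bar>t\<bar> \<ge> 1 \<longrightarrow>
           norm (mb_kernel \<alpha> y (Complex \<sigma> t)) \<le> C * exp (- \<delta> * \<bar>t\<bar>)"
proof -
  \<comment> \<open>With this choice the combined exponent is -4 \<epsilon> + (1 + \<alpha>)
    \<epsilon>, at most -2 \<epsilon>, and 2 \<epsilon> is the \<open>\<delta>\<close>
    below.\<close>
  define \<epsilon> where "\<epsilon> = (1 - \<alpha>) * pi / 8"
  have \<epsilon>: "\<epsilon> > 0" using assms by (simp add: \<epsilon>_def)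
  obtain C1 where C1: "C1 \<ge> 0" "\<And>\<sigma> t. \<sigma> \<in> {a..b} \<Longrightarrow> \<bar>t\<bar> \<ge> 1 \<Longrightarrow>
       norm (Gamma (Complex \<sigma> t)) \<le> C1 * exp (- (pi / 2 - \<epsilon>) * \<bar>t\<bar>)"
    using Gamma_strip_bound[OF \<epsilon>, of a b] by auto
  obtain C2 where C2: "C2 \<ge> 0" "\<And>\<sigma> t. \<sigma> \<in> {1 - \<alpha> + \<alpha> * a..1 - \<alpha> + \<alpha> * b} \<Longrightarrow>
       norm (rGamma (Complex \<sigma> t)) \<le> C2 * exp ((pi / 2 + \<epsilon>) * \<bar>t\<bar>)"
    using rGamma_strip_bound[OF \<epsilon>, of "1 - \<alpha> + \<alpha> * a" "1 - \<alpha> + \<alpha> * b"] by auto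
  define C3 where "C3 = exp ((\<bar>a\<bar> + \<bar>b\<bar>) * \<bar>ln y\<bar>)"
  define \<delta> where "\<delta> = (1 - \<alpha>) * pi / 4"
  have "norm (mb_kernel \<alpha> y (Complex \<sigma> t)) \<le> C1 * C2 * C3 * exp (- \<delta> * \<bar>t\<bar>)"
    if s: "\<sigma> \<in> {a..b}" and t: "\<bar>t\<bar> \<ge> 1" for \<sigma> t
  proof -
    have 2: "norm (rGamma (Complex (1 - \<alpha> + \<alpha> * \<sigma>) (\<alpha> * t))) \<le> C2 * exp ((pi / 2 + \<epsilon>) * (\<alpha> * \<bar>t\<bar>))"
      using C2(2)[of "1 - \<alpha> + \<alpha> * \<sigma>" "\<alpha> * t"] s assms by (auto simp: abs_mult)
    have "- (\<sigma> * ln y) \<le> \<bar>\<sigma>\<bar> * \<bar>ln y\<bar>" by (metis abs_ge_minus_self abs_mult)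
    also have "\<dots> \<le> (\<bar>a\<bar> + \<bar>b\<bar>) * \<bar>ln y\<bar>" using s by (intro mult_right_mono) auto
    finally have 3: "norm (exp (- (Complex \<sigma> t * of_real (ln y)))) \<le> C3" by (simp add: C3_def)
    have "norm (mb_kernel \<alpha> y (Complex \<sigma> t)) =
        norm (Gamma (Complex \<sigma> t)) * norm (rGamma (Complex (1 - \<alpha> + \<alpha> * \<sigma>) (\<alpha> * t))) *
        norm (exp (- (Complex \<sigma> t * of_real (ln y))))"
      by (simp only: mb_kernel_def norm_mult Complex_affine)
    also have "\<dots> \<le> (C1 * exp (- (pi / 2 - \<epsilon>) * \<bar>t\<bar>)) * (C2 * exp ((pi / 2 + \<epsilon>) * (\<alpha> * \<bar>t\<bar>))) * C3"
      using C1 C2 s t by (intro mult_mono 2 3) (auto intro!: mult_nonneg_nonneg)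
    also have "\<dots> = C1 * C2 * C3 * exp (- (pi / 2 - \<epsilon>) * \<bar>t\<bar> + (pi / 2 + \<epsilon>) * (\<alpha> * \<bar>t\<bar>))"
      unfolding exp_add by (simp add: mult_ac)
    also have "\<dots> \<le> C1 * C2 * C3 * exp (- \<delta> * \<bar>t\<bar>)"
    proof -
      have "- (pi / 2 - \<epsilon>) * \<bar>t\<bar> + (pi / 2 + \<epsilon>) * (\<alpha> * \<bar>t\<bar>) = (- (pi / 2 - \<epsilon>) + (pi / 2 + \<epsilon>) * \<alpha>) * \<bar>t\<bar>"
        by (simp add: algebra_simps)
      also have "- (pi / 2 - \<epsilon>) + (pi / 2 + \<epsilon>) * \<alpha> = - 4 * \<epsilon> + \<epsilon> * (1 + \<alpha>)"
        by (simp add: \<epsilon>_def field_simps)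
      also have "\<dots> * \<bar>t\<bar> \<le> (- 4 * \<epsilon> + \<epsilon> * 2) * \<bar>t\<bar>"
        using \<epsilon> assms by (intro mult_right_mono add_left_mono mult_left_mono) auto
      also have "\<dots> = - \<delta> * \<bar>t\<bar>" by (simp add: \<delta>_def \<epsilon>_def field_simps)
      finally show ?thesis using C1 C2 by (intro mult_left_mono) (auto simp: C3_def)
    qed
    finally show ?thesis .
  qed
  moreover have "C1 * C2 * C3 \<ge> 0" "\<delta> > 0" using C1 C2 assms by (auto simp: C3_def \<delta>_def)
  ultimately show ?thesis by blast
qed

lemma Complex_in_nonpos_Ints_iff: "Complex c t \<in> \<int>\<^sub>\<le>\<^sub>0 \<longleftrightarrow> c \<in> \<int>\<^sub>\<le>\<^sub>0 \<and> t = 0"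
  by (auto elim!: nonpos_Ints_cases simp: complex_eq_iff nonpos_Ints_def)

lemma mb_kernel_integrable:
  assumes "0 < \<alpha>" "\<alpha> < 1" "c \<notin> \<int>\<^sub>\<le>\<^sub>0"
  shows "integrable lborel (\<lambda>t. mb_kernel \<alpha> y (Complex c t))"
proof -
  have cont: "continuous_on A (\<lambda>t. mb_kernel \<alpha> y (Complex c t))" for A
    unfolding mb_kernel_def Complex_eq using assms
    by (auto intro!: continuous_intros continuous_on_compose2[OF continuous_on_Gamma[of "- \<int>\<^sub>\<le>\<^sub>0"]]
         continuous_on_compose2[OF continuous_on_rGamma[of UNIV]]
         simp: Complex_eq[symmetric] Complex_in_nonpos_Ints_iff)
  obtain C \<delta> where C: "C \<ge> 0" "\<delta> > 0" "\<And>t. \<bar>t\<bar> \<ge> 1 \<Longrightarrow> norm (mb_kernel \<alpha> y (Complex c t)) \<le> C * exp (- \<delta> * \<bar>t\<bar>)"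
    using mb_kernel_strip_bound[OF assms(1,2), of c c y] by auto
  have "compact ((\<lambda>t. mb_kernel \<alpha> y (Complex c t)) ` {-1..1})"
    by (intro compact_continuous_image cont) auto
  then obtain D where D: "\<And>t. t \<in> {-1..1} \<Longrightarrow> norm (mb_kernel \<alpha> y (Complex c t)) \<le> D"
    by (metis bounded_iff compact_imp_bounded image_eqI)
  have D0: "D \<ge> 0" using order_trans[OF norm_ge_zero D[of 0]] by simp
  \<comment> \<open>\<open>D\<close> bounds the kernel on [-1, 1], where exp (- \<delta> |t|) may be
    as small as exp (- \<delta>); the factor exp \<delta> compensates.\<close>
  have "integrable lborel (\<lambda>t. (C + D * exp \<delta>) * exp (- \<delta> * \<bar>t\<bar>))"
    by (intro integrable_mult_right integrable_exp_minus_abs C)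
  thus ?thesis
  proof (rule Bochner_Integration.integrable_bound)
    show "(\<lambda>t. mb_kernel \<alpha> y (Complex c t)) \<in> borel_measurable lborel"
      using cont[of UNIV] by (simp add: borel_measurable_continuous_onI)
    show "AE t in lborel. norm (mb_kernel \<alpha> y (Complex c t)) \<le> norm ((C + D * exp \<delta>) * exp (- \<delta> * \<bar>t\<bar>))"
    proof (rule AE_I2)
      fix t :: real
      have "norm (mb_kernel \<alpha> y (Complex c t)) \<le> (C + D * exp \<delta>) * exp (- \<delta> * \<bar>t\<bar>)"
      proof (cases "\<bar>t\<bar> \<ge> 1")
        case True
        have "C * exp (- \<delta> * \<bar>t\<bar>) \<le> (C + D * exp \<delta>) * exp (- \<delta> * \<bar>t\<bar>)"
          using D0 by (intro mult_right_mono) auto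
        with C(3)[OF True] show ?thesis by linarith
      next
        case False
        have "norm (mb_kernel \<alpha> y (Complex c t)) \<le> D * 1" 
          using D[of t] False by (smt (verit) atLeastAtMost_iff mult_1_right)
        also have "\<dots> \<le> D * exp (\<delta> - \<delta> * \<bar>t\<bar>)" using False C D0 by (intro mult_left_mono) auto
        also have "\<dots> = D * exp \<delta> * exp (- \<delta> * \<bar>t\<bar>)" by (simp add: exp_diff exp_minus field_simps)
        also have "\<dots> \<le> (C + D * exp \<delta>) * exp (- \<delta> * \<bar>t\<bar>)" using C by (intro mult_right_mono) auto
        finally show ?thesis .
      qed
      thus "norm (mb_kernel \<alpha> y (Complex c t)) \<le> norm ((C + D * exp \<delta>) * exp (- \<delta> * \<bar>t\<bar>))" by simp
    qed
  qed
qed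

text \<open>The recurrence isolates the simple pole at -N. The identity also holds at every pole:
  with z = -k the left side is 0 by convention, and on the right a denominator is 0 if k <= N, while
  the numerator is again a Gamma value at a pole if k > N.\<close>

lemma Gamma_split_pole:
  fixes z :: complex
  shows "Gamma z = Gamma (z + of_nat (Suc N)) / pochhammer z N / (z + of_nat N)"
proof (cases "z \<in> \<int>\<^sub>\<le>\<^sub>0")
  case False
  hence "pochhammer z N \<noteq> 0" "z + of_nat N \<noteq> 0" "Gamma z \<noteq> 0"
    using pochhammer_eq_0_imp_nonpos_Int[of z N] pochhammer_eq_0_imp_nonpos_Int[of z "Suc N"]
    by (auto simp: Gamma_eq_zero_iff pochhammer_rec')
  moreover have "Gamma (z + of_nat (Suc N)) = (z + of_nat N) * pochhammer z N * Gamma z"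
    using pochhammer_Gamma[OF False, of "Suc N"] \<open>Gamma z \<noteq> 0\<close>
    by (simp add: pochhammer_rec' nonzero_eq_divide_eq)
  ultimately show ?thesis by simp
next
  case True
  then obtain k where k: "z = - of_nat k" by (auto elim: nonpos_Ints_cases')
  have "Gamma (z + of_nat (Suc N)) = 0 \<or> pochhammer z N = 0 \<or> z + of_nat N = 0"
  proof (cases k N rule: linorder_cases)
    case less thus ?thesis by (auto simp: k pochhammer_eq_0_iff)
  next
    case greater
    hence "z + of_nat (Suc N) = - of_nat (k - Suc N)" by (simp add: k of_nat_diff)
    thus ?thesis by (metis Gamma_neg_of_nat)
  qed (auto simp: k)
  thus ?thesis using True by (auto simp: k)
qed

text \<open>The hypotheses place exactly one pole, -N, between the lines. For N = 0 there is no pole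
  further right, so \<open>b\<close> has no upper limit.\<close>

lemma vline_integral_mb_kernel_shift:
  assumes \<alpha>: "0 < \<alpha>" "\<alpha> < 1"
    and ab: "- real N - 1 < a" "a < - real N" "- real N < b" "N = 0 \<or> b < 1 - real N"
  shows "vline_integral (mb_kernel \<alpha> y) b - vline_integral (mb_kernel \<alpha> y) a =
           of_real ((-1) ^ N / fact N * rGamma (1 - \<alpha> - \<alpha> * real N) * exp (real N * ln y))"
proof -
  define h where "h = (\<lambda>u::complex. Gamma (u + of_nat (Suc N)) / pochhammer u N *
      rGamma (1 - of_real \<alpha> + of_real \<alpha> * u) * exp (- (u * of_real (ln y))))"
  define S where "S = {z. Re z > - real N - 1} \<inter> {z. Re z < (if N = 0 then b + 1 else 1 - real N)}"
  obtain C \<delta> where C: "C \<ge> 0" "\<delta> > 0" "\<And>\<sigma> t. \<sigma> \<in> {a..b} \<Longrightarrow> \<bar>t\<bar> \<ge> 1 \<Longrightarrow>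
      norm (mb_kernel \<alpha> y (Complex \<sigma> t)) \<le> C * exp (- \<delta> * \<bar>t\<bar>)"
    using mb_kernel_strip_bound[OF \<alpha>, of a b y] by auto
  have nonpos: "x \<notin> \<int>\<^sub>\<le>\<^sub>0" if "- real N - 1 < x" "x \<noteq> - real N" "N = 0 \<or> x < 1 - real N" for x :: real
  proof
    assume "x \<in> \<int>\<^sub>\<le>\<^sub>0"
    then obtain k where "x = - of_nat k" by (auto elim: nonpos_Ints_cases')
    thus False using that by auto
  qed
  have "vline_integral (mb_kernel \<alpha> y) b - vline_integral (mb_kernel \<alpha> y) a = h (of_real (- real N))"
  proof (rule vline_integral_shift_simple_pole[where S = S and B = "\<lambda>t. C * exp (- \<delta> * t)"])
    show "open S" "convex S" unfolding S_def
      by (auto intro!: open_Int convex_Int open_halfspace_Re_gt open_halfspace_Re_lt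
            convex_halfspace_Re_gt convex_halfspace_Re_lt)
    show "{z. a \<le> Re z \<and> Re z \<le> b} \<subseteq> S" using ab by (auto simp: S_def)
    show "h holomorphic_on S" unfolding h_def
    proof (intro holomorphic_intros)
      fix z assume z: "z \<in> S"
      show "z + of_nat (Suc N) \<notin> \<int>\<^sub>\<le>\<^sub>0"
        using z by (auto simp: S_def elim!: nonpos_Ints_cases simp: complex_eq_iff)
      show "pochhammer z N \<noteq> 0"
        using z by (auto simp: pochhammer_eq_0_iff S_def split: if_splits)
    qed
    show "mb_kernel \<alpha> y = (\<lambda>z. h z / (z - of_real (- real N)))"
      unfolding mb_kernel_def h_def by (rule ext, subst Gamma_split_pole[of _ N]) simp
    show "integrable lborel (\<lambda>t. mb_kernel \<alpha> y (Complex a t))"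
      using ab by (intro mb_kernel_integrable \<alpha> nonpos) auto
    show "integrable lborel (\<lambda>t. mb_kernel \<alpha> y (Complex b t))"
      using ab by (intro mb_kernel_integrable \<alpha> nonpos) auto
    have "((\<lambda>t. exp (- (\<delta> * t))) \<longlongrightarrow> 0) at_top"
      by (rule filterlim_compose[OF exp_at_bot])
         (use C(2) in \<open>auto simp: filterlim_uminus_at_bot intro!: filterlim_tendsto_pos_mult_at_top[OF tendsto_const] filterlim_ident\<close>)
    from tendsto_mult[OF tendsto_const[of C] this]
    show "((\<lambda>t. C * exp (- \<delta> * t)) \<longlongrightarrow> 0) at_top" by simp
  qed (use ab C in auto)
  \<comment> \<open>At -N the regular part of Gamma is Gamma 1 / \<open>pochhammer (- N) N\<close> =
    (-1)^N / N!.\<close>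
  also have "h (of_real (- real N)) =
      of_real ((-1) ^ N / fact N * rGamma (1 - \<alpha> - \<alpha> * real N) * exp (real N * ln y))"
  proof -
    have "rGamma (1 - of_real \<alpha> + of_real \<alpha> * of_real (- real N)) =
          (of_real (rGamma (1 - \<alpha> - \<alpha> * real N)) :: complex)"
      by (subst rGamma_complex_of_real[symmetric]) simp
    moreover have "1 / ((-1) ^ N * fact N) = ((-1) ^ N / fact N :: complex)"
      by (cases "even N") auto
    ultimately show ?thesis
      unfolding h_def by (simp add: pochhammer_same exp_of_real[symmetric])
  qed
  finally show ?thesis .
qed

section \<open>Vanishing of the integral as the line moves to the left\<close>

lemma norm_Gamma_half_le: "norm (Gamma (Complex (1/2) t)) \<le> sqrt (2 * pi) * exp (- (pi / 2) * \<bar>t\<bar>)"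
proof (rule power2_le_imp_le)
  let ?z = "Complex (1/2) t"
  have cnj: "1 - ?z = cnj ?z" by (simp add: complex_eq_iff)
  \<comment> \<open>On this line the sine has modulus cosh (pi t), which has no zero; so, unlike in
    \<open>Gamma_strip_bound\<close>, small t are covered too.\<close>
  have "exp (pi * \<bar>t\<bar>) / 2 \<le> norm (sin (of_real pi * ?z))"
  proof (rule power2_le_imp_le)
    define e where "e = exp (pi * t)"
    have e: "e > 0" by (simp add: e_def)
    have "(norm (sin (of_real pi * ?z)))\<^sup>2 = ((e + inverse e) / 2)\<^sup>2"
    proof -
      have "exp (2 * (pi * t)) = e * e" unfolding e_def exp_add[symmetric] by simp
      thus ?thesis using e unfolding norm_sin_squared
        by (simp add: power2_eq_square field_simps)
    qed
    moreover have "exp (pi * \<bar>t\<bar>) \<le> e + inverse e"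
      by (cases "t \<ge> 0") (auto simp: e_def exp_minus[symmetric])
    ultimately show "(exp (pi * \<bar>t\<bar>) / 2)\<^sup>2 \<le> (norm (sin (of_real pi * ?z)))\<^sup>2"
      using e by (auto intro!: power_mono)
  qed auto
  moreover have "(norm (Gamma ?z))\<^sup>2 = pi / norm (sin (of_real pi * ?z))"
  proof -
    have "(norm (Gamma ?z))\<^sup>2 = norm (Gamma ?z * cnj (Gamma ?z))"
      by (simp add: norm_mult power2_eq_square)
    also have "\<dots> = norm (of_real pi / sin (of_real pi * ?z))"
      using Gamma_reflection_complex[of ?z] unfolding cnj by (simp add: cnj_Gamma)
    finally show ?thesis by (simp add: norm_divide)
  qed
  ultimately have "(norm (Gamma ?z))\<^sup>2 \<le> pi / (exp (pi * \<bar>t\<bar>) / 2)"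
    by (simp only:) (intro divide_left_mono mult_pos_pos, auto intro: less_le_trans[OF _ \<open>exp (pi * \<bar>t\<bar>) / 2 \<le> _\<close>])
  also have "\<dots> = (sqrt (2 * pi) * exp (- (pi / 2) * \<bar>t\<bar>))\<^sup>2"
  proof -
    have "(exp (- (pi / 2) * \<bar>t\<bar>))\<^sup>2 = inverse (exp (pi * \<bar>t\<bar>))"
      unfolding power2_eq_square exp_add[symmetric] exp_minus[symmetric] by simp
    thus ?thesis by (simp only: power_mult_distrib) (simp add: field_simps)
  qed
  finally show "(norm (Gamma ?z))\<^sup>2 \<le> (sqrt (2 * pi) * exp (- (pi / 2) * \<bar>t\<bar>))\<^sup>2" .
qed auto

text \<open>Listed in descending order, the factors can be compared one by one with the factors w +
  k met when moving from a far-left line back to the right.\<close>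

lemma pochhammer_rising: "pochhammer (1 + x) n = (\<Prod>k<n. real (n - k) + x)"
  unfolding pochhammer_prod atLeast0LessThan
  by (rule prod.reindex_bij_witness[of _ "\<lambda>k. n - Suc k" "\<lambda>k. n - Suc k"]) (auto simp: of_nat_diff)

text \<open>The last n - m factors are at least 1, 2, ..., n - m. This is the factorial that
  eventually beats the geometric growth.\<close>

lemma pochhammer_one_plus_ge:
  fixes x :: real
  assumes "x \<ge> 0" "m \<le> n"
  shows "pochhammer (1 + x) n \<ge> pochhammer (1 + x) m * fact (n - m)"
proof -
  have "fact (n - m) = pochhammer (1::real) (n - m)" by (simp add: pochhammer_fact)
  also have "\<dots> \<le> pochhammer (1 + x + real m) (n - m)"
    using assms unfolding pochhammer_prod by (intro prod_mono) auto
  finally have "pochhammer (1 + x) m * fact (n - m) \<le> pochhammer (1 + x) m * pochhammer (1 + x + real m) (n - m)"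
    using assms by (intro mult_left_mono pochhammer_nonneg) auto
  thus ?thesis using assms pochhammer_product[of m n "1 + x"] by simp
qed

lemma norm_Complex_ge: "(\<bar>a\<bar> + \<bar>b\<bar>) / 2 \<le> norm (Complex a b)"
  using abs_Re_le_cmod[of "Complex a b"] abs_Im_le_cmod[of "Complex a b"] by simp

text \<open>The line lies midway between two poles. N + 1 recurrence steps lead to Re = 1/2; each of
  the first N factors is at least half of (N - k) + |t| and the last at least 1/2, which gives the
  power of 2.\<close>

lemma norm_Gamma_left_le:
  "norm (Gamma (Complex (- real N - 1/2) t)) \<le>
     sqrt (2 * pi) * exp (- (pi / 2) * \<bar>t\<bar>) * 2 ^ (N + 1) / pochhammer (1 + \<bar>t\<bar>) N"
proof -
  define w where "w = Complex (- real N - 1/2) t"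
  have nz: "w \<notin> \<int>\<^sub>\<le>\<^sub>0"
  proof
    assume "w \<in> \<int>\<^sub>\<le>\<^sub>0"
    then obtain k where "w = - of_nat k" by (auto elim: nonpos_Ints_cases')
    hence "2 * k = 2 * N + 1" by (auto simp: w_def complex_eq_iff)
    thus False by presburger
  qed
  have shift: "w + of_nat (N + 1) = Complex (1/2) t" by (simp add: w_def complex_eq_iff)
  have P0: "pochhammer (1 + \<bar>t\<bar>) N > 0" by (intro pochhammer_pos) auto
  have "pochhammer w (N + 1) = Gamma (Complex (1/2) t) / Gamma w"
    using pochhammer_Gamma[OF nz, of "N + 1"] by (simp only: shift)
  moreover have "Gamma w \<noteq> 0" using nz by (simp add: Gamma_eq_zero_iff)
  ultimately have eq: "norm (Gamma w) * norm (pochhammer w (N + 1)) = norm (Gamma (Complex (1/2) t))"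
    by (simp add: norm_mult[symmetric])
  have "pochhammer (1 + \<bar>t\<bar>) N / 2 ^ (N + 1) = (\<Prod>k<N. (real (N - k) + \<bar>t\<bar>) / 2) * (1 / 2)"
    by (simp add: pochhammer_rising prod_dividef)
  also have "\<dots> \<le> (\<Prod>k<N. norm (w + of_nat k)) * norm (w + of_nat N)"
  proof (intro mult_mono prod_mono conjI)
    fix k assume k: "k \<in> {..<N}"
    have "w + of_nat k = Complex (- real (N - k) - 1/2) t"
      using k by (simp add: w_def complex_eq_iff of_nat_diff)
    moreover have "(real (N - k) + \<bar>t\<bar>) / 2 \<le> (\<bar>- real (N - k) - 1/2\<bar> + \<bar>t\<bar>) / 2" by simp
    ultimately show "(real (N - k) + \<bar>t\<bar>) / 2 \<le> norm (w + of_nat k)"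
      using norm_Complex_ge[of "- real (N - k) - 1/2" t] by (metis order_trans)
  next
    have "w + of_nat N = Complex (- 1/2) t" by (simp add: w_def complex_eq_iff)
    thus "1 / 2 \<le> norm (w + of_nat N)" using abs_Re_le_cmod[of "w + of_nat N"] by simp
  qed (auto intro!: prod_nonneg)
  also have "\<dots> = norm (pochhammer w (N + 1))"
    by (simp add: pochhammer_prod prod_norm norm_mult atLeast0LessThan)
  finally have "norm (Gamma w) * (pochhammer (1 + \<bar>t\<bar>) N / 2 ^ (N + 1)) \<le> norm (Gamma (Complex (1/2) t))"
    unfolding eq[symmetric] by (intro mult_left_mono) auto
  also note norm_Gamma_half_le
  finally show ?thesis using P0 by (simp add: w_def field_simps)
qed

text \<open>M recurrence steps lead to the real part \<open>b\<close>; since b lies in [1, 2], each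
  factor is at most (M - k) + |t|. Bounding by |t| although the imaginary part is \<open>s\<close>
  produces the same Pochhammer base as for Gamma, so the two bounds can be divided.\<close>

lemma norm_rGamma_left_le:
  assumes b: "1 \<le> b" "b \<le> 2" and s: "\<bar>s\<bar> \<le> \<bar>t\<bar>"
  shows "norm (rGamma (Complex (b - real M) s)) \<le>
           pochhammer (1 + \<bar>t\<bar>) M * (rGamma b * exp (pi / 2 * \<bar>s\<bar>))"
proof -
  define w where "w = Complex (b - real M) s"
  have shift: "w + of_nat M = Complex b s" by (simp add: w_def complex_eq_iff)
  have "norm (rGamma w) = (\<Prod>k<M. norm (w + of_nat k)) * norm (rGamma (Complex b s))"
    using pochhammer_rGamma[of w M] unfolding shift
    by (simp add: norm_mult pochhammer_prod prod_norm atLeast0LessThan)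
  also have "\<dots> \<le> (\<Prod>k<M. real (M - k) + \<bar>t\<bar>) * (rGamma b * exp (pi / 2 * \<bar>s\<bar>))"
  proof (intro mult_mono prod_mono conjI norm_rGamma_le)
    fix k assume k: "k \<in> {..<M}"
    have "w + of_nat k = Complex (b - real (M - k)) s"
      using k by (simp add: w_def complex_eq_iff of_nat_diff)
    moreover have "\<bar>b - real (M - k)\<bar> \<le> real (M - k)" using k b by (auto simp: of_nat_diff abs_le_iff)
    ultimately show "norm (w + of_nat k) \<le> real (M - k) + \<bar>t\<bar>"
      using norm_Complex_le[of "b - real (M - k)" s] s by simp
  qed (use b in \<open>auto intro!: prod_nonneg\<close>)
  finally show ?thesis by (simp add: w_def pochhammer_rising)
qed

text \<open>\<open>M N\<close> is the number of unit steps that lift 1 - \<alpha> (N + 3/2), the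
  real part of the \<open>rGamma\<close> argument on Re u = -N - 1/2, into [1, 2]. As N -
  \<open>M N\<close> grows at least like (1 - \<alpha>) N, A^N is at most a constant times B^(N -
  \<open>M N\<close>), which the factorial beats.\<close>

lemma power_over_fact_lag_tendsto_0:
  fixes \<alpha> A :: real
  assumes \<alpha>: "0 < \<alpha>" "\<alpha> < 1" and A: "A \<ge> 0"
  defines "M \<equiv> \<lambda>N. nat \<lceil>\<alpha> * (real N + 3/2)\<rceil>"
  shows "(\<lambda>N. A ^ N / fact (N - M N)) \<longlonglongrightarrow> 0"
    and "eventually (\<lambda>N. M N \<le> N) sequentially"
proof -
  \<comment> \<open>Enlarging A to at least 1 makes ln \<open>A'\<close> nonnegative;
    \<open>B\<close> is then \<open>A'\<close> to the power 1 / (1 - \<alpha>).\<close>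
  define A' where "A' = max 1 A"
  define B where "B = exp (ln A' / (1 - \<alpha>))"
  have M: "real (M N) \<le> \<alpha> * real N + 5/2" for N
  proof -
    have "\<alpha> * (real N + 3/2) \<ge> 0" using \<alpha> by simp
    hence "real (M N) \<le> \<alpha> * (real N + 3/2) + 1" unfolding M_def by linarith
    also have "\<dots> \<le> \<alpha> * real N + 5/2" using \<alpha> by (simp add: algebra_simps)
    finally show ?thesis .
  qed
  have lag: "real (N - M N) \<ge> (1 - \<alpha>) * real N - 5/2" for N
    using M[of N] by (auto simp: algebra_simps of_nat_diff_real)
  have lim: "filterlim (\<lambda>N. (1 - \<alpha>) * real N - 5/2) at_top sequentially"
    using \<alpha> by real_asymp
  hence "eventually (\<lambda>N. (1 - \<alpha>) * real N - 5/2 \<ge> 0) sequentially"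
    unfolding filterlim_at_top by blast
  thus "eventually (\<lambda>N. M N \<le> N) sequentially"
  proof eventually_elim
    case (elim N)
    have "real (M N) \<le> real N" using M[of N] elim by (simp add: algebra_simps)
    thus ?case by simp
  qed
  have "filterlim (\<lambda>N. real (N - M N)) at_top sequentially"
    by (rule filterlim_at_top_mono[OF lim]) (use lag in auto)
  hence top: "filterlim (\<lambda>N. N - M N) at_top sequentially"
    by (simp add: filterlim_at_top eventually_sequentially) (metis of_nat_le_iff)
  have "(\<lambda>k. B ^ k / fact k) \<longlonglongrightarrow> 0"
    using summable_LIMSEQ_zero[OF summable_exp[of B]] by (simp add: field_simps)
  from filterlim_compose[OF this top]
  have "(\<lambda>N. B ^ (N - M N) / fact (N - M N)) \<longlonglongrightarrow> 0" .
  from tendsto_mult[OF tendsto_const[of "exp (5/2 * (ln A' / (1 - \<alpha>)))"] this]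
  have lim0: "(\<lambda>N. exp (5/2 * (ln A' / (1 - \<alpha>))) * (B ^ (N - M N) / fact (N - M N))) \<longlonglongrightarrow> 0" by simp
  show "(\<lambda>N. A ^ N / fact (N - M N)) \<longlonglongrightarrow> 0"
  proof (rule Lim_null_comparison[OF always_eventually lim0], rule allI)
    fix N
    have A': "A' \<ge> 1" by (simp add: A'_def)
    have "A ^ N \<le> A' ^ N" using A by (intro power_mono) (auto simp: A'_def)
    also have "\<dots> = exp (real N * ln A')" using A' by (simp add: exp_of_nat_mult)
    also have "\<dots> \<le> exp ((5/2 + real (N - M N)) * (ln A' / (1 - \<alpha>)))"
    proof -
      have "real N * ln A' = (1 - \<alpha>) * real N * (ln A' / (1 - \<alpha>))" using \<alpha> by simp
      also have "\<dots> \<le> (5/2 + real (N - M N)) * (ln A' / (1 - \<alpha>))"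
        using lag[of N] A' \<alpha> by (intro mult_right_mono) auto
      finally show ?thesis by simp
    qed
    also have "\<dots> = exp (5/2 * (ln A' / (1 - \<alpha>))) * B ^ (N - M N)"
      unfolding B_def exp_of_nat_mult[symmetric] exp_add[symmetric] by (simp only: ring_distribs)
    finally show "norm (A ^ N / fact (N - M N)) \<le> exp (5/2 * (ln A' / (1 - \<alpha>))) * (B ^ (N - M N) / fact (N - M N))"
      using A by (simp add: divide_right_mono)
  qed
qed

text \<open>On Re u = -N - 1/2 Gamma is divided by a Pochhammer symbol of length N, whereas the
  reciprocal factor gains one of length about \<alpha> N. The quotient is at most 1 / (N -
  \<open>M N\<close>)!, uniformly in t.\<close>

lemma vline_integral_mb_kernel_left_tendsto_0:
  assumes \<alpha>: "0 < \<alpha>" "\<alpha> < 1"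
  shows "(\<lambda>N. vline_integral (mb_kernel \<alpha> y) (- real N - 1/2)) \<longlonglongrightarrow> 0"
proof -
  define M where "M = (\<lambda>N. nat \<lceil>\<alpha> * (real N + 3/2)\<rceil>)"
  \<comment> \<open>The 2 comes from the lower bounds by halves in
    \<open>norm_Gamma_left_le\<close>, the other factor from exp (- u ln y).\<close>
  define A where "A = 2 * exp (ln y)"
  have "A \<ge> 0" by (simp add: A_def)
  hence lag: "(\<lambda>N. A ^ N / fact (N - M N)) \<longlonglongrightarrow> 0" "eventually (\<lambda>N. M N \<le> N) sequentially"
    unfolding M_def by (rule power_over_fact_lag_tendsto_0[OF \<alpha>])+
  have "compact ((\<lambda>\<sigma>. rGamma \<sigma> :: real) ` {1..2})"
    by (intro compact_continuous_image continuous_intros) auto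
  then obtain K where K: "\<And>b. b \<in> {1..2} \<Longrightarrow> norm (rGamma b :: real) \<le> K"
    by (metis bounded_iff compact_imp_bounded image_eqI)
  have K0: "K \<ge> 0" using order_trans[OF norm_ge_zero K[of 1]] by simp
  \<comment> \<open>The full rate is available here because the bounds on these lines lose no
    \<epsilon>.\<close>
  define \<delta> where "\<delta> = pi / 2 * (1 - \<alpha>)"
  have \<delta>: "\<delta> > 0" using \<alpha> by (simp add: \<delta>_def)
  define D where "D = sqrt (2 * pi) * 2 * K * exp (ln y / 2)"
  define J where "J = (\<integral>t. exp (- \<delta> * \<bar>t\<bar>) \<partial>lborel)"
  have bound: "norm (mb_kernel \<alpha> y (Complex (- real N - 1/2) t)) \<le>
      D * (A ^ N / fact (N - M N)) * exp (- \<delta> * \<bar>t\<bar>)" if N: "M N \<le> N" for N t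
  proof -
    define b where "b = 1 - \<alpha> * (real N + 3/2) + real (M N)"
    have "\<alpha> * (real N + 3/2) \<ge> 0" using \<alpha> by simp
    hence b: "1 \<le> b" "b \<le> 2" unfolding b_def M_def by linarith+
    have "1 - \<alpha> + \<alpha> * (- real N - 1/2) = b - real (M N)" by (simp add: b_def algebra_simps)
    hence aff: "1 - of_real \<alpha> + of_real \<alpha> * Complex (- real N - 1/2) t = Complex (b - real (M N)) (\<alpha> * t)"
      by (simp only: Complex_affine)
    let ?P = "pochhammer (1 + \<bar>t\<bar>)"
    have P: "?P n > 0" for n by (intro pochhammer_pos) auto
    have \<alpha>t: "\<bar>\<alpha> * t\<bar> = \<alpha> * \<bar>t\<bar>" using \<alpha> by (simp add: abs_mult)
    have "norm (rGamma (Complex (b - real (M N)) (\<alpha> * t))) \<le> ?P (M N) * (rGamma b * exp (pi / 2 * \<bar>\<alpha> * t\<bar>))"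
      using b \<alpha> by (intro norm_rGamma_left_le) (auto simp: \<alpha>t mult_left_le_one_le)
    also have "\<dots> \<le> ?P (M N) * (K * exp (pi / 2 * (\<alpha> * \<bar>t\<bar>)))"
      using K[of b] b P[of "M N"] unfolding \<alpha>t by (intro mult_left_mono mult_right_mono) auto
    finally have r: "norm (rGamma (Complex (b - real (M N)) (\<alpha> * t))) \<le> \<dots>" .
    have "norm (mb_kernel \<alpha> y (Complex (- real N - 1/2) t)) =
        norm (Gamma (Complex (- real N - 1/2) t)) * norm (rGamma (Complex (b - real (M N)) (\<alpha> * t))) *
        norm (exp (- (Complex (- real N - 1/2) t * of_real (ln y))))"
      by (simp only: mb_kernel_def norm_mult aff)
    also have "\<dots> \<le> (sqrt (2 * pi) * exp (- (pi / 2) * \<bar>t\<bar>) * 2 ^ (N + 1) / ?P N) *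
        (?P (M N) * (K * exp (pi / 2 * (\<alpha> * \<bar>t\<bar>)))) * exp ((real N + 1/2) * ln y)"
      using P K0 by (intro mult_mono r norm_Gamma_left_le)
        (auto intro!: mult_nonneg_nonneg divide_nonneg_pos simp: less_imp_le algebra_simps)
    also have "\<dots> = D * A ^ N * (?P (M N) / ?P N) * exp (- \<delta> * \<bar>t\<bar>)"
    proof -
      have "exp (- (pi / 2) * \<bar>t\<bar>) * exp (pi / 2 * (\<alpha> * \<bar>t\<bar>)) = exp (- \<delta> * \<bar>t\<bar>)"
        unfolding exp_add[symmetric] by (simp add: \<delta>_def field_simps)
      moreover have "exp ((real N + 1/2) * ln y) = exp (ln y) ^ N * exp (ln y / 2)"
        by (simp add: ring_distribs exp_add exp_of_nat_mult)
      ultimately show ?thesis by (simp add: D_def A_def power_mult_distrib mult_ac)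
    qed
    also have "\<dots> \<le> D * A ^ N * (1 / fact (N - M N)) * exp (- \<delta> * \<bar>t\<bar>)"
    proof (intro mult_right_mono mult_left_mono)
      show "?P (M N) / ?P N \<le> 1 / fact (N - M N)"
        using pochhammer_one_plus_ge[of "\<bar>t\<bar>" "M N" N] N P[of N] by (simp add: field_simps)
    qed (use K0 in \<open>auto simp: D_def A_def\<close>)
    finally show ?thesis by simp
  qed
  have vbound: "norm (vline_integral (mb_kernel \<alpha> y) (- real N - 1/2)) \<le> 1 / (2 * pi) * (D * (A ^ N / fact (N - M N)) * J)"
    if N: "M N \<le> N" for N
  proof -
    have "norm (\<integral>t. mb_kernel \<alpha> y (Complex (- real N - 1/2) t) \<partial>lborel) \<le>
          (\<integral>t. D * (A ^ N / fact (N - M N)) * exp (- \<delta> * \<bar>t\<bar>) \<partial>lborel)"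
    proof (rule Bochner_Integration.integral_norm_bound_integral)
      have "- real N - 1/2 \<notin> \<int>\<^sub>\<le>\<^sub>0"
      proof
        assume "- real N - 1/2 \<in> \<int>\<^sub>\<le>\<^sub>0"
        then obtain k where "- real N - 1/2 = - real k" by (auto elim: nonpos_Ints_cases')
        hence "2 * k = 2 * N + 1" by linarith
        thus False by presburger
      qed
      thus "integrable lborel (\<lambda>t. mb_kernel \<alpha> y (Complex (- real N - 1/2) t))"
        by (intro mb_kernel_integrable \<alpha>)
      show "integrable lborel (\<lambda>t. D * (A ^ N / fact (N - M N)) * exp (- \<delta> * \<bar>t\<bar>))"
        by (intro integrable_mult_right integrable_exp_minus_abs \<delta>)
    qed (use bound[OF N] in auto)
    also have "\<dots> = D * (A ^ N / fact (N - M N)) * J" by (simp add: J_def)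
    finally have "1 / (2 * pi) * norm (\<integral>t. mb_kernel \<alpha> y (Complex (- real N - 1/2) t) \<partial>lborel) \<le>
        1 / (2 * pi) * (D * (A ^ N / fact (N - M N)) * J)"
      by (intro mult_left_mono) auto
    thus ?thesis unfolding vline_integral_def norm_mult norm_of_real by simp
  qed
  have ev: "eventually (\<lambda>N. norm (vline_integral (mb_kernel \<alpha> y) (- real N - 1/2)) \<le>
      1 / (2 * pi) * (D * (A ^ N / fact (N - M N)) * J)) sequentially"
    by (rule eventually_mono[OF lag(2) vbound])
  have "(\<lambda>N. 1 / (2 * pi) * (D * (A ^ N / fact (N - M N)) * J)) \<longlonglongrightarrow> 1 / (2 * pi) * (D * 0 * J)"
    by (intro tendsto_intros lag(1))
  thus ?thesis by (intro Lim_null_comparison[OF ev]) simp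
qed

text \<open>The line goes from c to -1/2 and then by unit steps to -N - 1/2, crossing one pole each
  time. The partial sums telescope and the remaining integral tends to 0.\<close>

lemma mb_kernel_sums:
  assumes \<alpha>: "0 < \<alpha>" "\<alpha> < 1" and c: "c > 0"
  shows "(\<lambda>n. of_real ((-1) ^ n / fact n * rGamma (1 - \<alpha> - \<alpha> * real n) * exp (real n * ln y)))
           sums vline_integral (mb_kernel \<alpha> y) c"
proof -
  let ?a = "\<lambda>n. complex_of_real ((-1) ^ n / fact n * rGamma (1 - \<alpha> - \<alpha> * real n) * exp (real n * ln y))"
  let ?V = "vline_integral (mb_kernel \<alpha> y)"
  have "(\<Sum>n\<le>N. ?a n) = ?V c - ?V (- real N - 1/2)" for N
  proof (induction N)
    case 0
    show ?case using vline_integral_mb_kernel_shift[OF \<alpha>, of 0 "-1/2" c y] c by simp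
  next
    case (Suc N)
    have "?V (- real N - 1/2) - ?V (- real (Suc N) - 1/2) = ?a (Suc N)"
      by (rule vline_integral_mb_kernel_shift[OF \<alpha>]) auto
    thus ?case unfolding sum.atMost_Suc Suc.IH by (simp only: algebra_simps)
  qed
  moreover have "(\<lambda>N. ?V c - ?V (- real N - 1/2)) \<longlonglongrightarrow> ?V c - 0"
    by (intro tendsto_intros vline_integral_mb_kernel_left_tendsto_0 \<alpha>)
  ultimately show ?thesis by (simp add: sums_def_le)
qed

subsection \<open>The density and the Fox function in terms of one series\<close>

text \<open>For y = \<open>x powr - \<alpha>\<close> this is the residue of
  \<open>levy_kernel\<close> at u = -(n + 1); the index m of the residue classes is thus n +
  1.\<close>

definition levy_series_term :: "real \<Rightarrow> real \<Rightarrow> nat \<Rightarrow> real" where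
  "levy_series_term \<alpha> y n = (-1) ^ n / fact n * rGamma (1 - \<alpha> * real (Suc n)) * y ^ Suc n"

definition levy_kernel :: "real \<Rightarrow> real \<Rightarrow> complex \<Rightarrow> complex" where
  "levy_kernel \<alpha> x u = Gamma (1 + u) * rGamma (1 + of_real \<alpha> * u) * exp (of_real \<alpha> * u * of_real (ln x))"

lemma vline_integral_cong:
  assumes "\<And>t. f (Complex c t) = g (Complex c t)"
  shows "vline_integral f c = vline_integral g c"
  using assms by (simp add: vline_integral_def)

lemma vline_integral_cmult: "vline_integral (\<lambda>s. a * f s) c = a * vline_integral f c"
  by (simp add: vline_integral_def)

text \<open>The modulus appears because \<open>vline_integral\<close> always runs upwards. The
  density uses a negative factor, k = -1 / \<alpha>.\<close>

lemma vline_integral_affine: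
  assumes "k \<noteq> 0"
  shows "vline_integral (\<lambda>s. g (of_real a + of_real k * s)) c = vline_integral g (a + k * c) / of_real \<bar>k\<bar>"
proof -
  have "of_real a + of_real k * Complex c t = Complex (a + k * c) (k * t)" for t
    by (simp add: complex_eq_iff)
  moreover have "integral\<^sup>L lborel (\<lambda>t. g (Complex (a + k * c) t)) =
      \<bar>k\<bar> *\<^sub>R integral\<^sup>L lborel (\<lambda>t. g (Complex (a + k * c) (k * t)))"
    using lborel_integral_real_affine[OF assms, of "\<lambda>t. g (Complex (a + k * c) t)" 0] by simp
  ultimately show ?thesis using assms
    by (simp add: vline_integral_def scaleR_conv_of_real)
qed

lemma levy_series_term_sums:
  assumes "0 < \<alpha>" "\<alpha> < 1" "0 < x" "- 1 < c"
  shows "(\<lambda>n. complex_of_real (levy_series_term \<alpha> (x powr - \<alpha>) n)) sums vline_integral (levy_kernel \<alpha> x) c"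
proof -
  define y where "y = x powr - \<alpha>"
  have y: "y > 0" "ln y = - \<alpha> * ln x" using assms by (auto simp: y_def ln_powr)
  have "vline_integral (levy_kernel \<alpha> x) c =
        vline_integral (\<lambda>u. of_real y * mb_kernel \<alpha> y (of_real 1 + of_real 1 * u)) c"
  proof (rule vline_integral_cong)
    fix t :: real
    have "of_real y * exp (- ((1 + u) * of_real (ln y))) = exp (of_real \<alpha> * u * of_real (ln x))" for u :: complex
    proof -
      have "of_real y = exp (complex_of_real (ln y))" unfolding exp_of_real using y(1) by simp
      thus ?thesis unfolding y(2) by (simp add: exp_add[symmetric] algebra_simps)
    qed
    thus "levy_kernel \<alpha> x (Complex c t) = of_real y * mb_kernel \<alpha> y (of_real 1 + of_real 1 * Complex c t)"
      by (simp add: levy_kernel_def mb_kernel_def algebra_simps)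
  qed
  also have "\<dots> = of_real y * vline_integral (mb_kernel \<alpha> y) (1 + c)"
    unfolding vline_integral_cmult by (subst vline_integral_affine) auto
  finally have "vline_integral (levy_kernel \<alpha> x) c = of_real y * vline_integral (mb_kernel \<alpha> y) (1 + c)" .
  moreover have "(\<lambda>n. of_real y * complex_of_real ((-1) ^ n / fact n * rGamma (1 - \<alpha> - \<alpha> * real n) * exp (real n * ln y)))
      sums (of_real y * vline_integral (mb_kernel \<alpha> y) (1 + c))"
    using assms by (intro sums_mult mb_kernel_sums) auto
  moreover have "of_real y * complex_of_real ((-1) ^ n / fact n * rGamma (1 - \<alpha> - \<alpha> * real n) * exp (real n * ln y)) =
      of_real (levy_series_term \<alpha> y n)" for n
    using y(1) by (simp add: levy_series_term_def exp_of_nat_mult algebra_simps)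
  ultimately show ?thesis by (simp add: y_def)
qed

text \<open>No new estimate is made: up to a factor y this is a power series in y, its convergence
  at y + 1 is part of the residue expansion, and so it converges absolutely at y. Splitting into
  residue classes relies on this.\<close>

lemma summable_levy_series_term:
  assumes "0 < \<alpha>" "\<alpha> < 1" "0 < y"
  shows "summable (\<lambda>n. \<bar>levy_series_term \<alpha> y n\<bar>)"
proof -
  define x where "x = (y + 1) powr (- 1 / \<alpha>)"
  have x: "x > 0" "x powr - \<alpha> = y + 1" using assms by (auto simp: x_def powr_powr)
  have "summable (\<lambda>n. complex_of_real (levy_series_term \<alpha> (y + 1) n))"
    using levy_series_term_sums[OF assms(1,2) x(1), of 0] x(2) by (auto simp: sums_iff)
  hence "summable (levy_series_term \<alpha> (y + 1))" by (simp only: summable_complex_of_real)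
  from summable_mult[OF this, of "inverse (y + 1)"]
  moreover have "inverse (y + 1) * levy_series_term \<alpha> (y + 1) n =
      (-1) ^ n / fact n * rGamma (1 - \<alpha> * real (Suc n)) * (y + 1) ^ n" for n
    using assms by (simp add: levy_series_term_def)
  ultimately have "summable (\<lambda>n. (-1) ^ n / fact n * rGamma (1 - \<alpha> * real (Suc n)) * (y + 1) ^ n)"
    by simp
  hence "summable (\<lambda>n. norm ((-1) ^ n / fact n * rGamma (1 - \<alpha> * real (Suc n)) * y ^ n))"
    by (rule powser_insidea) (use assms in auto)
  from summable_mult[OF this, of y] show ?thesis
    using assms by (simp add: levy_series_term_def abs_mult field_simps)
qed

lemma vline_integral_levy_kernel:
  assumes "0 < \<alpha>" "\<alpha> < 1" "0 < x" "- 1 < c"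
  shows "vline_integral (levy_kernel \<alpha> x) c = of_real (\<Sum>n. levy_series_term \<alpha> (x powr - \<alpha>) n)"
proof -
  have "levy_series_term \<alpha> (x powr - \<alpha>) sums (\<Sum>n. levy_series_term \<alpha> (x powr - \<alpha>) n)"
    using summable_rabs_cancel[OF summable_levy_series_term[OF assms(1,2), of "x powr - \<alpha>"]] assms
    by (simp add: summable_sums)
  hence "(\<lambda>n. complex_of_real (levy_series_term \<alpha> (x powr - \<alpha>) n)) sums
           of_real (\<Sum>n. levy_series_term \<alpha> (x powr - \<alpha>) n)"
    by (simp only: sums_of_real_iff)
  thus ?thesis using levy_series_term_sums[OF assms] by (metis sums_unique2)
qed

lemma of_real_powr_exp: "x > 0 \<Longrightarrow> of_real x powr (s :: complex) = exp (s * of_real (ln x))"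
  by (simp add: powr_def Ln_of_real)

theorem levy_density_eq_series:
  assumes "0 < \<alpha>" "\<alpha> < 1" "0 < x" "0 < c" "c < \<alpha>"
  shows "levy_density \<alpha> c x = of_real (\<alpha> / x * (\<Sum>n. levy_series_term \<alpha> (x powr - \<alpha>) n))"
proof -
  have "levy_density \<alpha> c x =
      vline_integral (\<lambda>s. of_real (1 / x) * levy_kernel \<alpha> x (of_real (1 / \<alpha>) + of_real (- 1 / \<alpha>) * s)) c"
    unfolding levy_density_def
  proof (rule vline_integral_cong)
    fix t :: real
    define s where "s = Complex c t"
    define u where "u = (1 - s) / of_real \<alpha>"
    have u': "of_real (1 / \<alpha>) + of_real (- 1 / \<alpha>) * s = u"
      by (simp add: u_def diff_divide_distrib)
    have \<alpha>u: "of_real \<alpha> * u = 1 - s" using assms by (simp add: u_def)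
    have "Re u > 0" using assms by (simp add: u_def s_def Re_divide_of_real)
    hence nz: "u \<noteq> 0" "u \<notin> \<int>\<^sub>\<le>\<^sub>0" by (auto elim!: nonpos_Ints_cases)
    \<comment> \<open>Together the two recurrences trade
      \<open>Gamma u * rGamma (\<alpha> u) / \<alpha>\<close> for
      \<open>Gamma (1 + u) * rGamma (1 + \<alpha> u)\<close>: the factors u and \<alpha>
      cancel.\<close>
    have G: "Gamma (1 + u) = u * Gamma u" using Gamma_plus1[OF nz(2)] by (simp add: add.commute)
    have R: "rGamma (1 - s) = of_real \<alpha> * u * rGamma (1 + of_real \<alpha> * u)"
      using rGamma_plus1[of "of_real \<alpha> * u"] by (simp add: \<alpha>u add.commute)
    have "of_real x powr (- s) = exp ((1 - s) * of_real (ln x) - of_real (ln x))"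
      using assms by (simp add: of_real_powr_exp algebra_simps)
    also have "\<dots> = of_real (1 / x) * exp (of_real \<alpha> * u * of_real (ln x))"
      using assms unfolding \<alpha>u exp_diff by (simp add: exp_of_real)
    finally have "Gamma ((1 - s) / of_real \<alpha>) * rGamma (1 - s) / of_real \<alpha> * of_real x powr (- s) =
        Gamma u * (of_real \<alpha> * u * rGamma (1 + of_real \<alpha> * u)) / of_real \<alpha> *
        (of_real (1 / x) * exp (of_real \<alpha> * u * of_real (ln x)))"
      by (simp only: R u_def[symmetric])
    also have "\<dots> = of_real (1 / x) * levy_kernel \<alpha> x u"
      using assms by (simp add: levy_kernel_def G)
    finally show "Gamma ((1 - Complex c t) / of_real \<alpha>) * rGamma (1 - Complex c t) / of_real \<alpha> * of_real x powr (- Complex c t) =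
       of_real (1 / x) * levy_kernel \<alpha> x (of_real (1 / \<alpha>) + of_real (- 1 / \<alpha>) * Complex c t)"
      unfolding s_def[symmetric] u' .
  qed
  also have "\<dots> = of_real (1 / x) * (vline_integral (levy_kernel \<alpha> x) (1 / \<alpha> + - 1 / \<alpha> * c) / of_real \<bar>- 1 / \<alpha>\<bar>)"
    unfolding vline_integral_cmult by (subst vline_integral_affine) (use assms in auto)
  also have "vline_integral (levy_kernel \<alpha> x) (1 / \<alpha> + - 1 / \<alpha> * c) =
      of_real (\<Sum>n. levy_series_term \<alpha> (x powr - \<alpha>) n)"
    using assms by (intro vline_integral_levy_kernel) (auto simp: field_simps)
  finally show ?thesis using assms by simp
qed

section \<open>The Fox functions, reduced by Gauss' formula\<close>

text \<open>For n > 0 this is the product of Gamma (k / n) over 0 < k < n, by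
  \<open>prod_rGamma_fraction\<close>.\<close>

definition gauss_const :: "nat \<Rightarrow> real" where
  "gauss_const n = (2 * pi) powr ((real n - 1) / 2) / sqrt (real n)"

lemma gauss_const_pos: "n > 0 \<Longrightarrow> gauss_const n > 0"
  by (simp add: gauss_const_def)

lemma prod_rGamma_gauss:
  fixes z :: "'a :: Gamma"
  assumes "n > 0"
  shows "rGamma (1 + z) * (\<Prod>k=1..<n. rGamma (z + of_nat k / of_nat n)) =
           rGamma (1 + of_nat n * z) * exp (of_nat n * z * of_real (ln (real n))) / of_real (gauss_const n)"
  using rGamma_multiplication[OF assms, of z] gauss_const_pos[OF assms]
  by (simp add: gauss_const_def[symmetric] exp_minus)

text \<open>Unconditional, since \<open>Gamma\<close> is \<open>0\<close> at its poles and the poles on both sides agree.\<close>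
lemma prod_Gamma_gauss:
  fixes z :: "'a :: Gamma"
  assumes "n > 0"
  shows "Gamma (1 + z) * (\<Prod>k=1..<n. Gamma (z + of_nat k / of_nat n)) =
           of_real (gauss_const n) * exp (- (of_nat n * z * of_real (ln (real n)))) * Gamma (1 + of_nat n * z)"
  using arg_cong[OF prod_rGamma_gauss[OF assms, of z], of inverse]
  by (simp add: Gamma_def prod_inversef[unfolded o_def] exp_minus divide_inverse mult_ac)

lemma prod_list_map_upt: "prod_list (map f [a..<b]) = (\<Prod>k=a..<b. f k)"
  using prod.distinct_set_conv_list[of "[a..<b]" f] by simp

lemma fox_kernel_length:
  "m = length bs \<Longrightarrow> fox_kernel m 0 as bs s =
     prod_list (map (\<lambda>(b,B). Gamma (of_real b + of_real B * s)) bs) *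
     prod_list (map (\<lambda>(a,A). rGamma (of_real a + of_real A * s)) as)"
  by (simp add: fox_kernel_def)

text \<open>Gauss' formula is applied at s with q factors and at l s with p factors. The powers
  q^(-q s), p^(p l s) and z^(-s) must then merge into x^(p l s), which dictates the argument
  z.\<close>

lemma fox_H_levy:
  assumes "0 < p" "p < q" "0 < l" "real p * l < real q" "0 < x" "z > 0"
    and lnz: "ln z = real p * l * ln (real p) - real p * l * ln x - real q * ln (real q)"
    and sep: "fox_separating q 0 ((1, l) # map (\<lambda>k. (real k / real p, l)) [1..<p])
                             ((1, 1) # map (\<lambda>k. (real k / real q, 1)) [1..<q]) c"
  defines "\<alpha> \<equiv> real p * l / real q"
  shows "fox_H q 0 ((1, l) # map (\<lambda>k. (real k / real p, l)) [1..<p])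
                    ((1, 1) # map (\<lambda>k. (real k / real q, 1)) [1..<q]) c z =
         of_real (gauss_const q / (gauss_const p * real q) * (\<Sum>n. levy_series_term \<alpha> (x powr - \<alpha>) n))"
proof -
  have q: "q > 1" and q0: "q > 0" using assms by simp_all
  \<comment> \<open>The rightmost pole of the Gamma product is -1/q, from the entry (1/q, 1). Lying
    to the right of it means that u = q s satisfies Re u > -1.\<close>
  have c: "real q * c > - 1"
  proof -
    have "(1 / real q, 1) \<in> set (take q ((1, 1) # map (\<lambda>k. (real k / real q, 1::real)) [1..<q]))"
      using q by (force simp: image_iff)
    hence "- (1 / real q) < c" using sep unfolding fox_separating_def by fastforce
    thus ?thesis using q by (simp add: field_simps)
  qed
  have kernel: "fox_kernel q 0 ((1, l) # map (\<lambda>k. (real k / real p, l)) [1..<p])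
                    ((1, 1) # map (\<lambda>k. (real k / real q, 1)) [1..<q]) s * of_real z powr (- s) =
      of_real (gauss_const q / gauss_const p) * levy_kernel \<alpha> x (of_real 0 + of_real (real q) * s)" for s
  proof -
    have "fox_kernel q 0 ((1, l) # map (\<lambda>k. (real k / real p, l)) [1..<p])
                    ((1, 1) # map (\<lambda>k. (real k / real q, 1)) [1..<q]) s =
       (Gamma (1 + s) * (\<Prod>k=1..<q. Gamma (s + of_nat k / of_nat q))) *
       (rGamma (1 + of_real l * s) * (\<Prod>k=1..<p. rGamma (of_real l * s + of_nat k / of_nat p)))"
      using q by (subst fox_kernel_length)
        (auto simp: prod_list_map_upt o_def add_ac simp del: upt_Suc)
    also have "\<dots> = of_real (gauss_const q) * exp (- (of_nat q * s * of_real (ln (real q)))) * Gamma (1 + of_nat q * s) *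
       (rGamma (1 + of_nat p * (of_real l * s)) * exp (of_nat p * (of_real l * s) * of_real (ln (real p))) / of_real (gauss_const p))"
      unfolding prod_Gamma_gauss[OF q0] prod_rGamma_gauss[OF \<open>0 < p\<close>] ..
    finally have "fox_kernel q 0 ((1, l) # map (\<lambda>k. (real k / real p, l)) [1..<p])
                    ((1, 1) # map (\<lambda>k. (real k / real q, 1)) [1..<q]) s * of_real z powr (- s) =
      of_real (gauss_const q / gauss_const p) * (Gamma (1 + of_nat q * s) * rGamma (1 + of_nat p * (of_real l * s)) *
        (exp (- (of_nat q * s * of_real (ln (real q)))) * exp (of_nat p * (of_real l * s) * of_real (ln (real p))) *
         exp (- s * of_real (ln z))))"
      using \<open>z > 0\<close> by (simp add: of_real_powr_exp)
    also have "exp (- (of_nat q * s * of_real (ln (real q)))) * exp (of_nat p * (of_real l * s) * of_real (ln (real p))) *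
         exp (- s * of_real (ln z)) = exp (of_nat p * (of_real l * s) * of_real (ln x))"
      unfolding lnz exp_add[symmetric] by (simp add: algebra_simps)
    also have "of_nat p * (of_real l * s) = of_real \<alpha> * (of_real 0 + of_real (real q) * s)"
      using q by (simp add: \<alpha>_def)
    finally show ?thesis unfolding levy_kernel_def by simp
  qed
  have "fox_H q 0 ((1, l) # map (\<lambda>k. (real k / real p, l)) [1..<p])
                    ((1, 1) # map (\<lambda>k. (real k / real q, 1)) [1..<q]) c z =
     of_real (gauss_const q / gauss_const p) * (vline_integral (levy_kernel \<alpha> x) (0 + real q * c) / of_real \<bar>real q\<bar>)"
    unfolding fox_H_def kernel vline_integral_cmult by (subst vline_integral_affine) (use q in auto)
  also have "vline_integral (levy_kernel \<alpha> x) (0 + real q * c) = of_real (\<Sum>n. levy_series_term \<alpha> (x powr - \<alpha>) n)"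
    using assms c by (intro vline_integral_levy_kernel) (auto simp: \<alpha>_def)
  finally show ?thesis by simp
qed

text \<open>The missing \<open>Gamma (1 + s)\<close> is inserted together with its reciprocal. The
  former completes the q-fold product, the latter the L-fold one, which collapses to
  \<open>rGamma (1 + L s)\<close>; that is just the factor completing the p-fold product at L s. L =
  1 gives case (ii), L >= 2 case (iii).\<close>

lemma fox_H_levy_nat:
  assumes "0 < p" "p < q" "0 < L" "p * L < q" "0 < x" "z > 0"
    and lnz: "ln z = real p * real L * ln (real p) + real L * ln (real L) - real p * real L * ln x - real q * ln (real q)"
    and sep: "fox_separating (q - 1) 0 as (map (\<lambda>k. (real k / real q, 1)) [1..<q]) c"
    and as: "as = map (\<lambda>k. (real k / real L, 1)) [1..<L] @ map (\<lambda>k. (real k / real p, real L)) [1..<p]"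
  defines "\<alpha> \<equiv> real p * real L / real q"
  shows "fox_H (q - 1) 0 as (map (\<lambda>k. (real k / real q, 1)) [1..<q]) c z =
         of_real (gauss_const q / (gauss_const p * gauss_const L * real q) * (\<Sum>n. levy_series_term \<alpha> (x powr - \<alpha>) n))"
proof -
  have q: "q > 1" and q0: "q > 0" using assms by simp_all
  have c': "- (1 / real q) < c"
  proof -
    have "(1 / real q, 1) \<in> set (take (q - 1) (map (\<lambda>k. (real k / real q, 1::real)) [1..<q]))"
      using q by (force simp: image_iff)
    thus ?thesis using sep unfolding fox_separating_def by fastforce
  qed
  hence c: "real q * c > - 1" using q by (simp add: field_simps)
  \<comment> \<open>Keeps 1 + s off the poles, where the product of \<open>Gamma (1 + s)\<close> and
    \<open>rGamma (1 + s)\<close> would be 0 instead of 1.\<close>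
  have "c > - 1" using c' q by (smt (verit) divide_le_eq_1 of_nat_1 of_nat_less_iff)
  have kernel: "fox_kernel (q - 1) 0 as (map (\<lambda>k. (real k / real q, 1)) [1..<q]) s * of_real z powr (- s) =
      of_real (gauss_const q / (gauss_const p * gauss_const L)) * levy_kernel \<alpha> x (of_real 0 + of_real (real q) * s)"
    if "Re s > - 1" for s
  proof -
    have "1 + s \<notin> \<int>\<^sub>\<le>\<^sub>0" using that by (auto elim!: nonpos_Ints_cases simp: complex_eq_iff)
    hence one: "Gamma (1 + s) * rGamma (1 + s) = 1"
      by (simp add: rGamma_inverse_Gamma Gamma_eq_zero_iff)
    have "fox_kernel (q - 1) 0 as (map (\<lambda>k. (real k / real q, 1)) [1..<q]) s =
       (\<Prod>k=1..<q. Gamma (s + of_nat k / of_nat q)) *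
       ((\<Prod>k=1..<L. rGamma (s + of_nat k / of_nat L)) *
        (\<Prod>k=1..<p. rGamma (of_nat L * s + of_nat k / of_nat p)))"
      using q unfolding as by (subst fox_kernel_length)
        (auto simp: prod_list_map_upt o_def add_ac simp del: upt_Suc)
    also have "\<dots> = (Gamma (1 + s) * (\<Prod>k=1..<q. Gamma (s + of_nat k / of_nat q))) *
       ((rGamma (1 + s) * (\<Prod>k=1..<L. rGamma (s + of_nat k / of_nat L))) *
        (\<Prod>k=1..<p. rGamma (of_nat L * s + of_nat k / of_nat p)))"
      using one by (simp add: mult_ac)
    also have "\<dots> = (Gamma (1 + s) * (\<Prod>k=1..<q. Gamma (s + of_nat k / of_nat q))) *
       (exp (of_nat L * s * of_real (ln (real L))) / of_real (gauss_const L) *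
        (rGamma (1 + of_nat L * s) * (\<Prod>k=1..<p. rGamma (of_nat L * s + of_nat k / of_nat p))))"
      using assms by (subst prod_rGamma_gauss) (auto simp: mult_ac)
    also have "\<dots> = of_real (gauss_const q) * exp (- (of_nat q * s * of_real (ln (real q)))) * Gamma (1 + of_nat q * s) *
       (exp (of_nat L * s * of_real (ln (real L))) / of_real (gauss_const L) *
       (rGamma (1 + of_nat p * (of_nat L * s)) * exp (of_nat p * (of_nat L * s) * of_real (ln (real p))) / of_real (gauss_const p)))"
      unfolding prod_Gamma_gauss[OF q0] prod_rGamma_gauss[OF \<open>0 < p\<close>] ..
    finally have "fox_kernel (q - 1) 0 as (map (\<lambda>k. (real k / real q, 1)) [1..<q]) s * of_real z powr (- s) =
      of_real (gauss_const q / (gauss_const p * gauss_const L)) * (Gamma (1 + of_nat q * s) * rGamma (1 + of_nat p * (of_nat L * s)) *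
        (exp (- (of_nat q * s * of_real (ln (real q)))) * exp (of_nat L * s * of_real (ln (real L))) *
         exp (of_nat p * (of_nat L * s) * of_real (ln (real p))) * exp (- s * of_real (ln z))))"
      using \<open>z > 0\<close> by (simp add: of_real_powr_exp mult_ac)
    also have "exp (- (of_nat q * s * of_real (ln (real q)))) * exp (of_nat L * s * of_real (ln (real L))) *
         exp (of_nat p * (of_nat L * s) * of_real (ln (real p))) * exp (- s * of_real (ln z)) =
         exp (of_nat p * (of_nat L * s) * of_real (ln x))"
      unfolding lnz exp_add[symmetric] by (simp add: algebra_simps)
    also have "of_nat p * (of_nat L * s) = of_real \<alpha> * (of_real 0 + of_real (real q) * s)"
      using q by (simp add: \<alpha>_def)
    finally show ?thesis unfolding levy_kernel_def by simp
  qed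
  have "fox_H (q - 1) 0 as (map (\<lambda>k. (real k / real q, 1)) [1..<q]) c z =
     vline_integral (\<lambda>s. of_real (gauss_const q / (gauss_const p * gauss_const L)) *
        levy_kernel \<alpha> x (of_real 0 + of_real (real q) * s)) c"
    unfolding fox_H_def by (intro vline_integral_cong kernel) (use \<open>c > - 1\<close> in simp)
  also have "\<dots> = of_real (gauss_const q / (gauss_const p * gauss_const L)) *
      (vline_integral (levy_kernel \<alpha> x) (0 + real q * c) / of_real \<bar>real q\<bar>)"
    unfolding vline_integral_cmult by (subst vline_integral_affine) (use q in auto)
  also have "vline_integral (levy_kernel \<alpha> x) (0 + real q * c) = of_real (\<Sum>n. levy_series_term \<alpha> (x powr - \<alpha>) n)"
    using assms c by (intro vline_integral_levy_kernel) (auto simp: \<alpha>_def simp flip: of_nat_mult)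
  finally show ?thesis by simp
qed

subsection \<open>Residues of the Fox kernels\<close>

text \<open>Residue form of Gauss' formula: compare derivatives of both sides at the zero \<open>- m / q\<close>.\<close>
lemma prod_Gamma_gauss_at_pole:
  fixes q i j :: nat
  assumes j: "1 \<le> j" "j \<le> q"
  defines "m \<equiv> q * i + j"
  shows "(-1) ^ i / fact i * (\<Prod>k\<in>{1..q} - {j}. Gamma ((real k - real j) / real q - real i)) =
           gauss_const q * real q ^ (m - 1) * (-1) ^ (m - 1) / fact (m - 1)"
proof -
  have q: "q > 0" using j by simp
  define s0 where "s0 = - real m / real q"
  \<comment> \<open>The single factor k = j, which vanishes at \<open>s0\<close>, is kept out. The
    factor \<open>rGamma (1 + s)\<close> counts as k = q, so that all classes 1, ..., q are treated
    alike.\<close>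
  define R where "R = (\<lambda>s. gauss_const q * exp (- (real q * s * ln (real q))) * (\<Prod>k\<in>{1..q} - {j}. rGamma (s + real k / real q)))"
  have gauss: "rGamma (1 + real q * s) = R s * rGamma (s + real j / real q)" for s
  proof -
    have "rGamma (1 + real q * s) = gauss_const q * exp (- (real q * s * ln (real q))) *
        (rGamma (1 + s) * (\<Prod>k=1..<q. rGamma (s + real k / real q)))"
      using rGamma_multiplication[OF q, of s] by (simp add: gauss_const_def)
    also have "rGamma (1 + s) * (\<Prod>k=1..<q. rGamma (s + real k / real q)) =
        (\<Prod>k\<in>{1..q}. rGamma (s + real k / real q))"
    proof -
      have "{1..q} = insert q {1..<q}" using q by auto
      thus ?thesis using q by (simp add: add.commute)
    qed
    also have "\<dots> = rGamma (s + real j / real q) * (\<Prod>k\<in>{1..q} - {j}. rGamma (s + real k / real q))"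
      using j by (intro prod.remove) auto
    finally show ?thesis by (simp add: R_def)
  qed
  have s0: "s0 + real j / real q = - real i" "1 + real q * s0 = - real (m - 1)"
    using q j by (auto simp: s0_def m_def field_simps of_nat_diff)
  have "((\<lambda>s. rGamma (1 + real q * s)) has_field_derivative ((-1) ^ (m - 1) * fact (m - 1) * real q)) (at s0)"
  proof (rule DERIV_chain2[where f = rGamma])
    show "(rGamma has_field_derivative (-1) ^ (m - 1) * fact (m - 1)) (at (1 + real q * s0))"
      unfolding s0 by (rule has_field_derivative_rGamma_nonpos_int)
  qed (auto intro!: derivative_eq_intros)
  moreover have "((\<lambda>s. R s * rGamma (s + real j / real q)) has_field_derivative (R s0 * ((-1) ^ i * fact i))) (at s0)"
  proof -
    \<comment> \<open>Continuity of \<open>R\<close> suffices: the other factor vanishes at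
      \<open>s0\<close>, so the difference quotient of the product is \<open>R s\<close> times that
      of the other factor.\<close>
    have "isCont R s0" unfolding R_def by (intro continuous_intros)
    hence "R \<midarrow>s0\<rightarrow> R s0" by (simp add: isCont_def)
    moreover have "((\<lambda>s. rGamma (s + real j / real q)) has_field_derivative ((-1) ^ i * fact i * 1)) (at s0)"
    proof (rule DERIV_chain2[where f = rGamma])
      show "(rGamma has_field_derivative (-1) ^ i * fact i) (at (s0 + real j / real q))"
        unfolding s0 by (rule has_field_derivative_rGamma_nonpos_int)
    qed (auto intro!: derivative_eq_intros)
    hence "(\<lambda>s. (rGamma (s + real j / real q) - rGamma (s0 + real j / real q)) / (s - s0)) \<midarrow>s0\<rightarrow> (-1) ^ i * fact i"
      by (simp add: has_field_derivative_iff)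
    ultimately have "(\<lambda>s. R s * ((rGamma (s + real j / real q) - rGamma (s0 + real j / real q)) / (s - s0))) \<midarrow>s0\<rightarrow> R s0 * ((-1) ^ i * fact i)"
      by (rule tendsto_mult)
    thus ?thesis by (simp add: has_field_derivative_iff s0)
  qed
  ultimately have D: "(-1) ^ (m - 1) * fact (m - 1) * real q = R s0 * ((-1) ^ i * fact i)"
    unfolding gauss by (rule DERIV_unique)
  define P where "P = (\<Prod>k\<in>{1..q} - {j}. rGamma ((real k - real j) / real q - real i))"
  define g where "g = gauss_const q * real q ^ (m - 1)"
  have "R s0 = gauss_const q * real q ^ m * P"
  proof -
    have "s0 + real k / real q = (real k - real j) / real q - real i" for k
      using q by (simp add: s0_def m_def field_simps)
    moreover have "exp (- (real q * s0 * ln (real q))) = real q ^ m"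
      using q by (simp add: s0_def exp_of_nat_mult)
    ultimately show ?thesis by (simp add: R_def P_def)
  qed
  moreover have "real q ^ m = real q ^ (m - 1) * real q"
    using j q by (simp add: m_def power_eq_if)
  ultimately have D': "(-1) ^ (m - 1) * fact (m - 1) = g * P * (-1) ^ i * fact i"
    using D q by (simp add: g_def)
  hence P0: "P \<noteq> 0" by auto
  have sq: "(-1) ^ n * (-1) ^ n = (1::real)" for n :: nat by (simp add: power_mult_distrib[symmetric])
  have "(-1) ^ i * fact (m - 1) = ((-1) ^ i :: real) * ((-1) ^ (m - 1) * (-1) ^ (m - 1)) * fact (m - 1)"
    by (simp add: sq)
  also have "\<dots> = (-1) ^ i * (-1) ^ (m - 1) * ((-1) ^ (m - 1) * fact (m - 1))" by (simp only: mult_ac)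
  also have "\<dots> = ((-1) ^ i * (-1) ^ i) * ((-1) ^ (m - 1) * g * P * fact i)" unfolding D' by (simp only: mult_ac)
  finally have "(-1) ^ i * fact (m - 1) = (-1) ^ (m - 1) * g * P * fact i" by (simp add: sq)
  moreover have "(\<Prod>k\<in>{1..q} - {j}. Gamma ((real k - real j) / real q - real i)) = inverse P"
    by (simp add: P_def Gamma_def prod_inversef[unfolded o_def])
  moreover have "a * c = d * g * P * b \<Longrightarrow> b \<noteq> 0 \<Longrightarrow> c \<noteq> 0 \<Longrightarrow> a / b * inverse P = g * d / c" for a b c d :: real
    using P0 by (simp add: field_simps)
  ultimately show ?thesis unfolding g_def[symmetric] by simp
qed

text \<open>The jump skips the singular index. For k > j the argument is (k - j) / q, for k <= j it
  is ((k - 1) - j) / q; so k = 2, ..., q - 1 runs through 1, ..., q - 1 without j.\<close>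

lemma prod_levy_jump:
  assumes "1 \<le> j" "j < q"
  shows "(\<Prod>k=2..<q. f (real k / real q - levy_jump q j k)) = (\<Prod>k\<in>{1..<q} - {j}. f ((real k - real j) / real q))"
proof (rule prod.reindex_bij_witness[of _ "\<lambda>k. if k < j then k + 1 else k" "\<lambda>k. if j < k then k else k - 1"])
  fix k assume k: "k \<in> {2..<q}"
  have "real (if j < k then k else k - 1) - real j = real q * (real k / real q - levy_jump q j k)"
    using assms k by (auto simp: levy_jump_def of_nat_diff field_simps)
  thus "f ((real (if j < k then k else k - 1) - real j) / real q) = f (real k / real q - levy_jump q j k)"
    using assms by simp
qed (use assms in \<open>auto split: if_splits\<close>)

text \<open>Grouping q consecutive terms needs only convergence; separating the groups into q series
  needs every subseries to converge, which absolute convergence supplies.\<close>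

lemma suminf_split_residues:
  fixes a :: "nat \<Rightarrow> real"
  assumes "summable (\<lambda>n. \<bar>a n\<bar>)" "q > 0"
  shows "summable (\<lambda>i. a (q * i + j))"
    and "suminf a = (\<Sum>j<q. \<Sum>i. a (q * i + j))"
proof -
  have summ: "summable (\<lambda>i. a (q * i + j))" for j
  proof (rule summable_rabs_cancel)
    have "inj (\<lambda>i. q * i + j)" using assms(2) by (auto simp: inj_on_def)
    from summable_reindex[OF assms(1) this] show "summable (\<lambda>i. \<bar>a (q * i + j)\<bar>)"
      by (simp add: o_def)
  qed
  show "summable (\<lambda>i. a (q * i + j))" by (rule summ)
  have "(\<lambda>n. sum a {n * q..<n * q + q}) sums suminf a"
    by (rule sums_group[OF summable_sums[OF summable_rabs_cancel[OF assms(1)]] assms(2)])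
  moreover have "sum a {n * q..<n * q + q} = (\<Sum>j<q. a (q * n + j))" for n
    by (rule sum.reindex_bij_witness[of _ "\<lambda>j. q * n + j" "\<lambda>j. j - q * n"]) (auto simp: mult.commute)
  ultimately have "(\<lambda>n. \<Sum>j<q. a (q * n + j)) sums suminf a" by simp
  hence "suminf a = (\<Sum>n. \<Sum>j<q. a (q * n + j))" by (simp add: sums_iff)
  also have "\<dots> = (\<Sum>j<q. \<Sum>i. a (q * i + j))" by (intro suminf_sum summ)
  finally show "suminf a = \<dots>" .
qed

text \<open>Evaluates a Wright or hypergeometric series whose summability has not been shown: for K
  nonzero it is inherited from \<open>t\<close>, and for K = 0 both sides vanish.\<close>

lemma mult_suminf_eq:
  fixes K :: real
  assumes "\<And>i. K * w i = t i" "summable t"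
  shows "K * suminf w = suminf t"
proof (cases "K = 0")
  case True
  hence "t = (\<lambda>_. 0)" using assms(1) by (auto simp: fun_eq_iff)
  thus ?thesis using True by simp
next
  case False
  have t: "t = (\<lambda>i. K * w i)" using assms(1) by auto
  hence "summable w" using assms(2) False by (simp add: summable_cmult_iff)
  thus ?thesis unfolding t by (rule suminf_mult[symmetric])
qed

text \<open>\<open>w\<close> = -m / q with m = q i + j is a pole of the q-fold Gamma product. The
  residue form of Gauss' formula treats that product, the ordinary form the p-fold one, and exp (- w
  \<zeta>) cancels the remaining powers of p and q. j = q is included and gives the class m = 0
  modulo q.\<close>

lemma residue_term_levy:
  fixes p q j i :: nat
  assumes "0 < p" "1 \<le> j" "j \<le> q" "0 < x"
    and lnz: "\<zeta> = real p * l * ln (real p) - real p * l * ln x - real q * ln (real q)"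
  defines "\<alpha> \<equiv> real p * l / real q"
  defines "w \<equiv> - (real j / real q + real i)"
  shows "(\<Prod>k\<in>{1..q} - {j}. Gamma ((real k - real j) / real q - real i)) *
         (rGamma (1 + l * w) * (\<Prod>k=1..<p. rGamma (l * w + real k / real p))) / fact i * (-1) ^ i * exp (- w * \<zeta>) =
         gauss_const q / (gauss_const p * real q) * levy_series_term \<alpha> (x powr - \<alpha>) (q * i + (j - 1))"
proof -
  define m where "m = q * i + j"
  have q: "q > 0" using assms by simp
  have m: "q * i + (j - 1) = m - 1" "Suc (m - 1) = m" using assms by (auto simp: m_def)
  have w: "w = - real m / real q" using q by (simp add: w_def m_def field_simps)
  have plw: "real p * (l * w) = - (\<alpha> * real m)" by (simp add: w \<alpha>_def)
  have "exp (- w * \<zeta>) = exp (\<alpha> * real m * ln (real p)) * exp (- (\<alpha> * real m) * ln x) * exp (- (real m * ln (real q)))"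
    unfolding exp_add[symmetric] lnz using q by (simp add: w \<alpha>_def field_simps)
  also have "exp (- (real m * ln (real q))) = inverse (real q ^ m)"
    using q by (simp add: exp_minus exp_of_nat_mult)
  also have "exp (- (\<alpha> * real m) * ln x) = (x powr - \<alpha>) ^ m"
    using assms by (simp add: powr_def exp_of_nat_mult[symmetric] mult_ac)
  finally have ex: "exp (- w * \<zeta>) = exp (\<alpha> * real m * ln (real p)) * (x powr - \<alpha>) ^ m * inverse (real q ^ m)" .
  have rg: "rGamma (1 + l * w) * (\<Prod>k=1..<p. rGamma (l * w + real k / real p)) =
      rGamma (1 - \<alpha> * real m) * exp (- (\<alpha> * real m * ln (real p))) / gauss_const p"
    using prod_rGamma_gauss[OF \<open>0 < p\<close>, of "l * w"] by (simp add: plw)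
  have gq: "(-1) ^ i / fact i * (\<Prod>k\<in>{1..q} - {j}. Gamma ((real k - real j) / real q - real i)) =
      gauss_const q * real q ^ (m - 1) * (-1) ^ (m - 1) / fact (m - 1)"
    unfolding m_def by (rule prod_Gamma_gauss_at_pole) (use assms in auto)
  have qm: "real q ^ m = real q ^ (m - 1) * real q" using m(2) by (metis power_Suc2)
  have "(\<Prod>k\<in>{1..q} - {j}. Gamma ((real k - real j) / real q - real i)) *
         (rGamma (1 + l * w) * (\<Prod>k=1..<p. rGamma (l * w + real k / real p))) / fact i * (-1) ^ i * exp (- w * \<zeta>) =
       ((-1) ^ i / fact i * (\<Prod>k\<in>{1..q} - {j}. Gamma ((real k - real j) / real q - real i))) *
       (rGamma (1 + l * w) * (\<Prod>k=1..<p. rGamma (l * w + real k / real p))) * exp (- w * \<zeta>)"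
    by simp
  also have "\<dots> = gauss_const q / (gauss_const p * real q) * ((-1) ^ (m - 1) / fact (m - 1) * rGamma (1 - \<alpha> * real m) * (x powr - \<alpha>) ^ m) *
      (exp (\<alpha> * real m * ln (real p)) * exp (- (\<alpha> * real m * ln (real p))))"
  proof -
    have "(G * Q * s / f) * (r * e1 / P) * (E * Y * inverse (Q * q')) = G / (P * q') * (s / f * r * Y) * (E * e1)"
      if "Q \<noteq> 0" for G Q s f r e1 P E Y q' :: real
      using that by (simp add: field_simps)
    thus ?thesis unfolding gq rg ex qm using q by simp
  qed
  also have "exp (\<alpha> * real m * ln (real p)) * exp (- (\<alpha> * real m * ln (real p))) = 1"
    by (simp add: exp_minus)
  finally show ?thesis unfolding levy_series_term_def m by simp
qed

text \<open>Reduces to \<open>residue_term_levy\<close> by restoring the factor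
  \<open>Gamma (1 + w)\<close>, which is the index k = q, together with its reciprocal. This
  requires 1 + w not to be an integer, that is, q not dividing j; hence j < q.\<close>

lemma residue_term_levy_nat:
  fixes p q j i L :: nat
  assumes "0 < p" "1 \<le> j" "j < q" "0 < x" "0 < L"
    and lnz: "\<zeta> = real p * real L * ln (real p) + real L * ln (real L) - real p * real L * ln x - real q * ln (real q)"
  defines "\<alpha> \<equiv> real p * real L / real q"
  defines "w \<equiv> - (real j / real q + real i)"
  shows "(\<Prod>k\<in>{1..<q} - {j}. Gamma ((real k - real j) / real q - real i)) *
         ((\<Prod>k=1..<L. rGamma (w + real k / real L)) * (\<Prod>k=1..<p. rGamma (real L * w + real k / real p))) /
           fact i * (-1) ^ i * exp (- w * \<zeta>) =
         gauss_const q / (gauss_const p * gauss_const L * real q) * levy_series_term \<alpha> (x powr - \<alpha>) (q * i + (j - 1))"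
proof -
  define \<zeta>' where "\<zeta>' = real p * real L * ln (real p) - real p * real L * ln x - real q * ln (real q)"
  let ?P = "\<Prod>k\<in>{1..<q} - {j}. Gamma ((real k - real j) / real q - real i)"
  let ?A = "\<Prod>k=1..<L. rGamma (w + real k / real L)" and ?B = "\<Prod>k=1..<p. rGamma (real L * w + real k / real p)"
  have "1 + w \<notin> \<int>"
  proof
    assume "1 + w \<in> \<int>"
    then obtain n where "1 + w = of_int n" by (rule Ints_cases)
    hence "real_of_int (int j) = real_of_int ((1 - n - int i) * int q)"
      using assms by (simp add: w_def field_simps)
    hence "int q dvd int j" by (simp only: of_int_eq_iff) simp
    thus False using assms by (auto dest: dvd_imp_le)
  qed
  hence one: "Gamma (1 + w) * rGamma (1 + w) = 1"
    using nonpos_Ints_subset_Ints unfolding rGamma_inverse_Gamma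
    by (intro right_inverse) (auto simp: Gamma_eq_zero_iff simp del: Ints_add)
  have set: "{1..q} - {j} = insert q ({1..<q} - {j})" using assms by auto
  have "(real q - real j) / real q - real i = 1 + w" using assms by (simp add: w_def field_simps)
  hence P: "(\<Prod>k\<in>{1..q} - {j}. Gamma ((real k - real j) / real q - real i)) = Gamma (1 + w) * ?P"
    unfolding set by (subst prod.insert) auto
  have gL: "gauss_const L > 0" using assms by (intro gauss_const_pos) auto
  have "rGamma (1 + w) * ?A = rGamma (1 + real L * w) * exp (real L * w * ln (real L)) / gauss_const L"
    using prod_rGamma_gauss[OF \<open>0 < L\<close>, of w] by simp
  hence "rGamma (1 + real L * w) = rGamma (1 + w) * ?A * gauss_const L * exp (- (real L * w * ln (real L)))"
    using gL by (simp add: exp_minus)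
  hence A: "Gamma (1 + w) * rGamma (1 + real L * w) = ?A * gauss_const L * exp (- (real L * w * ln (real L)))"
    using one by simp
  have ex: "exp (- w * \<zeta>) = exp (- (real L * w * ln (real L))) * exp (- w * \<zeta>')"
    unfolding exp_add[symmetric] lnz \<zeta>'_def by (simp add: algebra_simps)
  have "?P * (?A * ?B) / fact i * (-1) ^ i * exp (- w * \<zeta>) * gauss_const L =
        ?P * ((?A * gauss_const L * exp (- (real L * w * ln (real L)))) * ?B) / fact i * (-1) ^ i * exp (- w * \<zeta>')"
    unfolding ex by simp
  also have "\<dots> = (Gamma (1 + w) * ?P) * (rGamma (1 + real L * w) * ?B) / fact i * (-1) ^ i * exp (- w * \<zeta>')"
    unfolding A[symmetric] by simp
  also have "\<dots> = gauss_const q / (gauss_const p * real q) * levy_series_term \<alpha> (x powr - \<alpha>) (q * i + (j - 1))"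
    unfolding P[symmetric] unfolding w_def \<alpha>_def by (rule residue_term_levy) (use assms in \<open>auto simp: \<zeta>'_def\<close>)
  finally have eq: "?P * (?A * ?B) / fact i * (-1) ^ i * exp (- w * \<zeta>) * gauss_const L = \<dots>" .
  have "a * g = b / (c * d) * t \<Longrightarrow> g > 0 \<Longrightarrow> a = b / (c * g * d) * t" for a b c d g t :: real
    by (metis divide_divide_eq_left mult.assoc mult.commute nonzero_eq_divide_eq order_less_irrefl times_divide_eq_left)
  from this[OF eq gL] show ?thesis .
qed

subsection \<open>Wright and hypergeometric form\<close>

text \<open>The prefactor of the theorem is exactly what turns the Gauss constants of the H-function
  into the factor \<alpha> / x of the density.\<close>

lemma gauss_const_ratio:
  assumes "0 < p" "0 < q" "0 < x"
  shows "l * sqrt (real p * real q) / (x * (2 * pi) powr ((real q - real p) / 2)) *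
           (gauss_const q / (gauss_const p * real q)) = real p * l / real q / x"
proof -
  have e: "(2 * pi) powr ((real q - 1) / 2) =
      (2 * pi) powr ((real q - real p) / 2) * (2 * pi) powr ((real p - 1) / 2)"
    unfolding powr_add[symmetric] by (simp add: diff_divide_distrib add_divide_distrib)
  have "l * (a * b) / (x * U) * ((U * V / b) / ((V / a) * (b * b))) = (a * a) * l / (b * b) / x"
    if "a > 0" "b > 0" "U > 0" "V > 0" for a b U V :: real
    using that by (simp add: field_simps)
  from this[of "sqrt (real p)" "sqrt (real q)" "(2 * pi) powr ((real q - real p) / 2)" "(2 * pi) powr ((real p - 1) / 2)"]
  show ?thesis unfolding gauss_const_def e using assms by (simp add: real_sqrt_mult)
qed

lemma gauss_const_ratio_nat:
  assumes "0 < p" "0 < q" "0 < x" "0 < L"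
  shows "sqrt (real p * real q * real L) / (x * (2 * pi) powr ((real q + 1 - real p - real L) / 2)) *
           (gauss_const q / (gauss_const p * gauss_const L * real q)) = real p * real L / real q / x"
proof -
  have e: "(2 * pi) powr ((real q - 1) / 2) =
      (2 * pi) powr ((real q + 1 - real p - real L) / 2) *
      ((2 * pi) powr ((real p - 1) / 2) * (2 * pi) powr ((real L - 1) / 2))"
    unfolding powr_add[symmetric] by (simp add: diff_divide_distrib add_divide_distrib)
  have "a * b * d / (x * U) * ((U * (V * W) / b) / ((V / a) * (W / d) * (b * b))) = (a * a) * (d * d) / (b * b) / x"
    if "a > 0" "b > 0" "d > 0" "U > 0" "V > 0" "W > 0" for a b d U V W :: real
    using that by (simp add: field_simps)
  from this[of "sqrt (real p)" "sqrt (real q)" "sqrt (real L)"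
     "(2 * pi) powr ((real q + 1 - real p - real L) / 2)" "(2 * pi) powr ((real p - 1) / 2)" "(2 * pi) powr ((real L - 1) / 2)"]
  show ?thesis unfolding gauss_const_def e using assms by (simp add: real_sqrt_mult)
qed

text \<open>With a = j / q this collects z^(j / q) (-z)^i into (-1)^i z^(-w) at the pole w = -(j / q
  + i).\<close>

lemma exp_ln_power_split:
  fixes z :: real
  assumes "z > 0"
  shows "exp (a * ln z) * (b * (- z) ^ i) = b * (-1) ^ i * exp (- (- (a + real i)) * ln z)"
proof -
  have "(- z) ^ i = (-1) ^ i * exp (real i * ln z)"
    using assms by (subst power_minus) (simp add: exp_of_nat_mult)
  thus ?thesis by (simp add: ring_distribs exp_add)
qed

lemma rGamma_minus_nat:
  "rGamma (b - real n) = rGamma b * (-1) ^ n * pochhammer (1 - b) n" for b :: real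
  using pochhammer_rGamma[of "b - real n" n] pochhammer_minus[of "real n - b" n] by (simp add: mult_ac)

context
  fixes p q :: nat and x :: real
  assumes p: "0 < p" and pq: "p < q" and x: "0 < x"
begin

lemma summable_residue_class:
  assumes "0 < \<alpha>" "\<alpha> < 1"
  shows "summable (\<lambda>i. levy_series_term \<alpha> (x powr - \<alpha>) (q * i + j))"
  using assms pq x by (intro suminf_split_residues summable_levy_series_term) auto

lemma suminf_levy_series_split:
  assumes "0 < \<alpha>" "\<alpha> < 1"
  shows "suminf (levy_series_term \<alpha> (x powr - \<alpha>)) =
     (\<Sum>i. levy_series_term \<alpha> (x powr - \<alpha>) (q * i + (q - 1))) +
     (\<Sum>j=1..q-1. \<Sum>i. levy_series_term \<alpha> (x powr - \<alpha>) (q * i + (j - 1)))"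
proof -
  have "suminf (levy_series_term \<alpha> (x powr - \<alpha>)) =
      (\<Sum>j<q. \<Sum>i. levy_series_term \<alpha> (x powr - \<alpha>) (q * i + j))"
    using assms pq x by (intro suminf_split_residues summable_levy_series_term) auto
  also have "\<dots> = (\<Sum>j=1..q. \<Sum>i. levy_series_term \<alpha> (x powr - \<alpha>) (q * i + (j - 1)))"
    by (rule sum.reindex_bij_witness[of _ "\<lambda>j. j - 1" Suc]) auto
  also have "{1..q} = insert q {1..q-1}" using pq by auto
  also have "(\<Sum>j\<in>insert q {1..q-1}. \<Sum>i. levy_series_term \<alpha> (x powr - \<alpha>) (q * i + (j - 1))) =
     (\<Sum>i. levy_series_term \<alpha> (x powr - \<alpha>) (q * i + (q - 1))) +
     (\<Sum>j=1..q-1. \<Sum>i. levy_series_term \<alpha> (x powr - \<alpha>) (q * i + (j - 1)))"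
    using pq by (subst sum.insert) auto
  finally show ?thesis .
qed

text \<open>Each Wright term is a residue at -(j / q + i). The leading parameter 1 -
  \<open>levy_jump q j q\<close> equals (q - j) / q and supplies the index k = q; the others come
  from \<open>prod_levy_jump\<close>.\<close>

lemma wright_psi_levy:
  assumes l: "0 < l" "real p * l < real q" and z: "z > 0"
    and lnz: "ln z = real p * l * ln (real p) - real p * l * ln x - real q * ln (real q)"
    and j: "1 \<le> j" "j < q"
  defines "\<alpha> \<equiv> real p * l / real q"
  shows "exp (real j / real q * ln z) *
     wright_psi ((1 - levy_jump q j q, -1) # map (\<lambda>k. (real k / real q - levy_jump q j k, -1)) [2..<q])
                (((real p * real q - real j * real p * l) / (real p * real q), - l) #
                  map (\<lambda>k. ((real k * real q - real j * real p * l) / (real p * real q), - l)) [1..<p]) (- z) =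
     gauss_const q / (gauss_const p * real q) * (\<Sum>i. levy_series_term \<alpha> (x powr - \<alpha>) (q * i + (j - 1)))"
proof -
  have \<alpha>: "0 < \<alpha>" "\<alpha> < 1" using l p pq by (auto simp: \<alpha>_def)
  have set: "{1..q} - {j} = insert q ({1..<q} - {j})" using j by auto
  show ?thesis
    unfolding wright_psi_def suminf_mult[OF summable_residue_class[OF \<alpha>], symmetric]
  proof (rule mult_suminf_eq)
    fix i :: nat
    define w where "w = - (real j / real q + real i)"
    let ?P = "\<Prod>k\<in>{1..q} - {j}. Gamma ((real k - real j) / real q - real i)"
    let ?B = "rGamma (1 + l * w) * (\<Prod>k=1..<p. rGamma (l * w + real k / real p))"
    have A: "prod_list (map (\<lambda>(a, A). Gamma (a + A * real i))
        ((1 - levy_jump q j q, -1) # map (\<lambda>k. (real k / real q - levy_jump q j k, -1)) [2..<q])) = ?P"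
    proof -
      have "1 - levy_jump q j q = (real q - real j) / real q" using j by (simp add: levy_jump_def field_simps)
      moreover have "(\<Prod>k=2..<q. Gamma (real k / real q - levy_jump q j k - real i)) =
          (\<Prod>k\<in>{1..<q} - {j}. Gamma ((real k - real j) / real q - real i))"
        by (rule prod_levy_jump[where f = "\<lambda>v. Gamma (v - real i)"]) (use j in auto)
      ultimately show ?thesis unfolding set
        by (subst prod.insert) (auto simp: prod_list_map_upt o_def)
    qed
    have B: "prod_list (map (\<lambda>(b, B). rGamma (b + B * real i))
        (((real p * real q - real j * real p * l) / (real p * real q), - l) #
          map (\<lambda>k. ((real k * real q - real j * real p * l) / (real p * real q), - l)) [1..<p])) = ?B"
    proof -
      have "(real p * real q - real j * real p * l) / (real p * real q) + - l * real i = 1 + l * w"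
        using p pq by (simp add: w_def field_simps)
      moreover have "(real k * real q - real j * real p * l) / (real p * real q) + - l * real i = l * w + real k / real p" for k
        using p pq by (simp add: w_def field_simps)
      ultimately show ?thesis
        by (simp only: list.map prod_list.Cons map_map o_def prod.case prod_list_map_upt)
    qed
    have "exp (real j / real q * ln z) * (?P * ?B / fact i * (- z) ^ i) =
        ?P * ?B / fact i * (-1) ^ i * exp (- w * ln z)"
      unfolding w_def by (rule exp_ln_power_split[OF z])
    also have "\<dots> = gauss_const q / (gauss_const p * real q) * levy_series_term \<alpha> (x powr - \<alpha>) (q * i + (j - 1))"
      unfolding w_def \<alpha>_def by (rule residue_term_levy) (use p j x lnz in auto)
    finally show "exp (real j / real q * ln z) *
         (prod_list (map (\<lambda>(a, A). Gamma (a + A * real i))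
        ((1 - levy_jump q j q, -1) # map (\<lambda>k. (real k / real q - levy_jump q j k, -1)) [2..<q])) *
          prod_list (map (\<lambda>(b, B). rGamma (b + B * real i))
        (((real p * real q - real j * real p * l) / (real p * real q), - l) #
          map (\<lambda>k. ((real k * real q - real j * real p * l) / (real p * real q), - l)) [1..<p])) / fact i * (- z) ^ i) =
        gauss_const q / (gauss_const p * real q) * levy_series_term \<alpha> (x powr - \<alpha>) (q * i + (j - 1))"
      unfolding A B .
  qed (intro summable_mult summable_residue_class \<alpha>)
qed

text \<open>The class j = q: the omitted index is k = q itself, so no jump occurs, and the prefactor
  z^(j / q) is simply z.\<close>

lemma wright_psi_levy_last:
  assumes l: "0 < l" "real p * l < real q" and z: "z > 0"
    and lnz: "ln z = real p * l * ln (real p) - real p * l * ln x - real q * ln (real q)"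
  defines "\<alpha> \<equiv> real p * l / real q"
  shows "z * wright_psi (map (\<lambda>i. (- (real q - real i) / real q, -1)) [1..<q])
             ((1 - l, - l) # map (\<lambda>k. ((real k * real q - real p * l * real q) / (real p * real q), - l)) [1..<p]) (- z) =
     gauss_const q / (gauss_const p * real q) * (\<Sum>i. levy_series_term \<alpha> (x powr - \<alpha>) (q * i + (q - 1)))"
proof -
  have \<alpha>: "0 < \<alpha>" "\<alpha> < 1" using l p pq by (auto simp: \<alpha>_def)
  have set: "{1..q} - {q} = {1..<q}" by auto
  show ?thesis
    unfolding wright_psi_def suminf_mult[OF summable_residue_class[OF \<alpha>], symmetric]
  proof (rule mult_suminf_eq)
    fix i :: nat
    define w where "w = - (real q / real q + real i)"
    let ?P = "\<Prod>k\<in>{1..q} - {q}. Gamma ((real k - real q) / real q - real i)"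
    let ?B = "rGamma (1 + l * w) * (\<Prod>k=1..<p. rGamma (l * w + real k / real p))"
    have A: "prod_list (map (\<lambda>(a, A). Gamma (a + A * real i))
        (map (\<lambda>i. (- (real q - real i) / real q, -1)) [1..<q])) = ?P"
      unfolding set by (simp add: prod_list_map_upt o_def)
    have B: "prod_list (map (\<lambda>(b, B). rGamma (b + B * real i))
        ((1 - l, - l) # map (\<lambda>k. ((real k * real q - real p * l * real q) / (real p * real q), - l)) [1..<p])) = ?B"
    proof -
      have "1 - l + - l * real i = 1 + l * w"
        using pq by (simp add: w_def field_simps)
      moreover have "(real k * real q - real p * l * real q) / (real p * real q) + - l * real i = l * w + real k / real p" for k
        using p pq by (simp add: w_def field_simps)
      ultimately show ?thesis
        by (simp only: list.map prod_list.Cons map_map o_def prod.case prod_list_map_upt)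
    qed
    have "z = exp (real q / real q * ln z)" using z pq by simp
    hence "z * (?P * ?B / fact i * (- z) ^ i) = exp (real q / real q * ln z) * (?P * ?B / fact i * (- z) ^ i)"
      by simp
    also have "\<dots> = ?P * ?B / fact i * (-1) ^ i * exp (- w * ln z)"
      unfolding w_def by (rule exp_ln_power_split[OF z])
    also have "\<dots> = gauss_const q / (gauss_const p * real q) * levy_series_term \<alpha> (x powr - \<alpha>) (q * i + (q - 1))"
      unfolding w_def \<alpha>_def by (rule residue_term_levy) (use p pq x lnz in auto)
    finally show "z * (prod_list (map (\<lambda>(a, A). Gamma (a + A * real i))
        (map (\<lambda>i. (- (real q - real i) / real q, -1)) [1..<q])) *
          prod_list (map (\<lambda>(b, B). rGamma (b + B * real i))
        ((1 - l, - l) # map (\<lambda>k. ((real k * real q - real p * l * real q) / (real p * real q), - l)) [1..<p])) / fact i * (- z) ^ i) =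
        gauss_const q / (gauss_const p * real q) * levy_series_term \<alpha> (x powr - \<alpha>) (q * i + (q - 1))"
      unfolding A B .
  qed (intro summable_mult summable_residue_class \<alpha>)
qed

text \<open>Stated for single terms because it serves both the Wright functions of case (iii) and,
  with L = 1, the hypergeometric series of case (ii).\<close>

lemma wright_term_levy_nat:
  fixes L i j :: nat
  assumes L: "0 < L" and z: "z > 0"
    and lnz: "ln z = real p * real L * ln (real p) + real L * ln (real L) - real p * real L * ln x - real q * ln (real q)"
    and j: "1 \<le> j" "j < q"
  defines "\<alpha> \<equiv> real p * real L / real q"
  shows "exp (real j / real q * ln z) *
     ((\<Prod>k=2..<q. Gamma (real k / real q - levy_jump q j k - real i)) *
      ((\<Prod>k=1..<L. rGamma ((real k * real q - real j * real L) / (real L * real q) - real i)) *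
       (\<Prod>k=1..<p. rGamma ((real k * real q - real j * real p * real L) / (real p * real q) - real L * real i))) /
      fact i * (- z) ^ i) =
     gauss_const q / (gauss_const p * gauss_const L * real q) * levy_series_term \<alpha> (x powr - \<alpha>) (q * i + (j - 1))"
proof -
  define w where "w = - (real j / real q + real i)"
  have A: "(\<Prod>k=2..<q. Gamma (real k / real q - levy_jump q j k - real i)) =
      (\<Prod>k\<in>{1..<q} - {j}. Gamma ((real k - real j) / real q - real i))"
    by (rule prod_levy_jump[where f = "\<lambda>v. Gamma (v - real i)"]) (use j in auto)
  have B: "(real k * real q - real j * real L) / (real L * real q) - real i = w + real k / real L" for k
    using L pq by (simp add: w_def field_simps)
  have C: "(real k * real q - real j * real p * real L) / (real p * real q) - real L * real i = real L * w + real k / real p" for k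
    using p pq by (simp add: w_def field_simps)
  show ?thesis unfolding A B C exp_ln_power_split[OF z]
    unfolding w_def \<alpha>_def by (rule residue_term_levy_nat) (use p j x L lnz in auto)
qed

lemma suminf_levy_series_split_nat:
  fixes L :: nat
  assumes L: "0 < L" "p * L < q"
  defines "\<alpha> \<equiv> real p * real L / real q"
  shows "suminf (levy_series_term \<alpha> (x powr - \<alpha>)) =
     (\<Sum>j=1..q-1. \<Sum>i. levy_series_term \<alpha> (x powr - \<alpha>) (q * i + (j - 1)))"
proof -
  have \<alpha>: "0 < \<alpha>" "\<alpha> < 1" using L p pq by (auto simp: \<alpha>_def simp flip: of_nat_mult)
  have "levy_series_term \<alpha> (x powr - \<alpha>) (q * i + (q - 1)) = 0" for i
  proof -
    have "Suc (q * i + (q - 1)) = q * Suc i" using pq by simp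
    hence "1 - \<alpha> * real (Suc (q * i + (q - 1))) = - real (p * L * Suc i - 1)"
      using p pq L by (simp add: \<alpha>_def of_nat_diff del: of_nat_Suc mult_Suc_right)
    thus ?thesis unfolding levy_series_term_def by (simp only: rGamma_neg_of_nat)
  qed
  thus ?thesis using suminf_levy_series_split[OF \<alpha>] by simp
qed

lemma wright_psi_levy_nat:
  fixes L :: nat
  assumes L: "0 < L" "p * L < q" and z: "z > 0"
    and lnz: "ln z = real p * real L * ln (real p) + real L * ln (real L) - real p * real L * ln x - real q * ln (real q)"
    and j: "1 \<le> j" "j < q"
  defines "\<alpha> \<equiv> real p * real L / real q"
  shows "exp (real j / real q * ln z) *
     wright_psi (map (\<lambda>k. (real k / real q - levy_jump q j k, -1)) [2..<q])
                (map (\<lambda>k. ((real k * real q - real j * real L) / (real L * real q), -1)) [1..<L] @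
                 map (\<lambda>k. ((real k * real q - real j * real p * real L) / (real p * real q), - real L)) [1..<p]) (- z) =
     gauss_const q / (gauss_const p * gauss_const L * real q) * (\<Sum>i. levy_series_term \<alpha> (x powr - \<alpha>) (q * i + (j - 1)))"
proof -
  have \<alpha>: "0 < \<alpha>" "\<alpha> < 1" using L p pq by (auto simp: \<alpha>_def simp flip: of_nat_mult)
  show ?thesis
    unfolding wright_psi_def suminf_mult[OF summable_residue_class[OF \<alpha>], symmetric]
  proof (rule mult_suminf_eq, goal_cases)
    case (1 i)
    show ?case using wright_term_levy_nat[OF L(1) z lnz j, of i]
      by (simp add: prod_list_map_upt o_def \<alpha>_def)
  qed (intro summable_mult summable_residue_class \<alpha>)
qed

text \<open>The terms for L = 1, with each Gamma value at b - n rewritten as its value at b and a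
  Pochhammer symbol in 1 - b. The values at b leave the series as the Gamma quotient in
  front.\<close>

lemma hyperF_levy:
  assumes z: "z > 0"
    and lnz: "ln z = real p * ln (real p) - real p * ln x - real q * ln (real q)"
    and j: "1 \<le> j" "j < q"
  defines "\<alpha> \<equiv> real p / real q"
  shows "exp (real j / real q * ln z) *
     ((\<Prod>i1 = 2..q - 1. Gamma (real i1 / real q - levy_jump q j i1)) *
      (\<Prod>i2 = 1..p - 1. rGamma ((real i2 * real q - real j * real p) / (real p * real q)))) *
     hyperF (map (\<lambda>i. 1 - (real i * real q - real j * real p) / (real p * real q)) [1..<p])
            (map (\<lambda>i. 1 - real i / real q + levy_jump q j i) [2..<q]) ((-1) ^ (q - p) * z) =
     gauss_const q / (gauss_const p * real q) * (\<Sum>i. levy_series_term \<alpha> (x powr - \<alpha>) (q * i + (j - 1)))"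
proof -
  have \<alpha>: "0 < \<alpha>" "\<alpha> < 1" using p pq by (auto simp: \<alpha>_def)
  have ivl: "{2..q - 1} = {2..<q}" "{1..p - 1} = {1..<p}" using p pq by auto
  let ?a = "\<lambda>k. real k / real q - levy_jump q j k"
  let ?b = "\<lambda>k. (real k * real q - real j * real p) / (real p * real q)"
  have g1: "gauss_const (Suc 0) = 1" by (simp add: gauss_const_def)
  show ?thesis
    unfolding hyperF_def suminf_mult[OF summable_residue_class[OF \<alpha>], symmetric]
  proof (rule mult_suminf_eq, goal_cases)
    case (1 n)
    have G: "(\<Prod>k=2..<q. Gamma (?a k - real n)) =
        (\<Prod>k=2..<q. Gamma (?a k)) * ((-1) ^ n) ^ (q - 2) /
        (\<Prod>k=2..<q. pochhammer (1 - real k / real q + levy_jump q j k) n)"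
    proof -
      have "Gamma (b - real n) = Gamma b * (-1) ^ n / pochhammer (1 - b) n" for b :: real
        unfolding Gamma_def rGamma_minus_nat by (cases "even n") (auto simp: divide_inverse)
      moreover have "1 - ?a k = 1 - real k / real q + levy_jump q j k" for k by simp
      ultimately show ?thesis by (simp only: prod_dividef prod.distrib prod_constant) simp
    qed
    have R: "(\<Prod>k=1..<p. rGamma (?b k - real n)) =
        (\<Prod>k=1..<p. rGamma (?b k)) * ((-1) ^ n) ^ (p - 1) * (\<Prod>k=1..<p. pochhammer (1 - ?b k) n)"
      by (simp add: rGamma_minus_nat prod.distrib)
    have sgn: "((-1) ^ n) ^ (q - 2) * ((-1) ^ n) ^ (p - 1) * (-1) ^ n = (((-1) ^ (q - p)) ^ n :: real)"
    proof -
      have "((-1) ^ n) ^ (q - 2) * ((-1) ^ n) ^ (p - 1) * (-1) ^ n = ((-1 :: real) ^ n) ^ (q - 2 + (p - 1) + 1)"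
        by (simp add: power_add)
      \<comment> \<open>The q - 2 upper and p - 1 lower Gamma factors and the power of -z each
        contribute (-1)^n; modulo 2 their number is q - p, the sign exponent in the hypergeometric
        argument.\<close>
      also have "q - 2 + (p - 1) + 1 = (q - p) + 2 * (p - 1)" using p pq by simp
      also have "((-1 :: real) ^ n) ^ ((q - p) + 2 * (p - 1)) = ((-1) ^ n) ^ (q - p)"
        by (cases "even n") (simp_all add: power_add power_mult)
      also have "\<dots> = ((-1) ^ (q - p)) ^ n" by (simp only: power_mult[symmetric] mult.commute)
      finally show ?thesis .
    qed
    have "exp (real j / real q * ln z) * ((\<Prod>k=2..<q. Gamma (?a k - real n)) *
        (\<Prod>k=1..<p. rGamma (?b k - real n)) / fact n * (- z) ^ n) =
       gauss_const q / (gauss_const p * real q) * levy_series_term \<alpha> (x powr - \<alpha>) (q * n + (j - 1))"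
      using wright_term_levy_nat[of 1 z j n] z lnz j by (simp add: g1 \<alpha>_def)
    moreover have "(- z) ^ n = (-1) ^ n * z ^ n" by (rule power_minus)
    moreover have "((-1) ^ (q - p) * z) ^ n = ((-1) ^ n) ^ (q - 2) * ((-1) ^ n) ^ (p - 1) * (-1) ^ n * z ^ n"
      unfolding sgn by (rule power_mult_distrib)
    ultimately show ?case
      unfolding ivl G R by (simp add: prod_list_map_upt o_def mult_ac)
  qed (intro summable_mult summable_residue_class \<alpha>)
qed

end

section \<open>Assembly of the three cases\<close>

lemma levy_arg_root:
  fixes p q j :: nat
  assumes "0 < p" "0 < q" "0 < x" "z > 0"
    and lnz: "ln z = real p * l * ln (real p) - real p * l * ln x - real q * ln (real q)"
  shows "real p powr (real j * l * real p / real q) / (x powr (real j * l * real p / real q) * real q ^ j) =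
           exp (real j / real q * ln z)"
proof -
  have "exp (real j / real q * ln z) = exp (real j * l * real p / real q * ln (real p)) /
      (exp (real j * l * real p / real q * ln x) * exp (real j * ln (real q)))"
    unfolding lnz exp_add[symmetric] exp_diff[symmetric] using assms by (simp add: field_simps)
  thus ?thesis using assms by (simp add: powr_def exp_of_nat_mult)
qed

lemma levy_arg_root_nat:
  fixes p q j L :: nat
  assumes "0 < p" "0 < q" "0 < x" "0 < L" "z > 0"
    and lnz: "ln z = real p * real L * ln (real p) + real L * ln (real L) - real p * real L * ln x - real q * ln (real q)"
  shows "real p powr (real j * real L * real p / real q) * real L powr (real j * real L / real q) /
           (x powr (real j * real L * real p / real q) * real q ^ j) = exp (real j / real q * ln z)"
proof -
  have "exp (real j / real q * ln z) = exp (real j * real L * real p / real q * ln (real p)) * exp (real j * real L / real q * ln (real L)) /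
      (exp (real j * real L * real p / real q * ln x) * exp (real j * ln (real q)))"
    unfolding lnz exp_add[symmetric] exp_diff[symmetric] using assms by (simp add: field_simps)
  thus ?thesis using assms by (simp add: powr_def exp_of_nat_mult)
qed

theorem theorem2p1:
  fixes p q l1 l2 :: nat and x :: real
  assumes "0 < p" and "p < q" and "0 < l1" and "0 < l2" and "0 < x"
  defines "\<alpha> \<equiv> (real p / real q) powr (real l2 / real l1)"
      and "l \<equiv> (real p / real q) powr (real l2 / real l1 - 1)"
  shows
   "((\<not> (\<exists>k::nat. 0 < k \<and> l = real k)) \<and> l1 \<noteq> l2 \<longrightarrow>
      (\<forall>c c'. 0 < c \<and> c < \<alpha> \<and>
          fox_separating q 0 ((1, l) # map (\<lambda>k. (real k / real p, l)) [1..<p])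
                             ((1, 1) # map (\<lambda>k. (real k / real q, 1)) [1..<q]) c' \<longrightarrow>
        levy_density \<alpha> c x =
          complex_of_real (l * sqrt (real p * real q) / (x * (2 * pi) powr ((real q - real p) / 2))) *
          fox_H q 0 ((1, l) # map (\<lambda>k. (real k / real p, l)) [1..<p])
                    ((1, 1) # map (\<lambda>k. (real k / real q, 1)) [1..<q]) c'
                (real p powr (real p * l) / (x powr (real p * l) * real q ^ q))
        \<and>
        levy_density \<alpha> c x = complex_of_real (
          l * sqrt (real p * real q) / (x * (2 * pi) powr ((real q - real p) / 2)) *
            (real p powr (l * real p) / (x powr (l * real p) * real q ^ q)) *
            wright_psi (map (\<lambda>i. (- (real q - real i) / real q, -1)) [1..<q])
                       ((1 - l, - l) # map (\<lambda>k. ((real k * real q - real p * l * real q) / (real p * real q), - l)) [1..<p])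
                       (- (real p powr (real p * l) / (x powr (real p * l) * real q ^ q)))
          + l * sqrt (real p * real q) / (x * (2 * pi) powr ((real q - real p) / 2)) *
            (\<Sum>j = 1..q - 1.
              (real p powr (real j * l * real p / real q) / (x powr (real j * l * real p / real q) * real q ^ j)) *
              wright_psi ((1 - levy_jump q j q, -1) # map (\<lambda>k. (real k / real q - levy_jump q j k, -1)) [2..<q])
                         (((real p * real q - real j * real p * l) / (real p * real q), - l) #
                           map (\<lambda>k. ((real k * real q - real j * real p * l) / (real p * real q), - l)) [1..<p])
                         (- (real p powr (real p * l) / (x powr (real p * l) * real q ^ q)))))))
    \<and>
    (l = 1 \<and> l1 = l2 \<longrightarrow>
      (\<forall>c c'. 0 < c \<and> c < \<alpha> \<and>
          fox_separating (q - 1) 0 (map (\<lambda>k. (real k / real p, 1)) [1..<p])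
                                   (map (\<lambda>k. (real k / real q, 1)) [1..<q]) c' \<longrightarrow>
        levy_density \<alpha> c x =
          complex_of_real (sqrt (real p * real q) / (x * (2 * pi) powr ((real q - real p) / 2))) *
          fox_H (q - 1) 0 (map (\<lambda>k. (real k / real p, 1)) [1..<p])
                          (map (\<lambda>k. (real k / real q, 1)) [1..<q]) c'
                (real p ^ p / (x ^ p * real q ^ q))
        \<and>
        levy_density \<alpha> c x = complex_of_real (
          sqrt (real p * real q) / (x * (2 * pi) powr ((real q - real p) / 2)) *
            (\<Sum>j = 1..q - 1.
              (real p powr (real j * real p / real q) / (x powr (real j * real p / real q) * real q ^ j)) *
              ((\<Prod>i1 = 2..q - 1. Gamma (real i1 / real q - levy_jump q j i1)) *
               (\<Prod>i2 = 1..p - 1. rGamma ((real i2 * real q - real j * real p) / (real p * real q)))) *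
              hyperF (map (\<lambda>i. 1 - (real i * real q - real j * real p) / (real p * real q)) [1..<p])
                     (map (\<lambda>i. 1 - real i / real q + levy_jump q j i) [2..<q])
                     ((-1) ^ (q - p) * (real p ^ p / (x ^ p * real q ^ q)))))))
    \<and>
    (\<forall>L::nat. 2 \<le> L \<and> l = real L \<and> l1 \<noteq> l2 \<longrightarrow>
      (\<forall>c c'. 0 < c \<and> c < \<alpha> \<and>
          fox_separating (q - 1) 0 (map (\<lambda>k. (real k / real L, 1)) [1..<L] @ map (\<lambda>k. (real k / real p, l)) [1..<p])
                                   (map (\<lambda>k. (real k / real q, 1)) [1..<q]) c' \<longrightarrow>
        levy_density \<alpha> c x =
          complex_of_real (sqrt (real p * real q * l) / (x * (2 * pi) powr ((real q + 1 - real p - l) / 2))) *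
          fox_H (q - 1) 0 (map (\<lambda>k. (real k / real L, 1)) [1..<L] @ map (\<lambda>k. (real k / real p, l)) [1..<p])
                          (map (\<lambda>k. (real k / real q, 1)) [1..<q]) c'
                (real p powr (real p * l) * l powr l / (x powr (real p * l) * real q ^ q))
        \<and>
        levy_density \<alpha> c x = complex_of_real (
          sqrt (real p * real q * l) / (x * (2 * pi) powr ((real q + 1 - l - real p) / 2)) *
            (\<Sum>j = 1..q - 1.
              (real p powr (real j * l * real p / real q) * l powr (real j * l / real q) /
                 (x powr (real j * l * real p / real q) * real q ^ j)) *
              wright_psi (map (\<lambda>k. (real k / real q - levy_jump q j k, -1)) [2..<q])
                         (map (\<lambda>k. ((real k * real q - real j * l) / (l * real q), -1)) [1..<L] @
                          map (\<lambda>k. ((real k * real q - real j * real p * l) / (real p * real q), - l)) [1..<p])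
                         (- (real p powr (real p * l) * l powr l / (x powr (real p * l) * real q ^ q)))))))"
proof -
  have q: "0 < q" "0 < real p / real q" "real p / real q < 1" using assms(1,2) by auto
  have l: "0 < l" using q assms(1) by (simp add: l_def)
  have \<alpha>_eq: "\<alpha> = real p * l / real q"
    using q by (simp add: \<alpha>_def l_def powr_diff)
  have \<alpha>: "0 < \<alpha>" "\<alpha> < 1"
  proof -
    show "0 < \<alpha>" using q assms(1) by (simp add: \<alpha>_def)
    have "\<alpha> < 1 powr (real l2 / real l1)"
      unfolding \<alpha>_def using q assms by (intro powr_less_mono2) auto
    thus "\<alpha> < 1" by simp
  qed
  have pl: "real p * l < real q" using \<alpha>(2) q by (simp add: \<alpha>_eq)
  define S where "S = suminf (levy_series_term \<alpha> (x powr - \<alpha>))"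
  \<comment> \<open>The part of the series with m = n + 1 congruent to j modulo q;
    \<open>T q\<close> is the class of 0.\<close>
  define T where "T = (\<lambda>j. \<Sum>i. levy_series_term \<alpha> (x powr - \<alpha>) (q * i + (j - 1)))"
  have dens: "levy_density \<alpha> c x = of_real (\<alpha> / x * S)" if "0 < c" "c < \<alpha>" for c
    unfolding S_def by (rule levy_density_eq_series) (use \<alpha> assms that in auto)
  have S: "S = T q + (\<Sum>j=1..q-1. T j)"
    unfolding S_def T_def by (rule suminf_levy_series_split) (use assms \<alpha> in auto)

  define z where "z = real p powr (real p * l) / (x powr (real p * l) * real q ^ q)"
  have z: "z > 0" using assms(1,5) q by (simp add: z_def)
  have lnz: "ln z = real p * l * ln (real p) - real p * l * ln x - real q * ln (real q)"
    using assms(1,5) q by (simp add: z_def ln_div ln_mult ln_powr ln_realpow)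
  define K where "K = l * sqrt (real p * real q) / (x * (2 * pi) powr ((real q - real p) / 2))"
  have K: "K * (gauss_const q / (gauss_const p * real q)) = \<alpha> / x"
    unfolding K_def \<alpha>_eq using assms by (intro gauss_const_ratio) auto

  have nat: "L > 0 \<Longrightarrow> p * L < q" if "l = real L" for L :: nat
    using pl unfolding that by (simp flip: of_nat_mult)
  have S_nat: "S = (\<Sum>j=1..q-1. T j)" if "l = real L" for L :: nat
  proof -
    have L: "L > 0" using l that by simp
    show ?thesis unfolding S_def T_def \<alpha>_eq that
      by (rule suminf_levy_series_split_nat) (use assms L nat[OF that L] in auto)
  qed
  have K_nat: "sqrt (real p * real q * l) / (x * (2 * pi) powr ((real q + 1 - real p - l) / 2)) *
      (gauss_const q / (gauss_const p * gauss_const L * real q)) = \<alpha> / x" if "l = real L" for L :: nat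
  proof -
    have "L > 0" using l that by simp
    thus ?thesis unfolding \<alpha>_eq that using assms(1,5) q(1) by (intro gauss_const_ratio_nat)
  qed

  \<comment> \<open>Each Fox form thus reduces to k * g = \<alpha> / x, where k is the prefactor in
    the theorem and g collects the Gauss constants.\<close>
  have comb: "of_real (\<alpha> / x * S) = complex_of_real k * of_real (g * S)" if "k * g = \<alpha> / x" for k g
    unfolding that[symmetric] by simp
  have sumT: "k * (\<Sum>j=1..q-1. g * T j) = \<alpha> / x * (\<Sum>j=1..q-1. T j)" if "k * g = \<alpha> / x" for k g
    unfolding that[symmetric] by (simp add: sum_distrib_left mult.assoc)
  show ?thesis
  \<comment> \<open>The six goals are the Fox form and the series form of (i), then of (ii), then of
    (iii).\<close>
  proof (intro conjI impI allI, goal_cases)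
    case (1 c c')
    note c = 1(2)[THEN conjunct1] 1(2)[THEN conjunct2, THEN conjunct1]
      and sep = 1(2)[THEN conjunct2, THEN conjunct2]
    show ?case unfolding K_def[symmetric] z_def[symmetric] dens[OF c]
        fox_H_levy[OF assms(1,2) l pl assms(5) z lnz sep, folded \<alpha>_eq, folded S_def]
      by (rule comb[OF K])
  next
    case (2 c c')
    have z': "real p powr (l * real p) / (x powr (l * real p) * real q ^ q) = z"
      by (simp add: z_def mult.commute)
    have s1: "(\<Sum>j = 1..q - 1. real p powr (real j * l * real p / real q) / (x powr (real j * l * real p / real q) * real q ^ j) *
              wright_psi ((1 - levy_jump q j q, -1) # map (\<lambda>k. (real k / real q - levy_jump q j k, -1)) [2..<q])
                         (((real p * real q - real j * real p * l) / (real p * real q), - l) #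
                           map (\<lambda>k. ((real k * real q - real j * real p * l) / (real p * real q), - l)) [1..<p]) (- z)) =
          (\<Sum>j = 1..q - 1. gauss_const q / (gauss_const p * real q) * T j)"
    proof (intro sum.cong refl)
      fix j assume j: "j \<in> {1..q - 1}"
      hence "1 \<le> j" "j < q" by auto
      thus "real p powr (real j * l * real p / real q) / (x powr (real j * l * real p / real q) * real q ^ j) *
              wright_psi ((1 - levy_jump q j q, -1) # map (\<lambda>k. (real k / real q - levy_jump q j k, -1)) [2..<q])
                         (((real p * real q - real j * real p * l) / (real p * real q), - l) #
                           map (\<lambda>k. ((real k * real q - real j * real p * l) / (real p * real q), - l)) [1..<p]) (- z) =
            gauss_const q / (gauss_const p * real q) * T j"
        unfolding levy_arg_root[OF assms(1) q(1) assms(5) z lnz] T_def \<alpha>_eq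
        by (intro wright_psi_levy assms l pl z lnz)
    qed
    have s2: "z * wright_psi (map (\<lambda>i. (- (real q - real i) / real q, -1)) [1..<q])
             ((1 - l, - l) # map (\<lambda>k. ((real k * real q - real p * l * real q) / (real p * real q), - l)) [1..<p]) (- z) =
        gauss_const q / (gauss_const p * real q) * T q"
      unfolding T_def \<alpha>_eq by (intro wright_psi_levy_last assms l pl z lnz)
    have s3: "K * (g * T q) + K * (\<Sum>j = 1..q - 1. g * T j) = K * g * S" for g
      unfolding S by (simp add: sum_distrib_left algebra_simps)
    note c = 2(2)[THEN conjunct1] 2(2)[THEN conjunct2, THEN conjunct1]
    show ?case unfolding K_def[symmetric] z_def[symmetric] z' mult.assoc[of K]
      unfolding s1 s2 s3 K by (rule dens[OF c])
  next
    case (3 c c')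
    have l1: "l = real (1::nat)" using 3 by simp
    have \<zeta>: "real p ^ p / (x ^ p * real q ^ q) > 0"
      "ln (real p ^ p / (x ^ p * real q ^ q)) = real p * real 1 * ln (real p) + real 1 * ln (real 1) -
         real p * real 1 * ln x - real q * ln (real q)"
      using assms(1,5) q by (auto simp: ln_div ln_mult ln_realpow)
    \<comment> \<open>Case (ii) is the reduced Fox function for L = 1: the L-part of the parameters
      is empty and \<open>gauss_const 1\<close> is 1.\<close>
    have as: "map (\<lambda>k. (real k / real p, 1)) [1..<p] =
        map (\<lambda>k. (real k / real 1, 1)) [1..<1] @ map (\<lambda>k. (real k / real p, real 1)) [1..<p]" by simp
    note c = 3(2)[THEN conjunct1] 3(2)[THEN conjunct2, THEN conjunct1]
      and sep = 3(2)[THEN conjunct2, THEN conjunct2]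
    have \<alpha>1: "real p * real 1 / real q = \<alpha>" using l1 \<alpha>_eq by simp
    have "p * 1 < q" using assms(2) by simp
    note fox = fox_H_levy_nat[OF assms(1,2) zero_less_one this assms(5) \<zeta> sep as, unfolded \<alpha>1, folded S_def]
    have "sqrt (real p * real q) / (x * (2 * pi) powr ((real q - real p) / 2)) *
        (gauss_const q / (gauss_const p * gauss_const 1 * real q)) = \<alpha> / x"
      using K l1 by (simp add: K_def gauss_const_def[of "Suc 0"])
    thus ?case unfolding dens[OF c] fox by (rule comb)
  next
    case (4 c c')
    have l1: "l = real (1::nat)" using 4 by simp
    define \<zeta> where "\<zeta> = real p ^ p / (x ^ p * real q ^ q)"
    have \<zeta>: "\<zeta> > 0" "ln \<zeta> = real p * ln (real p) - real p * ln x - real q * ln (real q)"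
      using assms(1,5) q by (auto simp: \<zeta>_def ln_div ln_mult ln_realpow)
    have "(\<Sum>j = 1..q - 1.
              (real p powr (real j * real p / real q) / (x powr (real j * real p / real q) * real q ^ j)) *
              ((\<Prod>i1 = 2..q - 1. Gamma (real i1 / real q - levy_jump q j i1)) *
               (\<Prod>i2 = 1..p - 1. rGamma ((real i2 * real q - real j * real p) / (real p * real q)))) *
              hyperF (map (\<lambda>i. 1 - (real i * real q - real j * real p) / (real p * real q)) [1..<p])
                     (map (\<lambda>i. 1 - real i / real q + levy_jump q j i) [2..<q])
                     ((-1) ^ (q - p) * \<zeta>)) = (\<Sum>j = 1..q - 1. gauss_const q / (gauss_const p * real q) * T j)"
    proof (intro sum.cong refl)
      fix j assume j: "j \<in> {1..q - 1}"
      hence j': "1 \<le> j" "j < q" by auto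
      have "real p powr (real j * real p / real q) / (x powr (real j * real p / real q) * real q ^ j) =
          exp (real j / real q * ln \<zeta>)"
        using levy_arg_root[of p q x \<zeta> 1 j] assms q \<zeta> by simp
      moreover have "\<alpha> = real p / real q" using l1 \<alpha>_eq by simp
      ultimately show "real p powr (real j * real p / real q) / (x powr (real j * real p / real q) * real q ^ j) *
              ((\<Prod>i1 = 2..q - 1. Gamma (real i1 / real q - levy_jump q j i1)) *
               (\<Prod>i2 = 1..p - 1. rGamma ((real i2 * real q - real j * real p) / (real p * real q)))) *
              hyperF (map (\<lambda>i. 1 - (real i * real q - real j * real p) / (real p * real q)) [1..<p])
                     (map (\<lambda>i. 1 - real i / real q + levy_jump q j i) [2..<q])
                     ((-1) ^ (q - p) * \<zeta>) = gauss_const q / (gauss_const p * real q) * T j"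
        unfolding T_def by (simp only:) (intro hyperF_levy assms \<zeta> j')
    qed
    moreover have "sqrt (real p * real q) / (x * (2 * pi) powr ((real q - real p) / 2)) *
        (\<Sum>j = 1..q - 1. gauss_const q / (gauss_const p * real q) * T j) = \<alpha> / x * S"
      unfolding S_nat[OF l1] by (rule sumT) (use K l1 in \<open>simp add: K_def\<close>)
    ultimately show ?case
      unfolding \<zeta>_def[symmetric] using dens[of c] 4 by simp
  next
    case (5 L c c')
    have L: "l = real L" "L > 0" using 5 by auto
    define \<zeta> where "\<zeta> = real p powr (real p * real L) * real L powr real L / (x powr (real p * real L) * real q ^ q)"
    have \<zeta>: "\<zeta> > 0" "ln \<zeta> = real p * real L * ln (real p) + real L * ln (real L) - real p * real L * ln x - real q * ln (real q)"
      using assms(1,5) q L by (auto simp: \<zeta>_def ln_div ln_mult ln_powr ln_realpow)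
    note c = 5(2)[THEN conjunct1] 5(2)[THEN conjunct2, THEN conjunct1]
      and sep = 5(2)[THEN conjunct2, THEN conjunct2, unfolded L(1)]
    have \<alpha>L: "real p * real L / real q = \<alpha>" using L \<alpha>_eq by simp
    note fox = fox_H_levy_nat[OF assms(1,2) L(2) nat[OF L] assms(5) \<zeta> sep refl, unfolded \<alpha>L, folded S_def]
    show ?case using comb[OF K_nat[OF L(1)]] unfolding dens[OF c] L(1) \<zeta>_def[symmetric] fox .
  next
    case (6 L c c')
    have L: "l = real L" "L > 0" using 6 by auto
    define \<zeta> where "\<zeta> = real p powr (real p * real L) * real L powr real L / (x powr (real p * real L) * real q ^ q)"
    have \<zeta>: "\<zeta> > 0" "ln \<zeta> = real p * real L * ln (real p) + real L * ln (real L) - real p * real L * ln x - real q * ln (real q)"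
      using assms(1,5) q L by (auto simp: \<zeta>_def ln_div ln_mult ln_powr ln_realpow)
    define g where "g = gauss_const q / (gauss_const p * gauss_const L * real q)"
    have "(\<Sum>j = 1..q - 1.
              (real p powr (real j * real L * real p / real q) * real L powr (real j * real L / real q) /
                 (x powr (real j * real L * real p / real q) * real q ^ j)) *
              wright_psi (map (\<lambda>k. (real k / real q - levy_jump q j k, -1)) [2..<q])
                         (map (\<lambda>k. ((real k * real q - real j * real L) / (real L * real q), -1)) [1..<L] @
                          map (\<lambda>k. ((real k * real q - real j * real p * real L) / (real p * real q), - real L)) [1..<p])
                         (- \<zeta>)) = (\<Sum>j = 1..q - 1. g * T j)"
    proof (intro sum.cong refl)
      fix j assume j: "j \<in> {1..q - 1}"
      hence "1 \<le> j" "j < q" by auto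
      thus "(real p powr (real j * real L * real p / real q) * real L powr (real j * real L / real q) /
                 (x powr (real j * real L * real p / real q) * real q ^ j)) *
              wright_psi (map (\<lambda>k. (real k / real q - levy_jump q j k, -1)) [2..<q])
                         (map (\<lambda>k. ((real k * real q - real j * real L) / (real L * real q), -1)) [1..<L] @
                          map (\<lambda>k. ((real k * real q - real j * real p * real L) / (real p * real q), - real L)) [1..<p])
                         (- \<zeta>) = g * T j"
        unfolding levy_arg_root_nat[OF assms(1) q(1) assms(5) L(2) \<zeta>] T_def \<alpha>_eq g_def unfolding L(1)
        by (intro wright_psi_levy_nat assms L nat[OF L] \<zeta>)
    qed
    moreover have "sqrt (real p * real q * real L) / (x * (2 * pi) powr ((real q + 1 - real L - real p) / 2)) *
        (\<Sum>j = 1..q - 1. g * T j) = \<alpha> / x * S"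
    proof -
      have e: "real q + 1 - real L - real p = real q + 1 - real p - real L" by simp
      show ?thesis using sumT[OF K_nat[OF L(1)]] unfolding S_nat[OF L(1)] e L(1) g_def .
    qed
    ultimately show ?case
      unfolding L(1) \<zeta>_def[symmetric] using dens[of c] 6 by simp
  qed
qed

end
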